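(* Let $r\ge0$ be an integer, let $\sigma:\mathbb{R}\to\mathbb{R}$ be a bounded, non-constant activation function of class $C^{r+2}$, and let $\varphi\in LdA^{r+1}(T^*Q)$ be a Lagrange-d'Alembert map of class $C^{r+1}$. Then for every compact set $K\subset T^*Q$ and every $\epsilon>0$ there exists a finite sequence of maps $LDE_{\tilde T_i,\tilde U_i,\tilde f_i}\in LDE^{r+1}_{\mathcal{N}_\sigma}(T^*Q)$, $i=1,\dots,m$, such that $$\big\|\varphi-LDE_{\tilde T_m,\tilde U_m,\tilde f_m}\circ\cdots\circ LDE_{\tilde T_1,\tilde U_1,\tilde f_1}\big\|_{C^r(K)}<\epsilon.$$
   Context: Setting: $Q=\mathbb{R}^n$ and $T^*Q=\mathbb{R}^n\times\mathbb{R}^n$ with coordinates $(q,p)$; $TQ=\mathbb{R}^n\times\mathbb{R}^n$. A time-dependent forced Hamiltonian system with Hamiltonian $H:T^*Q\times[0,\mathcal{T}]\to\mathbb{R}$ and forcing $f:T^*Q\times[0,\mathcal{T}]\to\mathbb{R}^n$ is $$\dot q=\frac{\partial H}{\partial p}(q,p,t),\qquad \dot p=-\frac{\partial H}{\partial q}(q,p,t)+f(q,p,t).$$ Standing assumptions (A) (for given $\mathcal{T}>0$ and integer $r\ge0$): (i) $H\in C^{r+2}(T^*Q\times[0,\mathcal{T}])$ and $f\in C^{r+1}(T^*Q\times[0,\mathcal{T}],\mathbb{R}^n)$; (ii) $H$ is hyperregular: for every $t\in[0,\mathcal{T}]$ the map $T^*Q\ni(q,p)\mapsto(q,\frac{\partial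 H}{\partial p}(q,p,t))\in TQ$ is a diffeomorphism; (iii) for every $(q_0,p_0)\in T^*Q$ and $t_0\in[0,\mathcal{T}]$ the solution with $(q(t_0),p(t_0))=(q_0,p_0)$ exists on all of $[0,\mathcal{T}]$, i.e. the flow map $F_{t,t_0}:T^*Q\to T^*Q$ is well defined for all $t,t_0\in[0,\mathcal{T}]$. Lagrange-d'Alembert map: a diffeomorphism $\varphi:T^*Q\to T^*Q$ is a Lagrange-d'Alembert map of class $C^{r+1}$ if there is a time-dependent forced Hamiltonian system satisfying (A) for some $\mathcal{T}>0$, with flow $F_{t,t_0}$, such that $\varphi=F_{\mathcal{T},0}$. The set of all of them is $LdA^{r+1}(T^*Q)$. Lagrange-d'Alembert-Euler map: for $T,U:\mathbb{R}^n\to\mathbb{R}$ and $f:\mathbb{R}^{2n}\to\mathbb{R}^n$, $LDE_{T,U,f}:T^*Q\to T^*Q$ is the map $(q,p)\mapsto(q',p')$ with $$q'=q+\frac{\partial T}{\partial p}(p),\qquad p'=p-\frac{\partial U}{\partial q}(q')+f(q',p).$$ Neural networks: $\mathcal{A}^s$ is the set of bounded non-constant functions $\sigma:\mathbb{R}\to\mathbb{R}$ of class $C^s$. For $\sigma\in\mathcal{A}^s$, $\mathcal{N}^s_\sigma(\mathbb{R}^a,\mathbb{R}^b)$ is the set of all multilayer perceptrons $\mathbb{R}^a\to\mathbb{R}^b$ with activation $\sigma$: alternating compositions of affine maps and componentwise application of $\sigma$, with any number ($\ge1$) of hidden layers of arbitrary finite widths and an affine output layer. For an integer $s\ge0$ and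 $\sigma\in\mathcal{A}^{s+1}$, $$LDE^s_{\mathcal{N}_\sigma}(T^*Q)=\{LDE_{\tilde T,\tilde U,\tilde f}\mid \tilde T,\tilde U\in\mathcal{N}^{s+1}_\sigma(\mathbb{R}^n,\mathbb{R}),\ \tilde f\in\mathcal{N}^s_\sigma(\mathbb{R}^{2n},\mathbb{R}^n)\},$$ with the same activation $\sigma$ for all three networks. $\|\cdot\|_{C^r(K)}$ is the usual $C^r$ norm on $K$ (maximum over $0\le l\le r$ of the supremum over $K$ of the norm of the $l$-th derivative). *)

theory Defs
  imports "HOL-Analysis.Analysis"
begin

section \<open>Functions of class \<open>C\<^sup>k\<close> and the \<open>C\<^sup>r\<close> norm\<close>

text \<open>
  Higher derivatives are iterated directional derivatives:
  \<open>iter_deriv S g [v\<^sub>1, \<dots>, v\<^sub>l] x\<close> is the \<open>l\<close>-th derivative of \<open>g\<close> at \<open>x\<close> applied to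
  \<open>v\<^sub>1, \<dots>, v\<^sub>l\<close>. On a finite-dimensional space, differentiability (continuity) of all
  \<open>x \<mapsto> Dg(x) v\<close> is differentiability (continuity) of \<open>Dg\<close>. Derivatives are taken within \<open>S\<close>,
  i.e. one-sided at boundary points; they are unique for the sets used below
  (\<open>UNIV\<close> and \<open>UNIV \<times> {0..\<tau>}\<close> with \<open>\<tau> > 0\<close>).
\<close>

primrec C_on :: "nat \<Rightarrow> 'a::euclidean_space set \<Rightarrow> ('a \<Rightarrow> 'b::real_normed_vector) \<Rightarrow> bool" where
  "C_on 0 S g \<longleftrightarrow> continuous_on S g"
| "C_on (Suc k) S g \<longleftrightarrow> g differentiable_on S \<and>
     (\<forall>v. C_on k S (\<lambda>x. frechet_derivative g (at x within S) v))"

primrec iter_deriv ::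
  "'a::euclidean_space set \<Rightarrow> ('a \<Rightarrow> 'b::real_normed_vector) \<Rightarrow> 'a list \<Rightarrow> 'a \<Rightarrow> 'b" where
  "iter_deriv S g [] = g"
| "iter_deriv S g (v # vs) = iter_deriv S (\<lambda>x. frechet_derivative g (at x within S) v) vs"

definition deriv_norm ::
  "nat \<Rightarrow> ('a::euclidean_space \<Rightarrow> 'b::real_normed_vector) \<Rightarrow> 'a \<Rightarrow> ennreal" where
  "deriv_norm l g x =
     (SUP vs\<in>{vs. length vs = l \<and> (\<forall>v\<in>set vs. norm v \<le> 1)}. ennreal (norm (iter_deriv UNIV g vs x)))"

text \<open>
  The values are in \<^typ>\<open>ennreal\<close>, so that suprema of unbounded sets are \<open>\<infinity>\<close> and the supremum
  over the empty set is \<open>0\<close>.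
\<close>

definition C_norm ::
  "nat \<Rightarrow> 'a::euclidean_space set \<Rightarrow> ('a \<Rightarrow> 'b::real_normed_vector) \<Rightarrow> ennreal" where
  "C_norm r K g = Max ((\<lambda>l. SUP x\<in>K. deriv_norm l g x) ` {0..r})"

definition diffeomorphism ::
  "nat \<Rightarrow> ('a::euclidean_space \<Rightarrow> 'b::euclidean_space) \<Rightarrow> bool" where
  "diffeomorphism k g \<longleftrightarrow> bij g \<and> C_on k UNIV g \<and> C_on k UNIV (inv g)"

definition gradient :: "('a::euclidean_space \<Rightarrow> real) \<Rightarrow> 'a \<Rightarrow> 'a" where
  "gradient g x = (THE D. GDERIV g x :> D)"


section \<open>Forced Hamiltonian systems and Lagrange-d'Alembert maps\<close>

text \<open>
  \<open>'n phase\<close> is \<open>T\<^sup>*Q\<close> (and also \<open>TQ\<close>) for \<open>Q = \<real>\<^sup>n\<close>. The functions \<open>H\<close> and \<open>f\<close> on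
  \<open>T\<^sup>*Q \<times> [0, \<tau>]\<close> are represented by total functions; their values at times outside
  \<open>[0, \<tau>]\<close> play no role.
\<close>

type_synonym 'n phase = "(real, 'n) vec \<times> (real, 'n) vec"

definition grad_q :: "('n::finite phase \<times> real \<Rightarrow> real) \<Rightarrow> 'n phase \<Rightarrow> real \<Rightarrow> real ^ 'n" where
  "grad_q H z t = gradient (\<lambda>q. H ((q, snd z), t)) (fst z)"

definition grad_p :: "('n::finite phase \<times> real \<Rightarrow> real) \<Rightarrow> 'n phase \<Rightarrow> real \<Rightarrow> real ^ 'n" where
  "grad_p H z t = gradient (\<lambda>p. H ((fst z, p), t)) (snd z)"

definition hamilton_solution ::
  "('n::finite phase \<times> real \<Rightarrow> real) \<Rightarrow> ('n phase \<times> real \<Rightarrow> real ^ 'n) \<Rightarrow> real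
    \<Rightarrow> (real \<Rightarrow> 'n phase) \<Rightarrow> bool" where
  "hamilton_solution H f \<tau> z \<longleftrightarrow>
     (\<forall>t\<in>{0..\<tau>}. (z has_vector_derivative
        (grad_p H (z t) t, - grad_q H (z t) t + f (z t, t))) (at t within {0..\<tau>}))"

definition flow ::
  "('n::finite phase \<times> real \<Rightarrow> real) \<Rightarrow> ('n phase \<times> real \<Rightarrow> real ^ 'n) \<Rightarrow> real
    \<Rightarrow> real \<Rightarrow> real \<Rightarrow> 'n phase \<Rightarrow> 'n phase" where
  "flow H f \<tau> t t\<^sub>0 z\<^sub>0 = (THE w. \<exists>z. hamilton_solution H f \<tau> z \<and> z t\<^sub>0 = z\<^sub>0 \<and> z t = w)"

text \<open>
  Under the regularity assumptions solutions are unique, hence \<^const>\<open>flow\<close> is well defined as soon as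
  solutions exist. The Legendre map of a \<open>C\<^sup>r\<^sup>+\<^sup>2\<close> Hamiltonian is \<open>C\<^sup>r\<^sup>+\<^sup>1\<close>, which is the class
  in which hyperregularity is understood.
\<close>

definition hyperregular :: "nat \<Rightarrow> ('n::finite phase \<times> real \<Rightarrow> real) \<Rightarrow> real \<Rightarrow> bool" where
  "hyperregular k H \<tau> \<longleftrightarrow> (\<forall>t\<in>{0..\<tau>}. diffeomorphism k (\<lambda>z. (fst z, grad_p H z t)))"

definition standing_assumptions ::
  "nat \<Rightarrow> real \<Rightarrow> ('n::finite phase \<times> real \<Rightarrow> real) \<Rightarrow> ('n phase \<times> real \<Rightarrow> real ^ 'n) \<Rightarrow> bool" where
  "standing_assumptions r \<tau> H f \<longleftrightarrow>
     C_on (r + 2) (UNIV \<times> {0..\<tau>}) H \<and>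
     C_on (r + 1) (UNIV \<times> {0..\<tau>}) f \<and>
     hyperregular (r + 1) H \<tau> \<and>
     (\<forall>z\<^sub>0. \<forall>t\<^sub>0\<in>{0..\<tau>}. \<exists>z. hamilton_solution H f \<tau> z \<and> z t\<^sub>0 = z\<^sub>0)"

definition LdA :: "nat \<Rightarrow> ('n::finite phase \<Rightarrow> 'n phase) set" where
  "LdA k = {\<phi>. diffeomorphism k \<phi> \<and>
     (\<exists>r \<tau> H f. k = r + 1 \<and> \<tau> > 0 \<and> standing_assumptions r \<tau> H f \<and> \<phi> = flow H f \<tau> \<tau> 0)}"


section \<open>Neural networks and Lagrange-d'Alembert-Euler maps\<close>

definition activations :: "nat \<Rightarrow> (real \<Rightarrow> real) set" where
  "activations s = {\<sigma>. bounded (range \<sigma>) \<and> \<not> \<sigma> constant_on UNIV \<and> C_on s UNIV \<sigma>}"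

text \<open>
  \<open>hidden_layers \<sigma> N h\<close>: the map \<open>x \<mapsto> (h x 0, \<dots>, h x (N - 1))\<close> into \<open>\<real>\<^sup>N\<close> is the output of the
  last of one or more hidden layers, the last one having width \<open>N\<close>. The values \<open>h x j\<close> with
  \<open>j \<ge> N\<close> are never used. Every linear functional on the input space has the form \<open>x \<mapsto> w \<bullet> x\<close>, and
  every linear map from \<open>\<real>\<^sup>N\<close> to the output space has the form
  \<open>y \<mapsto> (\<Sum>j<N. y j *\<^sub>R v j)\<close>.
\<close>

inductive hidden_layers ::
  "(real \<Rightarrow> real) \<Rightarrow> nat \<Rightarrow> ('a::euclidean_space \<Rightarrow> nat \<Rightarrow> real) \<Rightarrow> bool" for \<sigma> where
  first: "N \<ge> 1 \<Longrightarrow> hidden_layers \<sigma> N (\<lambda>x j. \<sigma> (w j \<bullet> x + b j))"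
| next_layer: "hidden_layers \<sigma> M h \<Longrightarrow> N \<ge> 1 \<Longrightarrow>
     hidden_layers \<sigma> N (\<lambda>x j. \<sigma> ((\<Sum>k<M. W j k * h x k) + b j))"

definition networks ::
  "nat \<Rightarrow> (real \<Rightarrow> real) \<Rightarrow> ('a::euclidean_space \<Rightarrow> 'b::euclidean_space) set" where
  "networks s \<sigma> = {g. \<sigma> \<in> activations s \<and>
     (\<exists>N h v c. hidden_layers \<sigma> N h \<and> g = (\<lambda>x. (\<Sum>j<N. h x j *\<^sub>R v j) + c))}"

definition LDE ::
  "(real ^ 'n::finite \<Rightarrow> real) \<Rightarrow> (real ^ 'n \<Rightarrow> real) \<Rightarrow> ('n phase \<Rightarrow> real ^ 'n)
    \<Rightarrow> 'n phase \<Rightarrow> 'n phase" where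
  "LDE T U f = (\<lambda>(q, p). let q' = q + gradient T p in (q', p - gradient U q' + f (q', p)))"

definition LDE_networks :: "nat \<Rightarrow> (real \<Rightarrow> real) \<Rightarrow> ('n::finite phase \<Rightarrow> 'n phase) set" where
  "LDE_networks s \<sigma> = {LDE T U f | T U f.
     T \<in> networks (s + 1) \<sigma> \<and> U \<in> networks (s + 1) \<sigma> \<and> f \<in> networks s \<sigma>}"

end

theory Submission
  imports Defs
begin

text \<open>
  Since \<open>f\<close> is arbitrary, every momentum update \<open>(q, p) \<mapsto> (q, G(q, p))\<close> is a limit of LDE maps with
  \<open>T = U = 0\<close>; the choice \<open>T(p) = |p|\<^sup>2 / 2\<close> gives the shear \<open>(q, p) \<mapsto> (q + p, p)\<close>, and these two
  generate the quarter turn \<open>(q, p) \<mapsto> (p, -q)\<close>, hence all position updates \<open>(q, p) \<mapsto> (G(q, p), p)\<close>.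
  By Gaussian elimination they generate all invertible linear maps, and a map \<open>C\<^sup>1\<close>-close to the
  identity is a position update
  followed by a momentum update. Finally \<open>\<phi>\<^sub>s(x) = (\<phi>(s x) - \<phi>(0)) / s\<close> connects the linear map
  \<open>D\<phi>(0)\<close> to \<open>\<phi> - \<phi>(0)\<close>, and \<open>\<phi>\<^sub>s\<^sub>' \<circ> \<phi>\<^sub>s\<^sup>-\<^sup>1\<close> is \<open>C\<^sup>1\<close>-close to the identity on balls when
  \<open>s\<close> and \<open>s'\<close> are close.

  Density of the networks in \<open>C\<^sup>k\<close>: difference quotients of \<open>\<sigma>\<close> give the identity and second
  differences give squares, so deep networks approximate all polynomials, and polynomials are dense.
\<close>

section \<open>Joint \<open>C\<^sup>k\<close> convergence of families\<close>

text \<open>All approximation errors are hidden in one set: the closure, in \<open>C\<^sup>r\<close>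
  on balls, of the compositions of LDE maps. It is closed under composition, and a map belongs to it
  as soon as on every ball it coincides with some member. The last part is therefore about exact
  factorizations on balls. Cut-offs are harmless there, and only \<open>C\<^sup>1\<close> smallness
  has to be estimated, although the final norm has order \<open>r\<close>. The additional derivative
  of \<phi> is what makes \<open>C\<^sup>1\<close> estimates available even for
  \<open>r = 0\<close>. The obstacle is closure under composition: with norms it would require
  moduli of continuity for all derivatives. Families that converge jointly in index and point
  compose without any estimate. Indexing them by a filter treats sequences and the difference
  quotients of \<sigma>, with step tending to 0, in the same way. Orientation is no obstruction,
  because the reflection of the momentum is itself a momentum update.\<close>

definition jlim ::
  "'i filter \<Rightarrow> ('i \<Rightarrow> 'a::topological_space \<Rightarrow> 'b::topological_space) \<Rightarrow> ('a \<Rightarrow> 'b) \<Rightarrow> bool" where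
  "jlim G F f \<longleftrightarrow> (\<forall>x. ((\<lambda>(i, y). F i y) \<longlongrightarrow> f x) (G \<times>\<^sub>F nhds x))"

text \<open>Continuous convergence of all derivatives up to order \<open>k\<close>. For continuous
  limits this amounts to uniform convergence on compact sets, but it passes through compositions at
  once. Directional derivatives keep every level a statement about functions with values in the same
  space.\<close>

primrec Cconv ::
  "nat \<Rightarrow> 'i filter \<Rightarrow> ('i \<Rightarrow> 'a::euclidean_space \<Rightarrow> 'b::real_normed_vector) \<Rightarrow> ('a \<Rightarrow> 'b) \<Rightarrow> bool" where
  "Cconv 0 G F f \<longleftrightarrow> jlim G F f"
| "Cconv (Suc k) G F f \<longleftrightarrow> jlim G F f \<and>
     (\<forall>\<^sub>F i in G. \<forall>x. F i differentiable at x) \<and> (\<forall>x. f differentiable at x) \<and>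
     (\<forall>v. Cconv k G (\<lambda>i x. frechet_derivative (F i) (at x) v) (\<lambda>x. frechet_derivative f (at x) v))"

lemma jlim_cong:
  fixes F :: "'i \<Rightarrow> 'a::topological_space \<Rightarrow> 'b::topological_space"
  assumes "\<forall>\<^sub>F i in G. \<forall>x. F i x = F' i x"
  shows "jlim G F f = jlim G F' f"
proof -
  have "\<forall>\<^sub>F p in G \<times>\<^sub>F nhds x. (case p of (i, y) \<Rightarrow> F i y) = (case p of (i, y) \<Rightarrow> F' i y)" for x :: 'a
    using eventually_prodI[OF assms, of "\<lambda>_. True" "nhds x"] by (auto elim!: eventually_mono)
  from tendsto_cong[OF this] show ?thesis
    unfolding jlim_def by blast
qed

lemma Cconv_jlim: "Cconv k G F f \<Longrightarrow> jlim G F f"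
  by (cases k) auto

lemma Cconv_cong:
  assumes "\<forall>\<^sub>F i in G. \<forall>x. F i x = F' i x"
  shows "Cconv k G F f = Cconv k G F' f"
  using assms
proof (induction k arbitrary: F F' f)
  case 0
  then show ?case by (simp add: jlim_cong)
next
  case (Suc k)
  have ev: "\<forall>\<^sub>F i in G. F i = F' i"
    using Suc.prems by (auto elim!: eventually_mono)
  have 1: "jlim G F f = jlim G F' f" using Suc.prems by (rule jlim_cong)
  have 2: "(\<forall>\<^sub>F i in G. \<forall>x. F i differentiable at x) = (\<forall>\<^sub>F i in G. \<forall>x. F' i differentiable at x)"
    by (rule eventually_cong[OF ev]) auto
  have 3: "\<forall>\<^sub>F i in G. \<forall>x. frechet_derivative (F i) (at x) v = frechet_derivative (F' i) (at x) v" for v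
    using ev by (auto elim!: eventually_mono)
  show ?case
    using 1 2 Suc.IH[OF 3] by simp
qed

lemma Cconv_Suc_D: "Cconv (Suc k) G F f \<Longrightarrow> Cconv k G F f"
proof (induction k arbitrary: F f)
  case (Suc k)
  have "Cconv k G (\<lambda>i x. frechet_derivative (F i) (at x) v) (\<lambda>x. frechet_derivative f (at x) v)" for v
    using Suc.prems by (intro Suc.IH) (simp only: Cconv.simps(2)[of "Suc k"])
  then show ?case using Suc.prems by simp
qed auto

lemma Cconv_mono:
  assumes "Cconv m G F f" "k \<le> m"
  shows "Cconv k G F f"
  using assms(2,1) by (induction rule: inc_induct) (auto intro: Cconv_Suc_D simp del: Cconv.simps)

text \<open>The derivatives may be supplied by any formula; uniqueness of derivatives identifies it
  with \<open>frechet_derivative\<close>, for the family eventually along \<open>G\<close>.\<close>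

lemma Cconv_SucI:
  assumes "jlim G F f"
    and "\<forall>\<^sub>F i in G. \<forall>x. (F i has_derivative F' i x) (at x)"
    and "\<And>x. (f has_derivative f' x) (at x)"
    and "\<And>v. Cconv k G (\<lambda>i x. F' i x v) (\<lambda>x. f' x v)"
  shows "Cconv (Suc k) G F f"
proof -
  have 1: "\<forall>\<^sub>F i in G. \<forall>x. F i differentiable at x"
    using assms(2) by eventually_elim (auto simp: differentiable_def)
  have 2: "\<forall>\<^sub>F i in G. \<forall>x. F' i x v = frechet_derivative (F i) (at x) v" for v
    using assms(2) by eventually_elim (metis frechet_derivative_at)
  have 3: "f' x = frechet_derivative f (at x)" for x
    using assms(3) frechet_derivative_at by blast
  show ?thesis
    using assms(1,3,4) 1 Cconv_cong[OF 2] by (auto simp: 3 differentiable_def simp del: Cconv.simps(1))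
qed

lemma Cconv_deriv: "Cconv (Suc k) G F f \<Longrightarrow>
   Cconv k G (\<lambda>i x. frechet_derivative (F i) (at x) v) (\<lambda>x. frechet_derivative f (at x) v)"
  by simp

lemma Cconv_ev_deriv:
  assumes "Cconv (Suc k) G F f"
  shows "\<forall>\<^sub>F i in G. \<forall>x. (F i has_derivative frechet_derivative (F i) (at x)) (at x)"
proof -
  have "\<forall>\<^sub>F i in G. \<forall>x. F i differentiable at x" using assms by simp
  then show ?thesis by eventually_elim (auto simp: frechet_derivative_works)
qed

lemma Cconv_lim_deriv:
  "Cconv (Suc k) G F f \<Longrightarrow> (f has_derivative frechet_derivative f (at x)) (at x)"
  by (auto simp: frechet_derivative_works)

text \<open>For \<open>G \<noteq> bot\<close> the second projection of the product filter is all of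
  \<open>nhds x\<close>, so for a family without index the joint limit is the ordinary limit at
  \<open>x\<close>.\<close>

lemma jlim_const_iff:
  fixes f :: "'a::topological_space \<Rightarrow> 'b::topological_space"
  assumes "G \<noteq> bot"
  shows "jlim G (\<lambda>_. f) f \<longleftrightarrow> continuous_on UNIV f"
proof -
  have "filtermap snd (G \<times>\<^sub>F nhds x) = nhds x" for x :: 'a
  proof (rule antisym[OF filtermap_snd_prod_filter])
    show "nhds x \<le> filtermap snd (G \<times>\<^sub>F nhds x)"
    proof (rule filter_leI)
      fix P assume "eventually P (filtermap snd (G \<times>\<^sub>F nhds x))"
      then obtain Q R where "eventually Q G" "eventually R (nhds x)" "\<And>i y. Q i \<Longrightarrow> R y \<Longrightarrow> P y"
        unfolding eventually_filtermap eventually_prod_filter by auto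
      moreover obtain i where "Q i" using \<open>eventually Q G\<close> assms eventually_happens' by blast
      ultimately show "eventually P (nhds x)" by (auto elim: eventually_mono)
    qed
  qed
  then have "((\<lambda>(i::'c, y). f y) \<longlongrightarrow> f x) (G \<times>\<^sub>F nhds x) \<longleftrightarrow> (f \<longlongrightarrow> f x) (nhds x)" for x
    by (metis (no_types, lifting) case_prod_beta' comp_apply ext tendsto_compose_filtermap)
  then show ?thesis
    by (auto simp: jlim_def continuous_on_def tendsto_at_iff_tendsto_nhds)
qed

lemma C_on_continuous: "C_on k UNIV f \<Longrightarrow> continuous_on UNIV f"
  by (cases k) (auto intro: differentiable_imp_continuous_on)

text \<open>The bridge to \<open>C_on\<close>: each rule of calculus is proved once, for families,
  and its version for a single function is the case of a constant family.\<close>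

lemma Cconv_const_iff:
  assumes "G \<noteq> bot"
  shows "Cconv k G (\<lambda>_. f) f \<longleftrightarrow> C_on k UNIV f"
  using assms
proof (induction k arbitrary: f)
  case (Suc k)
  then show ?case
    using C_on_continuous[of "Suc k" f]
    by (auto simp: jlim_const_iff differentiable_on_def)
qed (simp add: jlim_const_iff)

lemma C_on_Cconv: "C_on k UNIV f \<longleftrightarrow> Cconv k sequentially (\<lambda>_. f) f"
  by (simp add: Cconv_const_iff)

section \<open>Calculus of jointly convergent families\<close>

lemma jlim_bounded_linear: "bounded_linear L \<Longrightarrow> jlim G F f \<Longrightarrow> jlim G (\<lambda>i x. L (F i x)) (\<lambda>x. L (f x))"
  unfolding jlim_def case_prod_beta' by (auto intro: bounded_linear.tendsto)

lemma jlim_add: "jlim G F f \<Longrightarrow> jlim G H h \<Longrightarrow> jlim G (\<lambda>i x. F i x + H i x) (\<lambda>x. f x + h x :: 'b::real_normed_vector)"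
  unfolding jlim_def case_prod_beta' by (auto intro: tendsto_add)

lemma jlim_scaleR:
  "jlim G F f \<Longrightarrow> jlim G H h \<Longrightarrow> jlim G (\<lambda>i x. F i x *\<^sub>R H i x) (\<lambda>x. f x *\<^sub>R h x :: 'b::real_normed_vector)"
  unfolding jlim_def case_prod_beta' by (auto intro: tendsto_scaleR)

lemma jlim_compose:
  assumes "jlim G F f" "jlim G H h"
  shows "jlim G (\<lambda>i x. F i (H i x)) (\<lambda>x. f (h x))"
  unfolding jlim_def
proof
  fix x
  have "filterlim (\<lambda>(i, y). (i, H i y)) (G \<times>\<^sub>F nhds (h x)) (G \<times>\<^sub>F nhds x)"
    using filterlim_Pair[OF filterlim_fst, of "\<lambda>(i, y). H i y" "nhds (h x)" G "nhds x"] assms(2)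
    by (simp add: jlim_def case_prod_beta')
  from filterlim_compose[OF assms(1)[unfolded jlim_def, rule_format] this]
  show "((\<lambda>(i, y). F i (H i y)) \<longlongrightarrow> f (h x)) (G \<times>\<^sub>F nhds x)"
    by (simp add: case_prod_beta')
qed

lemma jlim_const: "jlim G (\<lambda>_ _. c) (\<lambda>_. c)"
  by (auto simp: jlim_def case_prod_beta')

lemma Cconv_const: "Cconv k G (\<lambda>_ _. c) (\<lambda>_. c)"
  by (induction k arbitrary: c) (auto simp: jlim_const)

lemma Cconv_bounded_linear:
  assumes "bounded_linear L" "Cconv k G F f"
  shows "Cconv k G (\<lambda>i x. L (F i x)) (\<lambda>x. L (f x))"
  using assms(2)
proof (induction k arbitrary: F f)
  case 0
  then show ?case by (simp add: jlim_bounded_linear[OF assms(1)])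
next
  case (Suc k)
  show ?case
  proof (rule Cconv_SucI)
    show "\<forall>\<^sub>F i in G. \<forall>x. ((\<lambda>x. L (F i x)) has_derivative
        (\<lambda>v. L (frechet_derivative (F i) (at x) v))) (at x)"
      using Cconv_ev_deriv[OF Suc.prems]
      by eventually_elim (auto intro: bounded_linear.has_derivative[OF assms(1)])
    show "((\<lambda>x. L (f x)) has_derivative (\<lambda>v. L (frechet_derivative f (at x) v))) (at x)" for x
      using Cconv_lim_deriv[OF Suc.prems] by (rule bounded_linear.has_derivative[OF assms(1)])
  qed (use Suc jlim_bounded_linear[OF assms(1)] in auto)
qed

lemma Cconv_add:
  assumes "Cconv k G F f" "Cconv k G H h"
  shows "Cconv k G (\<lambda>i x. F i x + H i x) (\<lambda>x. f x + h x)"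
  using assms
proof (induction k arbitrary: F f H h)
  case 0
  then show ?case by (simp add: jlim_add)
next
  case (Suc k)
  show ?case
  proof (rule Cconv_SucI)
    show "\<forall>\<^sub>F i in G. \<forall>x. ((\<lambda>x. F i x + H i x) has_derivative
        (\<lambda>v. frechet_derivative (F i) (at x) v + frechet_derivative (H i) (at x) v)) (at x)"
      using Cconv_ev_deriv[OF Suc.prems(1)] Cconv_ev_deriv[OF Suc.prems(2)]
      by eventually_elim (auto intro: has_derivative_add)
    show "((\<lambda>x. f x + h x) has_derivative
        (\<lambda>v. frechet_derivative f (at x) v + frechet_derivative h (at x) v)) (at x)" for x
      using Cconv_lim_deriv[OF Suc.prems(1)] Cconv_lim_deriv[OF Suc.prems(2)]
      by (rule has_derivative_add)
  qed (use Suc jlim_add in auto)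
qed

lemma Cconv_sum:
  assumes "\<And>b. b \<in> B \<Longrightarrow> Cconv k G (F b) (f b)"
  shows "Cconv k G (\<lambda>i x. \<Sum>b\<in>B. F b i x) (\<lambda>x. \<Sum>b\<in>B. f b x)"
  using assms
  by (induction B rule: infinite_finite_induct) (auto intro: Cconv_const Cconv_add)

lemma Cconv_scaleR:
  assumes "Cconv k G F f" "Cconv k G H h"
  shows "Cconv k G (\<lambda>i x. F i x *\<^sub>R H i x) (\<lambda>x. f x *\<^sub>R h x)"
  using assms
proof (induction k arbitrary: F f H h)
  case 0
  then show ?case by (simp add: jlim_scaleR)
next
  case (Suc k)
  show ?case
  proof (rule Cconv_SucI)
    show "\<forall>\<^sub>F i in G. \<forall>x. ((\<lambda>x. F i x *\<^sub>R H i x) has_derivative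
        (\<lambda>v. F i x *\<^sub>R frechet_derivative (H i) (at x) v + frechet_derivative (F i) (at x) v *\<^sub>R H i x)) (at x)"
      using Cconv_ev_deriv[OF Suc.prems(1)] Cconv_ev_deriv[OF Suc.prems(2)]
      by eventually_elim (auto intro: has_derivative_scaleR)
    show "((\<lambda>x. f x *\<^sub>R h x) has_derivative
        (\<lambda>v. f x *\<^sub>R frechet_derivative h (at x) v + frechet_derivative f (at x) v *\<^sub>R h x)) (at x)" for x
      using Cconv_lim_deriv[OF Suc.prems(1)] Cconv_lim_deriv[OF Suc.prems(2)]
      by (rule has_derivative_scaleR)
    show "Cconv k G
        (\<lambda>i x. F i x *\<^sub>R frechet_derivative (H i) (at x) v + frechet_derivative (F i) (at x) v *\<^sub>R H i x)
        (\<lambda>x. f x *\<^sub>R frechet_derivative h (at x) v + frechet_derivative f (at x) v *\<^sub>R h x)" for v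
      by (rule Cconv_add[OF Suc.IH[OF Cconv_Suc_D[OF Suc.prems(1)] Cconv_deriv[OF Suc.prems(2)]]
            Suc.IH[OF Cconv_deriv[OF Suc.prems(1)] Cconv_Suc_D[OF Suc.prems(2)]]])
  qed (use Suc.prems in \<open>auto intro: jlim_scaleR\<close>)
qed

lemma Cconv_inner: "Cconv k G F f \<Longrightarrow> Cconv k G (\<lambda>i x. F i x \<bullet> c) (\<lambda>x. f x \<bullet> c)"
  by (rule Cconv_bounded_linear[OF bounded_linear_inner_left])

lemma linear_basis_expand:
  fixes L :: "'a::euclidean_space \<Rightarrow> 'b::real_normed_vector"
  assumes "linear L"
  shows "L v = (\<Sum>b\<in>Basis. (v \<bullet> b) *\<^sub>R L b)"
proof -
  have "L v = L (\<Sum>b\<in>Basis. (v \<bullet> b) *\<^sub>R b)" by (simp add: euclidean_representation)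
  then show ?thesis
    by (simp only: linear_sum[OF assms] linear_cmul[OF assms])
qed

text \<open>In the chain rule the derivative of the outer map is applied to a direction that varies
  with the index and the point, which the induction hypothesis does not cover. Expanding that
  direction in the basis leaves products of scalar families and derivatives in fixed
  directions.\<close>

lemma Cconv_compose:
  fixes H :: "'i \<Rightarrow> 'a::euclidean_space \<Rightarrow> 'm::euclidean_space"
  assumes "Cconv k G F f" "Cconv k G H h"
  shows "Cconv k G (\<lambda>i x. F i (H i x)) (\<lambda>x. f (h x))"
  using assms
proof (induction k arbitrary: F f)
  case 0
  then show ?case by (simp add: jlim_compose)
next
  case (Suc k)
  let ?S = "\<lambda>F H x v. (\<Sum>b\<in>Basis. (frechet_derivative H (at x) v \<bullet> b) *\<^sub>R
      frechet_derivative F (at (H x)) b)"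
  have chain: "((\<lambda>x. F (H x)) has_derivative ?S F H x) (at x)"
    if "\<forall>x. (F has_derivative frechet_derivative F (at x)) (at x)"
       "\<forall>x. (H has_derivative frechet_derivative H (at x)) (at x)" for F :: "'m \<Rightarrow> 'b" and H :: "'a \<Rightarrow> 'm" and x
  proof -
    have "((\<lambda>x. F (H x)) has_derivative
       (\<lambda>v. frechet_derivative F (at (H x)) (frechet_derivative H (at x) v))) (at x)"
      using that by (blast intro: has_derivative_compose)
    moreover have "linear (frechet_derivative F (at (H x)))"
      using that by (blast intro: has_derivative_linear)
    ultimately show ?thesis by (simp add: linear_basis_expand[symmetric])
  qed
  show ?case
  proof (rule Cconv_SucI)
    show "\<forall>\<^sub>F i in G. \<forall>x. ((\<lambda>x. F i (H i x)) has_derivative ?S (F i) (H i) x) (at x)"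
      using Cconv_ev_deriv[OF Suc.prems(1)] Cconv_ev_deriv[OF Suc.prems(2)]
      by eventually_elim (auto intro: chain)
    show "((\<lambda>x. f (h x)) has_derivative ?S f h x) (at x)" for x
      using Cconv_lim_deriv[OF Suc.prems(1)] Cconv_lim_deriv[OF Suc.prems(2)]
      by (intro chain) auto
    show "Cconv k G (\<lambda>i x. ?S (F i) (H i) x v) (\<lambda>x. ?S f h x v)" for v
      by (rule Cconv_sum, rule Cconv_scaleR[OF Cconv_inner[OF Cconv_deriv[OF Suc.prems(2)]]
            Suc.IH[OF Cconv_deriv[OF Suc.prems(1)] Cconv_Suc_D[OF Suc.prems(2)]]])
  qed (use Suc.prems in \<open>auto intro: jlim_compose\<close>)
qed

lemma Cconv_Pair:
  assumes "Cconv k G F f" "Cconv k G H h"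
  shows "Cconv k G (\<lambda>i x. (F i x, H i x)) (\<lambda>x. (f x, h x))"
proof -
  have "Cconv k G (\<lambda>i x. (F i x, 0) + (0, H i x)) (\<lambda>x. (f x, 0) + (0, h x))"
    by (intro Cconv_add Cconv_bounded_linear[OF _ assms(1), of "\<lambda>x. (x, 0)"]
        Cconv_bounded_linear[OF _ assms(2), of "\<lambda>x. (0, x)"]
        bounded_linear_Pair bounded_linear_ident bounded_linear_zero)
  then show ?thesis by simp
qed

section \<open>Calculus of functions of class \<open>C\<^sup>k\<close>\<close>

lemma C_on_const: "C_on k UNIV (\<lambda>_. c)"
  by (simp add: C_on_Cconv Cconv_const)

lemma C_on_ident: "C_on k UNIV (\<lambda>x. x)"
  by (cases k) (auto simp: C_on_const differentiable_on_def)

lemma C_on_bounded_linear: "bounded_linear L \<Longrightarrow> C_on k UNIV f \<Longrightarrow> C_on k UNIV (\<lambda>x. L (f x))"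
  unfolding C_on_Cconv by (rule Cconv_bounded_linear)

lemma C_on_linear:
  fixes L :: "'a::euclidean_space \<Rightarrow> 'b::real_normed_vector"
  shows "linear L \<Longrightarrow> C_on k UNIV L"
  using C_on_bounded_linear[of L k "\<lambda>x. x"] by (simp add: C_on_ident linear_conv_bounded_linear)

lemma C_on_add: "C_on k UNIV f \<Longrightarrow> C_on k UNIV g \<Longrightarrow> C_on k UNIV (\<lambda>x. f x + g x)"
  by (simp add: C_on_Cconv Cconv_add)

lemma C_on_scaleR: "C_on k UNIV f \<Longrightarrow> C_on k UNIV g \<Longrightarrow> C_on k UNIV (\<lambda>x. f x *\<^sub>R g x)"
  by (simp add: C_on_Cconv Cconv_scaleR)

lemma C_on_mult: "C_on k UNIV f \<Longrightarrow> C_on k UNIV g \<Longrightarrow> C_on k UNIV (\<lambda>x. f x * g x :: real)"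
  using C_on_scaleR[of k f g] by simp

lemma C_on_diff: "C_on k UNIV f \<Longrightarrow> C_on k UNIV g \<Longrightarrow> C_on k UNIV (\<lambda>x. f x - g x)"
  using C_on_add[of k f "\<lambda>x. -1 *\<^sub>R g x"] C_on_scaleR[OF C_on_const, of k g "-1"] by simp

lemma C_on_sum: "(\<And>b. b \<in> B \<Longrightarrow> C_on k UNIV (f b)) \<Longrightarrow> C_on k UNIV (\<lambda>x. \<Sum>b\<in>B. f b x)"
  by (simp add: C_on_Cconv Cconv_sum)

lemma C_on_compose:
  fixes g :: "'a::euclidean_space \<Rightarrow> 'm::euclidean_space"
  shows "C_on k UNIV f \<Longrightarrow> C_on k UNIV g \<Longrightarrow> C_on k UNIV (\<lambda>x. f (g x))"
  unfolding C_on_Cconv by (rule Cconv_compose)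

lemma C_on_Pair: "C_on k UNIV f \<Longrightarrow> C_on k UNIV g \<Longrightarrow> C_on k UNIV (\<lambda>x. (f x, g x))"
  by (simp add: C_on_Cconv Cconv_Pair)

lemma C_on_fst: "C_on k UNIV f \<Longrightarrow> C_on k UNIV (\<lambda>x. fst (f x))"
  by (rule C_on_bounded_linear[OF bounded_linear_fst])

lemma C_on_snd: "C_on k UNIV f \<Longrightarrow> C_on k UNIV (\<lambda>x. snd (f x))"
  by (rule C_on_bounded_linear[OF bounded_linear_snd])

lemma C_on_mono: "C_on m UNIV f \<Longrightarrow> k \<le> m \<Longrightarrow> C_on k UNIV f"
  unfolding C_on_Cconv by (rule Cconv_mono)

lemma C_on_has_derivative:
  "C_on (Suc k) UNIV f \<Longrightarrow> (f has_derivative frechet_derivative f (at x)) (at x)"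
  by (auto simp: differentiable_on_def frechet_derivative_works)

lemma C_on_SucI:
  assumes "\<And>x. (f has_derivative f' x) (at x)"
    and "\<And>v. C_on k UNIV (\<lambda>x. f' x v)"
  shows "C_on (Suc k) UNIV f"
proof -
  have "f' x = frechet_derivative f (at x)" for x
    using assms(1) frechet_derivative_at by blast
  then show ?thesis using assms by (auto simp: differentiable_on_def differentiable_def)
qed

lemma Cconv_C_on:
  assumes "Cconv k G F f" "G \<noteq> bot" "\<forall>\<^sub>F i in G. C_on k UNIV (F i)"
  shows "C_on k UNIV f"
  using assms(1,3)
proof (induction k arbitrary: F f)
  case 0
  have "isCont f x" for x
    unfolding isCont_def tendsto_at_iff_tendsto_nhds
  proof (rule tendstoI)
    fix e :: real assume "e > 0"
    then have "\<forall>\<^sub>F p in G \<times>\<^sub>F nhds x. dist (case p of (i, y) \<Rightarrow> F i y) (f x) < e / 2"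
      using 0(1) by (auto simp: jlim_def tendsto_iff simp del: less_divide_eq_numeral1)
    then obtain P Q where PQ: "eventually P G" "eventually Q (nhds x)"
        "\<And>i y. P i \<Longrightarrow> Q y \<Longrightarrow> dist (F i y) (f x) < e / 2"
      unfolding eventually_prod_filter by auto
    \<comment> \<open>With \<open>y\<close> fixed, let \<open>i\<close> run along \<open>G\<close>:
      the joint bound on \<open>F i y\<close> becomes a bound on \<open>f y\<close>. Joint
      convergence thus carries the continuity of the limit in itself.\<close>
    have "dist (f y) (f x) < e" if "Q y" for y
    proof -
      have "((\<lambda>i. F i y) \<longlongrightarrow> f y) G"
      proof -
        have "filterlim (\<lambda>i. (i, y)) (G \<times>\<^sub>F nhds y) G"
          by (intro filterlim_Pair filterlim_ident) (auto simp: tendsto_const)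
        from filterlim_compose[OF _ this, of "\<lambda>(i, y). F i y" "nhds (f y)"] show ?thesis
          using 0(1) by (auto simp: jlim_def)
      qed
      then have "((\<lambda>i. dist (F i y) (f x)) \<longlongrightarrow> dist (f y) (f x)) G"
        by (intro tendsto_intros)
      then have "dist (f y) (f x) \<le> e / 2"
        by (rule tendsto_upperbound[OF _ _ assms(2)])
          (use PQ that in \<open>auto elim!: eventually_mono intro: less_imp_le\<close>)
      then show ?thesis using \<open>e > 0\<close> by simp
    qed
    then show "\<forall>\<^sub>F y in nhds x. dist (f y) (f x) < e"
      using PQ(2) by (auto elim: eventually_mono)
  qed
  then show ?case by (simp add: continuous_at_imp_continuous_on)
next
  case (Suc k)
  have "C_on k UNIV (\<lambda>x. frechet_derivative f (at x) v)" for v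
    by (rule Suc.IH[of "\<lambda>i x. frechet_derivative (F i) (at x) v"])
      (use Suc.prems in \<open>auto elim!: eventually_mono\<close>)
  then show ?case using Suc.prems(1) by (auto simp: differentiable_on_def)
qed

section \<open>\<open>C\<^sup>k\<close> closeness and closure\<close>

text \<open>With basis directions only, this is a finite set of uniform bounds, which can be secured
  one at a time along a filter. Passing to all directions of norm at most 1 costs a power of the
  dimension, paid in \<open>norm_iter_deriv_le_basis\<close>.\<close>

definition C_close ::
  "nat \<Rightarrow> 'a::euclidean_space set \<Rightarrow> real \<Rightarrow> ('a \<Rightarrow> 'b::real_normed_vector) \<Rightarrow> ('a \<Rightarrow> 'b) \<Rightarrow> bool" where
  "C_close k K e f g \<longleftrightarrow> (\<forall>bs. set bs \<subseteq> Basis \<and> length bs \<le> k \<longrightarrow>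
     (\<forall>x\<in>K. norm (iter_deriv UNIV f bs x - iter_deriv UNIV g bs x) \<le> e))"

lemma C_close_0: "C_close 0 K e f g \<longleftrightarrow> (\<forall>x\<in>K. norm (f x - g x) \<le> e)"
  by (auto simp: C_close_def)

lemma C_close_Suc:
  fixes f g :: "'a::euclidean_space \<Rightarrow> 'b::real_normed_vector"
  shows "C_close (Suc k) K e f g \<longleftrightarrow> (\<forall>x\<in>K. norm (f x - g x) \<le> e) \<and>
     (\<forall>b\<in>Basis. C_close k K e (\<lambda>x. frechet_derivative f (at x) b) (\<lambda>x. frechet_derivative g (at x) b))"
  (is "?L \<longleftrightarrow> ?R")
proof
  assume L: ?L
  have "norm (f x - g x) \<le> e" if "x \<in> K" for x
    using L[unfolded C_close_def, rule_format, of "[]"] that by auto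
  moreover have "C_close k K e (\<lambda>x. frechet_derivative f (at x) b) (\<lambda>x. frechet_derivative g (at x) b)"
    if "b \<in> Basis" for b
    unfolding C_close_def
  proof safe
    fix bs x assume "set bs \<subseteq> (Basis :: 'a set)" "length bs \<le> k" "x \<in> K"
    then show "norm (iter_deriv UNIV (\<lambda>x. frechet_derivative f (at x) b) bs x
        - iter_deriv UNIV (\<lambda>x. frechet_derivative g (at x) b) bs x) \<le> e"
      using L[unfolded C_close_def, rule_format, of "b # bs"] that by auto
  qed
  ultimately show ?R by blast
next
  assume R: ?R
  show ?L
    unfolding C_close_def
  proof safe
    fix bs x assume bs: "set bs \<subseteq> (Basis :: 'a set)" "length bs \<le> Suc k" "x \<in> K"
    show "norm (iter_deriv UNIV f bs x - iter_deriv UNIV g bs x) \<le> e"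
      using bs R by (cases bs) (auto simp: C_close_def)
  qed
qed

lemma C_close_subset: "C_close k K e f g \<Longrightarrow> K' \<subseteq> K \<Longrightarrow> e \<le> e' \<Longrightarrow> C_close k K' e' f g"
  unfolding C_close_def by (meson order_trans subsetD)

lemma C_close_mono: "C_close m K e f g \<Longrightarrow> k \<le> m \<Longrightarrow> C_close k K e f g"
  unfolding C_close_def by simp

lemma C_close_trans:
  fixes f g h :: "'a::euclidean_space \<Rightarrow> 'b::real_normed_vector"
  assumes "C_close k K e f g" "C_close k K e' g h"
  shows "C_close k K (e + e') f h"
  unfolding C_close_def
proof safe
  fix bs x assume "set bs \<subseteq> (Basis :: 'a set)" "length bs \<le> k" "x \<in> K"
  then have "norm (iter_deriv UNIV f bs x - iter_deriv UNIV g bs x) \<le> e"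
    "norm (iter_deriv UNIV g bs x - iter_deriv UNIV h bs x) \<le> e'"
    using assms by (auto simp: C_close_def)
  then show "norm (iter_deriv UNIV f bs x - iter_deriv UNIV h bs x) \<le> e + e'"
    using norm_triangle_ineq[of "iter_deriv UNIV f bs x - iter_deriv UNIV g bs x"
        "iter_deriv UNIV g bs x - iter_deriv UNIV h bs x"] by simp
qed

section \<open>Locality of derivatives\<close>

lemma frechet_derivative_cong_open:
  assumes "open U" "x \<in> U" "\<And>y. y \<in> U \<Longrightarrow> f y = g y"
  shows "frechet_derivative f (at x) = frechet_derivative g (at x)"
proof -
  have "(f has_derivative f') (at x) = (g has_derivative f') (at x)" for f'
    using has_derivative_transform_within_open[OF _ assms(1,2)] assms(3) by metis
  then show ?thesis by (simp add: frechet_derivative_def)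
qed

lemma iter_deriv_cong_open:
  assumes "open U" "x \<in> U" "\<And>y. y \<in> U \<Longrightarrow> f y = g y"
  shows "iter_deriv UNIV f vs x = iter_deriv UNIV g vs x"
  using assms(3)
proof (induction vs arbitrary: f g)
  case (Cons v vs)
  show ?case
    using frechet_derivative_cong_open[OF assms(1) _ Cons.prems]
    by (auto intro!: Cons.IH)
qed (use assms in auto)

lemma C_close_cong_open:
  assumes "open U" "K \<subseteq> U" "\<And>y. y \<in> U \<Longrightarrow> f y = f' y" "\<And>y. y \<in> U \<Longrightarrow> g y = g' y"
  shows "C_close k K e f g = C_close k K e f' g'"
proof -
  have "iter_deriv UNIV f bs x = iter_deriv UNIV f' bs x"
       "iter_deriv UNIV g bs x = iter_deriv UNIV g' bs x" if "x \<in> K" for bs x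
    using assms that by (auto intro!: iter_deriv_cong_open[of U])
  then show ?thesis by (auto simp: C_close_def)
qed

text \<open>Joint convergence gives around each point a neighbourhood together with a set of good
  indices; a finite subcover leaves only finitely many index sets to intersect.\<close>

lemma jlim_imp_uniform_on_compact:
  fixes f :: "'a::topological_space \<Rightarrow> 'b::real_normed_vector"
  assumes "jlim G F f" "continuous_on UNIV f" "compact K" "e > 0"
  shows "\<forall>\<^sub>F i in G. \<forall>x\<in>K. norm (F i x - f x) \<le> e"
proof -
  have "\<exists>P U. eventually P G \<and> open U \<and> x \<in> U \<and> (\<forall>i y. P i \<longrightarrow> y \<in> U \<longrightarrow> norm (F i y - f y) \<le> e)" for x :: 'a
  proof -
    have "\<forall>\<^sub>F p in G \<times>\<^sub>F nhds x. dist (case p of (i, y) \<Rightarrow> F i y) (f x) < e / 2"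
      using assms(1,4) unfolding jlim_def tendsto_iff by (meson half_gt_zero)
    then obtain P Q where PQ: "eventually P G" "eventually Q (nhds x)"
        "\<And>i y. P i \<Longrightarrow> Q y \<Longrightarrow> dist (F i y) (f x) < e / 2"
      unfolding eventually_prod_filter by auto
    have "(f \<longlongrightarrow> f x) (nhds x)"
      using assms(2) by (simp add: continuous_on_def tendsto_at_iff_tendsto_nhds)
    then have "\<forall>\<^sub>F y in nhds x. dist (f y) (f x) < e / 2"
      using assms(4) unfolding tendsto_iff by (meson half_gt_zero)
    with PQ(2) have "\<forall>\<^sub>F y in nhds x. Q y \<and> dist (f y) (f x) < e / 2"
      by (rule eventually_conj)
    then obtain U where U: "open U" "x \<in> U" "\<And>y. y \<in> U \<Longrightarrow> Q y \<and> dist (f y) (f x) < e / 2"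
      unfolding eventually_nhds by auto
    have "norm (F i y - f y) \<le> e" if "P i" "y \<in> U" for i y
    proof -
      have "dist (F i y) (f x) < e / 2" "dist (f y) (f x) < e / 2"
        using PQ(3) U(3) that by auto
      then show ?thesis
        using dist_triangle2[of "F i y" "f y" "f x"] by (simp add: dist_norm)
    qed
    then show ?thesis using PQ(1) U(1,2) by blast
  qed
  then obtain P U where PU: "\<And>x. eventually (P x) G" "\<And>x. open (U x)" "\<And>x. x \<in> U x"
      "\<And>x i y. P x i \<Longrightarrow> y \<in> U x \<Longrightarrow> norm (F i y - f y) \<le> e"
    by metis
  obtain C where C: "C \<subseteq> K" "finite C" "K \<subseteq> (\<Union>x\<in>C. U x)"
    by (rule compactE_image[OF assms(3), of K U]) (use PU(2,3) in auto)
  have "\<forall>\<^sub>F i in G. \<forall>x\<in>C. P x i"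
    using C(2) PU(1) by (simp add: eventually_ball_finite)
  then show ?thesis
    by eventually_elim (use C(3) PU(4) in blast)
qed

lemma Cconv_imp_C_close:
  fixes f :: "'a::euclidean_space \<Rightarrow> 'b::real_normed_vector"
  assumes "Cconv k G F f" "C_on k UNIV f" "compact K" "e > 0"
  shows "\<forall>\<^sub>F i in G. C_close k K e (F i) f"
  using assms(1,2)
proof (induction k arbitrary: F f)
  case 0
  then show ?case
    using jlim_imp_uniform_on_compact[of G F f K e] assms(3,4) by (simp add: C_close_0)
next
  case (Suc k)
  have "\<forall>\<^sub>F i in G. \<forall>x\<in>K. norm (F i x - f x) \<le> e"
    using jlim_imp_uniform_on_compact[of G F f K e] Cconv_jlim[OF Suc.prems(1)]
      C_on_continuous[OF Suc.prems(2)] assms(3,4) by blast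
  moreover have "\<forall>\<^sub>F i in G. \<forall>b\<in>Basis. C_close k K e (\<lambda>x. frechet_derivative (F i) (at x) b)
      (\<lambda>x. frechet_derivative f (at x) b)"
  proof (rule eventually_ball_finite[OF finite_Basis], rule ballI)
    fix b :: 'a
    show "\<forall>\<^sub>F i in G. C_close k K e (\<lambda>x. frechet_derivative (F i) (at x) b)
      (\<lambda>x. frechet_derivative f (at x) b)"
      by (rule Suc.IH) (use Suc.prems in auto)
  qed
  ultimately show ?case
    by eventually_elim (simp add: C_close_Suc)
qed

text \<open>The converse passage: a ball around 0 of radius \<open>norm x + 1\<close> is a
  neighbourhood of \<open>x\<close>, and continuity of \<open>f\<close> absorbs the motion of the
  point.\<close>

lemma C_close_imp_jlim:
  fixes f :: "'a::euclidean_space \<Rightarrow> 'b::real_normed_vector"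
  assumes close: "\<And>R e. e > 0 \<Longrightarrow> \<forall>\<^sub>F i in G. C_close 0 (cball 0 R) e (F i) f"
    and cont: "continuous_on UNIV f"
  shows "jlim G F f"
  unfolding jlim_def tendsto_iff
  proof safe
    fix x :: 'a and e :: real assume "e > 0"
    have "\<forall>\<^sub>F i in G. \<forall>y\<in>cball 0 (norm x + 1). norm (F i y - f y) \<le> e / 3"
      using close[of "e / 3"] \<open>e > 0\<close> by (simp add: C_close_0)
    moreover have "\<forall>\<^sub>F y in nhds x. dist (f y) (f x) < e / 3 \<and> y \<in> ball 0 (norm x + 1)"
    proof (rule eventually_conj)
      have "(f \<longlongrightarrow> f x) (nhds x)"
        using cont by (simp add: continuous_on_def tendsto_at_iff_tendsto_nhds)
      then show "\<forall>\<^sub>F y in nhds x. dist (f y) (f x) < e / 3"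
        using \<open>e > 0\<close> unfolding tendsto_iff by (meson divide_pos_pos zero_less_numeral)
      show "\<forall>\<^sub>F y in nhds x. y \<in> ball 0 (norm x + 1)"
        by (intro eventually_nhds_in_open) auto
    qed
    ultimately have "\<forall>\<^sub>F p in G \<times>\<^sub>F nhds x.
       (\<forall>y\<in>cball 0 (norm x + 1). norm (F (fst p) y - f y) \<le> e / 3) \<and>
       dist (f (snd p)) (f x) < e / 3 \<and> snd p \<in> ball 0 (norm x + 1)"
      by (rule eventually_prodI)
    then show "\<forall>\<^sub>F p in G \<times>\<^sub>F nhds x. dist (case p of (i, y) \<Rightarrow> F i y) (f x) < e"
    proof eventually_elim
      case (elim p)
      then have "dist (F (fst p) (snd p)) (f (snd p)) \<le> e / 3" by (auto simp: dist_norm)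
      then show ?case
        using elim dist_triangle[of "F (fst p) (snd p)" "f x" "f (snd p)"] \<open>e > 0\<close>
        by (simp add: case_prod_beta')
    qed
  qed

lemma C_close_imp_Cconv:
  fixes f :: "'a::euclidean_space \<Rightarrow> 'b::real_normed_vector"
  assumes "\<And>R e. e > 0 \<Longrightarrow> \<forall>\<^sub>F i in G. C_close k (cball 0 R) e (F i) f"
    and "C_on k UNIV f" "\<forall>\<^sub>F i in G. C_on k UNIV (F i)"
  shows "Cconv k G F f"
  using assms
proof (induction k arbitrary: F f)
  case 0
  then show ?case by (simp add: C_close_imp_jlim)
next
  case (Suc k)
  have f: "(f has_derivative frechet_derivative f (at x)) (at x)" for x
    using Suc.prems(2) by (rule C_on_has_derivative)
  have F: "\<forall>\<^sub>F i in G. \<forall>x. (F i has_derivative frechet_derivative (F i) (at x)) (at x)"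
    using Suc.prems(3) by eventually_elim (auto intro: C_on_has_derivative)
  have b: "Cconv k G (\<lambda>i x. frechet_derivative (F i) (at x) b) (\<lambda>x. frechet_derivative f (at x) b)"
    if "b \<in> Basis" for b
  proof (rule Suc.IH)
    show "\<forall>\<^sub>F i in G. C_close k (cball 0 R) e (\<lambda>x. frechet_derivative (F i) (at x) b)
      (\<lambda>x. frechet_derivative f (at x) b)" if "e > 0" for R e
      using Suc.prems(1)[OF that, of R] by eventually_elim (use \<open>b \<in> Basis\<close> in \<open>auto simp: C_close_Suc\<close>)
    show "\<forall>\<^sub>F i in G. C_on k UNIV (\<lambda>x. frechet_derivative (F i) (at x) b)"
      using Suc.prems(3) by eventually_elim auto
  qed (use Suc.prems in auto)
  \<comment> \<open>Closeness is known in basis directions only; linearity of the derivative in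
    \<open>v\<close> extends the convergence to all directions.\<close>
  have "Cconv k G (\<lambda>i x. frechet_derivative (F i) (at x) v) (\<lambda>x. frechet_derivative f (at x) v)" for v
  proof -
    have fv: "frechet_derivative g (at x) v = (\<Sum>b\<in>Basis. (v \<bullet> b) *\<^sub>R frechet_derivative g (at x) b)"
      if "(g has_derivative frechet_derivative g (at x)) (at x)" for g :: "'a \<Rightarrow> 'b" and x
      using linear_basis_expand[OF has_derivative_linear[OF that]] .
    have ev: "\<forall>\<^sub>F i in G. \<forall>x. frechet_derivative (F i) (at x) v =
       (\<Sum>b\<in>Basis. (v \<bullet> b) *\<^sub>R frechet_derivative (F i) (at x) b)"
      using F by eventually_elim (use fv in blast)
    have "Cconv k G (\<lambda>i x. \<Sum>b\<in>Basis. (v \<bullet> b) *\<^sub>R frechet_derivative (F i) (at x) b)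
       (\<lambda>x. \<Sum>b\<in>Basis. (v \<bullet> b) *\<^sub>R frechet_derivative f (at x) b)"
      by (intro Cconv_sum Cconv_scaleR Cconv_const b)
    then show ?thesis
      using Cconv_cong[OF ev] fv[OF f] by simp
  qed
  moreover have "jlim G F f"
  proof (rule C_close_imp_jlim)
    show "\<forall>\<^sub>F i in G. C_close 0 (cball 0 R) e (F i) f" if "e > 0" for R e
      using Suc.prems(1)[OF that, of R] by eventually_elim (auto intro: C_close_mono)
  qed (rule C_on_continuous[OF Suc.prems(2)])
  moreover have "\<forall>\<^sub>F i in G. \<forall>x. F i differentiable at x"
    using F by eventually_elim (auto simp: differentiable_def)
  ultimately show ?case using f
    by (auto simp: differentiable_def)
qed

text \<open>Closure for \<open>C\<^sup>k\<close> convergence on compact sets, exhausted by balls.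
  Smoothness of \<open>f\<close> is part of membership because \<open>frechet_derivative\<close> is
  unspecified where no derivative exists, so that \<open>C_close\<close> alone would not express
  closeness.\<close>

definition C_closure ::
  "nat \<Rightarrow> ('a::euclidean_space \<Rightarrow> 'b::real_normed_vector) set \<Rightarrow> ('a \<Rightarrow> 'b) set" where
  "C_closure k S = {f. C_on k UNIV f \<and> (\<forall>R e. e > 0 \<longrightarrow> (\<exists>g\<in>S. C_close k (cball 0 R) e g f))}"

section \<open>Rules for the closure\<close>

lemma C_closure_D:
  "f \<in> C_closure k S \<Longrightarrow> e > 0 \<Longrightarrow> \<exists>g\<in>S. C_close k (cball 0 R) e g f"
  by (simp add: C_closure_def)

lemma C_close_refl: "e \<ge> 0 \<Longrightarrow> C_close k K e f f"
  by (simp add: C_close_def)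

lemma C_closure_subset: "f \<in> S \<Longrightarrow> C_on k UNIV f \<Longrightarrow> f \<in> C_closure k S"
  unfolding C_closure_def using C_close_refl less_imp_le by blast

lemma C_closure_C_on: "f \<in> C_closure k S \<Longrightarrow> C_on k UNIV f"
  by (simp add: C_closure_def)

lemma C_closure_mono: "f \<in> C_closure k S \<Longrightarrow> S \<subseteq> S' \<Longrightarrow> f \<in> C_closure k S'"
  unfolding C_closure_def by blast

lemma C_closure_le: "f \<in> C_closure m S \<Longrightarrow> k \<le> m \<Longrightarrow> f \<in> C_closure k S"
  unfolding C_closure_def using C_close_mono C_on_mono by blast

lemma C_closure_closure:
  assumes "f \<in> C_closure k S" "S \<subseteq> C_closure k S'"
  shows "f \<in> C_closure k S'"
proof -
  have "\<exists>h\<in>S'. C_close k (cball 0 R) e h f" if "e > 0" for R e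
  proof -
    obtain g where g: "g \<in> S" "C_close k (cball 0 R) (e / 2) g f"
      using C_closure_D[OF assms(1), of "e / 2" R] \<open>e > 0\<close> by auto
    then obtain h where h: "h \<in> S'" "C_close k (cball 0 R) (e / 2) h g"
      using C_closure_D[of g k S' "e / 2" R] assms(2) \<open>e > 0\<close> by auto
    then show ?thesis using C_close_trans[OF h(2) g(2)] by auto
  qed
  then show ?thesis using assms(1) by (simp add: C_closure_def)
qed

text \<open>Radius \<open>n\<close> and tolerance \<open>1 / (n + 1)\<close> taken together produce
  one sequence that works on every ball. Membership in a closure thereby becomes
  \<open>Cconv\<close>, for which the calculus is available.\<close>

lemma C_closure_sequence:
  assumes "f \<in> C_closure k S" "\<And>g. g \<in> S \<Longrightarrow> C_on k UNIV g"
  obtains F where "\<And>n::nat. F n \<in> S" "Cconv k sequentially F f"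
proof -
  have "\<exists>g\<in>S. C_close k (cball 0 (real n)) (inverse (Suc n)) g f" for n :: nat
    using assms(1) unfolding C_closure_def by simp
  then obtain F where F: "\<And>n. F n \<in> S" "\<And>n::nat. C_close k (cball 0 (real n)) (inverse (Suc n)) (F n) f"
    by metis
  have "Cconv k sequentially F f"
  proof (rule C_close_imp_Cconv)
    fix R e :: real assume "e > 0"
    then obtain N where N: "inverse (Suc N) < e" using reals_Archimedean by blast
    have "C_close k (cball 0 R) e (F n) f" if "n \<ge> max N (nat \<lceil>R\<rceil>)" for n
    proof (rule C_close_subset[OF F(2)[of n]])
      have "R \<le> real n" using that by (simp add: nat_le_iff ceiling_le_iff)
      then show "cball 0 R \<subseteq> cball 0 (real n)" by (simp add: subset_cball)
      have "inverse (real (Suc n)) \<le> inverse (real (Suc N))" using that by (intro le_imp_inverse_le) auto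
      then show "inverse (real (Suc n)) \<le> e" using N by linarith
    qed
    then show "\<forall>\<^sub>F n in sequentially. C_close k (cball 0 R) e (F n) f"
      unfolding eventually_sequentially by blast
  qed (use assms F(1) in \<open>auto simp: C_closure_def\<close>)
  then show thesis using that F(1) by blast
qed

text \<open>The filter is arbitrary because the limits below are taken along \<open>at 0\<close>,
  for steps tending to 0, as well as along sequences.\<close>

lemma Cconv_imp_C_closure:
  assumes "Cconv k G F f" "G \<noteq> bot" "\<forall>\<^sub>F i in G. F i \<in> C_closure k S"
  shows "f \<in> C_closure k S"
proof (rule C_closure_closure[of _ _ "C_closure k S"])
  have f: "C_on k UNIV f"
    by (rule Cconv_C_on[OF assms(1,2)]) (use assms(3) in \<open>auto simp: C_closure_def elim: eventually_mono\<close>)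
  moreover have "\<exists>g\<in>C_closure k S. C_close k (cball 0 R) e g f" if "e > 0" for R e
  proof -
    have "\<forall>\<^sub>F i in G. C_close k (cball 0 R) e (F i) f"
      by (rule Cconv_imp_C_close) (use assms f that in auto)
    with assms(3) have "\<forall>\<^sub>F i in G. F i \<in> C_closure k S \<and> C_close k (cball 0 R) e (F i) f"
      by (rule eventually_conj)
    then show ?thesis using assms(2) eventually_happens' by blast
  qed
  ultimately show "f \<in> C_closure k (C_closure k S)" by (simp add: C_closure_def)
qed simp

text \<open>This makes cut-offs free of charge: a construction that agrees with \<open>f\<close>
  only inside a ball, but does so for every ball, proves membership.\<close>

lemma C_closure_local:
  assumes "C_on k UNIV f" "\<And>R. \<exists>g\<in>C_closure k S. \<forall>x\<in>ball 0 R. g x = f x"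
  shows "f \<in> C_closure k S"
proof -
  have "\<exists>h\<in>S. C_close k (cball 0 R) e h f" if "e > 0" for R e
  proof -
    \<comment> \<open>Derivatives are compared at the boundary of \<open>cball 0 R\<close> too, so
      agreement on an open neighbourhood is required; hence \<open>R + 1\<close>.\<close>
    obtain g where g: "g \<in> C_closure k S" "\<forall>x\<in>ball 0 (R + 1). g x = f x"
      using assms(2) by blast
    then obtain h where h: "h \<in> S" "C_close k (cball 0 R) e h g"
      using C_closure_D[OF _ \<open>e > 0\<close>] by blast
    moreover have "C_close k (cball 0 R) e h g = C_close k (cball 0 R) e h f"
      using g(2) by (intro C_close_cong_open[of "ball 0 (R + 1)"]) auto
    ultimately show ?thesis by blast
  qed
  then show ?thesis using assms(1) by (simp add: C_closure_def)
qed

lemma C_closure_compose: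
  fixes g :: "'a::euclidean_space \<Rightarrow> 'b::euclidean_space" and f :: "'b \<Rightarrow> 'c::real_normed_vector"
  assumes "f \<in> C_closure k S" "g \<in> C_closure k S'"
    and S: "\<And>f. f \<in> S \<Longrightarrow> C_on k UNIV f" "\<And>f. f \<in> S' \<Longrightarrow> C_on k UNIV f"
    and comp: "\<And>f g. f \<in> S \<Longrightarrow> g \<in> S' \<Longrightarrow> (\<lambda>x. f (g x)) \<in> S''"
  shows "(\<lambda>x. f (g x)) \<in> C_closure k S''"
proof -
  obtain F where F: "\<And>n. F n \<in> S" "Cconv k sequentially F f"
    using C_closure_sequence[OF assms(1) S(1)] by blast
  obtain H where H: "\<And>n. H n \<in> S'" "Cconv k sequentially H g"
    using C_closure_sequence[OF assms(2) S(2)] by blast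
  show ?thesis
  proof (rule Cconv_imp_C_closure)
    show "Cconv k sequentially (\<lambda>n x. F n (H n x)) (\<lambda>x. f (g x))"
      by (rule Cconv_compose[OF F(2) H(2)])
    have "(\<lambda>x. F n (H n x)) \<in> C_closure k S''" for n
      by (rule C_closure_subset[OF comp[OF F(1) H(1)] C_on_compose[OF S(1)[OF F(1)] S(2)[OF H(1)]]])
    then show "\<forall>\<^sub>F n in sequentially. (\<lambda>x. F n (H n x)) \<in> C_closure k S''" by simp
  qed simp
qed

section \<open>Inverses of perturbations of the identity\<close>

text \<open>A product rule with a merely continuous factor \<open>u\<close>. Since
  \<open>g x = 0\<close>, the remainder is the remainder of \<open>g\<close> times
  \<open>u y\<close>, plus \<open>g' (y - x)\<close> times \<open>u y - u x\<close>, and both are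
  small compared with \<open>y - x\<close>.\<close>

lemma has_derivative_scaleR_vanishing:
  fixes g :: "'a::real_normed_vector \<Rightarrow> real" and u :: "'a \<Rightarrow> 'b::real_normed_vector"
  assumes "(g has_derivative g') (at x)" "g x = 0" "isCont u x"
  shows "((\<lambda>y. g y *\<^sub>R u y) has_derivative (\<lambda>h. g' h *\<^sub>R u x)) (at x)"
proof (rule has_derivativeI)
  have bl: "bounded_linear g'" using assms(1) by (rule has_derivative_bounded_linear)
  show "bounded_linear (\<lambda>h. g' h *\<^sub>R u x)"
    by (rule bounded_linear_compose[OF bounded_linear_scaleR_left bl])
  let ?r = "\<lambda>y. (g y - g x - g' (y - x)) /\<^sub>R norm (y - x)"
  have r: "(?r \<longlongrightarrow> 0) (at x)"
    using assms(1) by (simp add: has_derivative_at_within)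
  have u: "(u \<longlongrightarrow> u x) (at x)" using assms(3) by (simp add: isCont_def)
  have "((\<lambda>y. (g' (y - x) /\<^sub>R norm (y - x)) *\<^sub>R (u y - u x)) \<longlongrightarrow> 0) (at x)"
  proof (rule Lim_null_comparison)
    show "\<forall>\<^sub>F y in at x. norm ((g' (y - x) /\<^sub>R norm (y - x)) *\<^sub>R (u y - u x)) \<le> onorm g' * norm (u y - u x)"
    proof (intro always_eventually allI)
      fix y
      have "\<bar>g' (y - x)\<bar> / norm (y - x) \<le> onorm g'"
        using onorm[OF bl, of "y - x"] onorm_pos_le[OF bl]
        by (cases "y = x") (auto simp: divide_simps)
      then show "norm ((g' (y - x) /\<^sub>R norm (y - x)) *\<^sub>R (u y - u x)) \<le> onorm g' * norm (u y - u x)"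
        by (simp add: divide_inverse_commute abs_mult mult_right_mono)
    qed
    have "((\<lambda>y. onorm g' * norm (u y - u x)) \<longlongrightarrow> onorm g' * norm (u x - u x)) (at x)"
      by (intro tendsto_intros u)
    then show "((\<lambda>y. onorm g' * norm (u y - u x)) \<longlongrightarrow> 0) (at x)" by simp
  qed
  moreover have "((\<lambda>y. ?r y *\<^sub>R u y) \<longlongrightarrow> 0 *\<^sub>R u x) (at x)"
    by (intro tendsto_scaleR r u)
  ultimately have "((\<lambda>y. ?r y *\<^sub>R u y + (g' (y - x) /\<^sub>R norm (y - x)) *\<^sub>R (u y - u x)) \<longlongrightarrow> 0 *\<^sub>R u x + 0) (at x)"
    by (intro tendsto_add)
  then show "((\<lambda>y. (g y *\<^sub>R u y - g x *\<^sub>R u x - g' (y - x) *\<^sub>R u x) /\<^sub>R norm (y - x)) \<longlongrightarrow> 0) (at x)"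
    by (simp add: assms(2) algebra_simps)
qed

lemma linear_two_sided_inverse:
  assumes linA: "linear A" and AB: "\<And>v. A (B v) = v" and BA: "\<And>v. B (A v) = v"
  shows "linear B"
proof
  fix v w a
  have "B (v + w) = B (A (B v + B w))" by (simp add: linear_add[OF linA] AB)
  then show "B (v + w) = B v + B w" by (simp add: BA)
  have "B (a *\<^sub>R v) = B (A (a *\<^sub>R B v))" by (simp add: linear_cmul[OF linA] AB)
  then show "B (a *\<^sub>R v) = a *\<^sub>R B v" by (simp add: BA)
qed

text \<open>Everything follows from the resolvent identity
  \<open>B y - B x = B y (A x - A y) B x\<close>. The uniform bound on the inverses yields
  continuity, and induction on \<open>k\<close> then raises the order, as the derivative of
  \<open>B\<close> is a polynomial expression in \<open>B\<close> and the derivative of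
  \<open>A\<close>.\<close>

lemma C_on_inverse_operator:
  fixes A :: "'a::euclidean_space \<Rightarrow> 'b::euclidean_space \<Rightarrow> 'b"
  assumes linA: "\<And>x. linear (A x)" and AB: "\<And>x v. A x (B x v) = v" and BA: "\<And>x v. B x (A x v) = v"
    and bnd: "\<And>x v. norm (B x v) \<le> c * norm v"
    and C: "\<And>v. C_on k UNIV (\<lambda>x. A x v)"
  shows "C_on k UNIV (\<lambda>x. B x v)"
proof -
  have linB: "linear (B x)" for x by (rule linear_two_sided_inverse[OF linA AB BA])
  have cont: "isCont (\<lambda>y. B y v) x" for v x
  proof -
    have A: "((\<lambda>y. A y (B x v)) \<longlongrightarrow> A x (B x v)) (at x)"
      using C_on_continuous[OF C] by (simp add: continuous_on_def)
    have "((\<lambda>y. B y v - B x v) \<longlongrightarrow> 0) (at x)"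
    proof (rule Lim_null_comparison)
      show "\<forall>\<^sub>F y in at x. norm (B y v - B x v) \<le> c * norm (A x (B x v) - A y (B x v))"
      proof (intro always_eventually allI)
        fix y
        have "B y v - B x v = B y (A x (B x v)) - B y (A y (B x v))" by (simp add: AB BA)
        also have "\<dots> = B y (A x (B x v) - A y (B x v))" by (simp add: linear_diff[OF linB])
        finally show "norm (B y v - B x v) \<le> c * norm (A x (B x v) - A y (B x v))"
          using bnd by metis
      qed
      have "((\<lambda>y. c * norm (A x (B x v) - A y (B x v))) \<longlongrightarrow> c * norm (A x (B x v) - A x (B x v))) (at x)"
        by (intro tendsto_intros A)
      then show "((\<lambda>y. c * norm (A x (B x v) - A y (B x v))) \<longlongrightarrow> 0) (at x)" by simp
    qed
    then show ?thesis unfolding isCont_def by (simp add: LIM_zero_iff)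
  qed
  show ?thesis
    using C
  proof (induction k arbitrary: v)
    case 0
    then show ?case using cont by (simp add: continuous_at_imp_continuous_on)
  next
    case (Suc k)
    define DA where "DA w x = frechet_derivative (\<lambda>y. A y w) (at x)" for w x
    have DA: "((\<lambda>y. A y w) has_derivative DA w x) (at x)" for w x
      unfolding DA_def by (rule C_on_has_derivative[OF Suc.prems])
    have DA_C: "C_on k UNIV (\<lambda>x. DA w x h)" for w h
      using Suc.prems[of w] by (simp add: DA_def)
    have B_C: "C_on k UNIV (\<lambda>x. B x w)" for w
      using Suc.prems C_on_mono by (intro Suc.IH) (blast intro: le_SucI)
    define F' where "F' x h = (\<Sum>b\<in>Basis. (B x v \<bullet> b) *\<^sub>R DA b x h)" for x h
    show ?case
    proof (rule C_on_SucI)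
      fix x
      have F: "((\<lambda>y. A y (B x v)) has_derivative F' x) (at x)"
      proof -
        have "((\<lambda>y. \<Sum>b\<in>Basis. (B x v \<bullet> b) *\<^sub>R A y b) has_derivative F' x) (at x)"
          unfolding F'_def by (intro has_derivative_sum has_derivative_scaleR_right DA)
        then show ?thesis
          by (simp add: linear_basis_expand[OF linA, of _ "B x v"])
      qed
      let ?D = "\<lambda>h. \<Sum>b\<in>Basis. (F' x h \<bullet> b) *\<^sub>R B x b"
      \<comment> \<open>This sum is \<open>B y\<close> applied to \<open>A y (B x v) - v\<close>.
        Its scalar coefficients vanish at \<open>y = x\<close>, so it can be differentiated although
        only continuity of \<open>B\<close> is known at this point.\<close>
      have "((\<lambda>y. \<Sum>b\<in>Basis. ((A y (B x v) - A x (B x v)) \<bullet> b) *\<^sub>R B y b) has_derivative ?D) (at x)"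
      proof (intro has_derivative_sum has_derivative_scaleR_vanishing cont)
        fix b
        have "((\<lambda>y. A y (B x v) - A x (B x v)) has_derivative (\<lambda>h. F' x h - 0)) (at x)"
          by (intro has_derivative_diff F has_derivative_const)
        from has_derivative_inner_left[OF this, of b]
        show "((\<lambda>y. (A y (B x v) - A x (B x v)) \<bullet> b) has_derivative (\<lambda>h. F' x h \<bullet> b)) (at x)"
          by simp
      qed simp
      then have "((\<lambda>y. B x v - (\<Sum>b\<in>Basis. ((A y (B x v) - A x (B x v)) \<bullet> b) *\<^sub>R B y b))
         has_derivative (\<lambda>h. 0 - ?D h)) (at x)"
        by (intro has_derivative_diff has_derivative_const)
      moreover have "B x v - (\<Sum>b\<in>Basis. ((A y (B x v) - A x (B x v)) \<bullet> b) *\<^sub>R B y b) = B y v" for y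
        by (simp add: linear_basis_expand[OF linB, symmetric] linear_diff[OF linB] AB BA)
      ultimately show "((\<lambda>y. B y v) has_derivative (\<lambda>h. 0 - ?D h)) (at x)" by simp
    next
      show "C_on k UNIV (\<lambda>x. 0 - (\<Sum>b\<in>Basis. (F' x h \<bullet> b) *\<^sub>R B x b))" for h
        unfolding F'_def
        by (intro C_on_diff C_on_const C_on_sum C_on_scaleR B_C DA_C
            C_on_bounded_linear[OF bounded_linear_inner_left])
    qed
  qed
qed

text \<open>The solution \<open>x\<close> of \<open>x + u x = y\<close> is the fixed point of the
  contraction sending \<open>z\<close> to \<open>y - u z\<close>, which gives a global inverse. The
  constant 1/2 makes both this inverse and the inverses of the derivatives bounded by 2.\<close>

lemma near_identity_inverse:
  fixes u :: "'a::euclidean_space \<Rightarrow> 'a"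
  assumes C: "C_on (Suc k) UNIV u"
    and bnd: "\<And>x v. norm (frechet_derivative u (at x) v) \<le> 1/2 * norm v"
  obtains g where "\<And>x. g (x + u x) = x" "\<And>y. g y + u (g y) = y" "C_on (Suc k) UNIV g"
proof -
  let ?D = "\<lambda>x. frechet_derivative u (at x)"
  have du: "(u has_derivative ?D x) (at x)" for x by (rule C_on_has_derivative[OF C])
  have lip: "norm (u x - u y) \<le> 1/2 * norm (x - y)" for x y
    by (rule differentiable_bound[of UNIV u ?D]) (auto intro: du onorm_le bnd simp del: divide_const_simps)
  have "\<exists>!z. y - u z = z" for y
    using lip by (intro banach_fix_type[of "1/2" "\<lambda>z. y - u z"])
      (auto simp: dist_norm norm_minus_commute)
  then obtain g where g: "\<And>y. y - u (g y) = g y" "\<And>y z. y - u z = z \<Longrightarrow> z = g y"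
    by metis
  have g1: "g (x + u x) = x" for x by (rule g(2)[symmetric]) simp
  have g2: "g y + u (g y) = y" for y using g(1)[of y] by (simp add: algebra_simps)
  have lipg: "norm (g y - g z) \<le> 2 * norm (y - z)" for y z
  proof -
    have "g y - g z = (y - z) - (u (g y) - u (g z))"
      using g(1)[of y] g(1)[of z] by (simp add: algebra_simps)
    then have "norm (g y - g z) \<le> norm (y - z) + norm (u (g y) - u (g z))"
      using norm_triangle_ineq4 by metis
    then show ?thesis using lip[of "g y" "g z"] by simp
  qed
  have contg: "continuous_on UNIV g"
    by (rule lipschitz_on_continuous_on[of 2]) (use lipg in \<open>auto simp: lipschitz_on_def dist_norm\<close>)
  define A where "A x v = v + ?D x v" for x v
  have linA: "linear (A x)" for x
    unfolding A_def by (intro linear_compose_add linear_ident has_derivative_linear[OF du])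
  have lowA: "norm v \<le> 2 * norm (A x v)" for x v
  proof -
    have "norm v = norm (A x v - ?D x v)" by (simp add: A_def)
    also have "\<dots> \<le> norm (A x v) + norm (?D x v)" by (rule norm_triangle_ineq4)
    finally show ?thesis using bnd[of x v] by simp
  qed
  have inj: "inj (A x)" for x
  proof (rule injI)
    fix v w assume "A x v = A x w"
    then show "v = w" using lowA[of "v - w" x] by (simp add: linear_diff[OF linA])
  qed
  have surj: "surj (A x)" for x
    by (rule linear_inj_imp_surj[OF linA inj])
  define B where "B x = inv (A x)" for x
  have AB: "A x (B x v) = v" for x v unfolding B_def by (rule surj_f_inv_f[OF surj])
  have BA: "B x (A x v) = v" for x v unfolding B_def by (rule inv_f_f[OF inj])
  have bndB: "norm (B x v) \<le> 2 * norm v" for x v using lowA[of "B x v" x] by (simp add: AB)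
  have CA: "C_on k UNIV (\<lambda>x. A x v)" for v
    unfolding A_def using C by (intro C_on_add C_on_const) simp
  have CB: "C_on k UNIV (\<lambda>x. B x v)" for v
    by (rule C_on_inverse_operator[OF linA AB BA bndB CA])
  have dg: "(g has_derivative B (g y)) (at y)" for y
  proof (rule has_derivative_inverse_basic[where f = "\<lambda>x. x + u x" and f' = "A (g y)" and T = UNIV])
    show "((\<lambda>x. x + u x) has_derivative A (g y)) (at (g y))"
      unfolding A_def by (intro has_derivative_add has_derivative_ident du)
    have "linear (B (g y))" by (rule linear_two_sided_inverse[OF linA AB BA])
    then show "bounded_linear (B (g y))" by (simp add: linear_conv_bounded_linear)
    show "B (g y) \<circ> A (g y) = id" by (auto simp: BA)
    show "continuous (at y) g" using contg by (simp add: continuous_on_eq_continuous_at)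
  qed (auto simp: g2)
  \<comment> \<open>Bootstrapping: the derivative of \<open>g\<close> at \<open>y\<close> is
    \<open>B (g y)\<close>, so each order known for \<open>g\<close> gives the next, as far as
    \<open>B\<close> is smooth.\<close>
  have "j \<le> Suc k \<Longrightarrow> C_on j UNIV g" for j
  proof (induction j)
    case (Suc j)
    show ?case
    proof (rule C_on_SucI[OF dg])
      fix v
      have "C_on j UNIV (\<lambda>x. B x v)" using Suc.prems by (intro C_on_mono[OF CB]) simp
      then show "C_on j UNIV (\<lambda>y. B (g y) v)" 
        by (rule C_on_compose[OF _ Suc.IH[OF Suc_leD[OF Suc.prems]]])
    qed
  qed (simp add: contg)
  then show thesis using that g1 g2 by blast
qed

section \<open>Bump functions\<close>

text \<open>Truncated powers supply cut-offs of any finite smoothness: differentiation lowers the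
  degree by one and multiplies by a constant.\<close>

lemma C_on_max_power: "C_on n UNIV (\<lambda>t::real. max 0 t ^ Suc n)"
proof (induction n)
  case 0
  show ?case by (auto intro!: continuous_intros)
next
  case (Suc n)
  let ?f' = "\<lambda>t v. (v * real (Suc (Suc n))) * max 0 t ^ Suc n"
  have "((\<lambda>t. max 0 t ^ Suc (Suc n)) has_derivative ?f' t) (at t)" for t :: real
  proof -
    consider "t > 0" | "t < 0" | "t = 0" by linarith
    then show ?thesis
    proof cases
      case 1
      have "((\<lambda>t. t ^ Suc (Suc n)) has_real_derivative real (Suc (Suc n)) * t ^ Suc n) (at t)"
        using DERIV_pow[of "Suc (Suc n)" t] by simp
      then have "((\<lambda>t. t ^ Suc (Suc n)) has_derivative ?f' t) (at t)"
        using 1 by (simp add: has_field_derivative_def mult_commute_abs mult_ac del: of_nat_Suc power_Suc)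
      then show ?thesis
        by (rule has_derivative_transform_within_open[of _ _ _ _ "{0<..}"]) (use 1 in auto)
    next
      case 2
      have "((\<lambda>t. 0) has_derivative ?f' t) (at t)"
        using 2 by (simp add: max_def)
      then show ?thesis
        by (rule has_derivative_transform_within_open[of _ _ _ _ "{..<0}"]) (use 2 in auto)
    next
      case 3
      \<comment> \<open>At the corner one factor \<open>t\<close> is split off; it vanishes at 0 and
        the other factor is continuous.\<close>
      have "((\<lambda>t. t *\<^sub>R max 0 t ^ Suc n) has_derivative (\<lambda>h. h *\<^sub>R max 0 (0::real) ^ Suc n)) (at 0)"
        by (rule has_derivative_scaleR_vanishing)
          (auto intro!: continuous_intros simp: continuous_max)
      moreover have "(\<lambda>t. t *\<^sub>R max 0 t ^ Suc n) = (\<lambda>t::real. max 0 t ^ Suc (Suc n))"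
        by (auto simp: max_def)
      ultimately have "((\<lambda>t::real. max 0 t ^ Suc (Suc n)) has_derivative (\<lambda>h. h *\<^sub>R max 0 (0::real) ^ Suc n)) (at 0)"
        by (simp only:)
      then show ?thesis using 3 by simp
    qed
  qed
  then show ?case
    by (rule C_on_SucI) (intro C_on_mult C_on_const Suc)
qed

text \<open>With \<open>m t = max 0 t ^ Suc k\<close>, the function is \<open>m (1 - m s)\<close>
  for \<open>s = (norm x / R)\<^sup>2 - 1\<close>. For \<open>norm x \<le> R\<close> one has
  \<open>s \<le> 0\<close>, so the inner term is 0; for \<open>norm x \<ge> 2 * R\<close> one has
  \<open>s \<ge> 3\<close>, so it is at least 1.\<close>

lemma bump_function:
  assumes "R > 0"
  obtains \<beta> :: "'a::euclidean_space \<Rightarrow> real" where "C_on k UNIV \<beta>"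
    "\<And>x. norm x \<le> R \<Longrightarrow> \<beta> x = 1" "\<And>x. norm x \<ge> 2 * R \<Longrightarrow> \<beta> x = 0"
    "\<And>x. 0 \<le> \<beta> x" "\<And>x. \<beta> x \<le> 1"
proof
  let ?m = "\<lambda>t::real. max 0 t ^ Suc k"
  let ?s = "\<lambda>x::'a. (x \<bullet> x) * inverse (R\<^sup>2) - 1"
  let ?\<beta> = "\<lambda>x::'a. ?m (1 - ?m (?s x))"
  have ip: "C_on k UNIV (\<lambda>x::'a. x \<bullet> x)"
  proof -
    have "C_on k UNIV (\<lambda>x::'a. \<Sum>b\<in>Basis. (x \<bullet> b) * (x \<bullet> b))"
      by (intro C_on_sum C_on_mult C_on_bounded_linear[OF bounded_linear_inner_left] C_on_ident)
    then show ?thesis by (subst euclidean_inner)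
  qed
  have s: "C_on k UNIV ?s"
    by (intro C_on_diff C_on_mult C_on_const ip)
  have "C_on k UNIV (\<lambda>x. 1 - ?m (?s x))"
    by (rule C_on_diff[OF C_on_const C_on_compose[OF C_on_max_power s]])
  then show "C_on k UNIV ?\<beta>" by (rule C_on_compose[OF C_on_max_power])
  have sx: "?s x = (norm x / R)\<^sup>2 - 1" for x :: 'a
    by (simp add: power_mult_distrib power_inverse divide_inverse flip: power2_norm_eq_inner)
  show "?\<beta> x = 1" if "norm x \<le> R" for x
  proof -
    have "norm x / R \<le> 1" using that assms by simp
    then have "?s x \<le> 0" unfolding sx using assms by (simp add: power_le_one)
    then have "max 0 (?s x) = 0" by (simp only: max_absorb1)
    then show ?thesis by simp
  qed
  show "?\<beta> x = 0" if "norm x \<ge> 2 * R" for x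
  proof -
    have "norm x / R \<ge> 2" using that assms by (simp add: field_simps)
    then have "(norm x / R)\<^sup>2 \<ge> 2\<^sup>2" by (intro power_mono) auto
    then have "?s x \<ge> 1" unfolding sx by simp
    then have "max 0 (?s x) \<ge> 1" by simp
    then have "?m (?s x) \<ge> 1" by (rule one_le_power)
    then have "max 0 (1 - ?m (?s x)) = 0" by simp
    then show ?thesis by simp
  qed
  show "0 \<le> ?\<beta> x" for x by simp
  show "?\<beta> x \<le> 1" for x by (rule power_le_one) auto
qed

section \<open>Polynomial approximation in \<open>C\<^sup>k\<close>\<close>

text \<open>The convolution of \<open>f\<close> with the reflected kernel, truncated to
  \<open>B\<close>. Since the shift stands in \<open>f\<close>, derivatives in \<open>x\<close> fall
  on \<open>f\<close> and commute with the averaging.\<close>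

definition kernel_mean :: "'a::euclidean_space set \<Rightarrow> ('a \<Rightarrow> real) \<Rightarrow> ('a \<Rightarrow> real) \<Rightarrow> 'a \<Rightarrow> real" where
  "kernel_mean B k f x = integral B (\<lambda>u. k u * f (x + u))"

lemma kernel_mean_has_derivative:
  fixes f k :: "'a::euclidean_space \<Rightarrow> real"
  assumes k: "continuous_on UNIV k" and f: "C_on (Suc 0) UNIV f"
  shows "(kernel_mean (cbox a b) k f has_derivative
     (\<lambda>v. kernel_mean (cbox a b) k (\<lambda>y. frechet_derivative f (at y) v) x)) (at x)"
proof -
  let ?D = "\<lambda>y. frechet_derivative f (at y)"
  have df: "(f has_derivative ?D y) (at y)" for y by (rule C_on_has_derivative[OF f])
  have cD: "continuous_on UNIV (\<lambda>y. ?D y v)" for v using f by simp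
  have cf: "continuous_on UNIV f" by (rule C_on_continuous[OF f])
  have bl: "bounded_linear (\<lambda>h. k t * ?D y h)" for t y
    by (rule bounded_linear_compose[OF bounded_linear_mult_right has_derivative_bounded_linear[OF df]])
  \<comment> \<open>\<open>leibniz_rule\<close> takes the derivative of the integrand as an operator
    depending continuously on both variables; this continuity can be checked direction by
    direction.\<close>
  define fx where "fx x t = Blinfun (\<lambda>h. k t * ?D (x + t) h)" for x t
  have fx: "blinfun_apply (fx x t) = (\<lambda>h. k t * ?D (x + t) h)" for x t
    unfolding fx_def by (rule bounded_linear_Blinfun_apply[OF bl])
  have k': "continuous_on S (\<lambda>z. k (g z))" if "continuous_on S g" for S :: "'c::topological_space set" and g
    using continuous_on_compose2[OF k that] by simp
  have cfx: "continuous_on S (\<lambda>(x, t). fx x t)" for S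
  proof (rule continuous_on_blinfun_componentwise)
    fix i :: 'a
    have "continuous_on S (\<lambda>z. k (snd z) * ?D (fst z + snd z) i)"
      by (intro continuous_intros k' continuous_on_compose2[OF cD]) auto
    then show "continuous_on S (\<lambda>z. blinfun_apply (case z of (x, t) \<Rightarrow> fx x t) i)"
      by (simp add: case_prod_beta' fx)
  qed
  have "((\<lambda>x. integral (cbox a b) (\<lambda>t. k t * f (x + t))) has_derivative
     blinfun_apply (integral (cbox a b) (fx x))) (at x within UNIV)"
  proof (rule leibniz_rule)
    show "((\<lambda>x. k t * f (x + t)) has_derivative blinfun_apply (fx x t)) (at x within UNIV)" for x t
    proof -
      have "((\<lambda>x. x + t) has_derivative (\<lambda>h. h)) (at x)"
        by (auto intro!: derivative_eq_intros)
      from has_derivative_compose[OF this df]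
      have "((\<lambda>x. f (x + t)) has_derivative ?D (x + t)) (at x)" .
      then show ?thesis unfolding fx by (rule has_derivative_mult_right)
    qed
    show "(\<lambda>t. k t * f (x + t)) integrable_on cbox a b" for x
      by (intro integrable_continuous continuous_intros continuous_on_compose2[OF cf]
          continuous_on_subset[OF k]) auto
  qed (auto intro: cfx)
  moreover have "blinfun_apply (integral (cbox a b) (fx x)) v =
      integral (cbox a b) (\<lambda>t. k t * ?D (x + t) v)" for v
  proof -
    have "continuous_on (cbox a b) (\<lambda>t. (\<lambda>(x, t). fx x t) (x, t))"
      by (rule continuous_on_compose2[OF cfx[of UNIV]]) (auto intro: continuous_intros)
    then have "fx x integrable_on cbox a b" by (intro integrable_continuous) simp
    from blinfun_apply_integral[OF this] show ?thesis by (simp add: fx)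
  qed
  ultimately show ?thesis
    unfolding kernel_mean_def[abs_def] by (metis (no_types, lifting) ext)
qed

lemma iter_deriv_kernel_mean:
  fixes f k :: "'a::euclidean_space \<Rightarrow> real"
  assumes k: "continuous_on UNIV k" and f: "C_on (length vs) UNIV f"
  shows "iter_deriv UNIV (kernel_mean (cbox a b) k f) vs = kernel_mean (cbox a b) k (iter_deriv UNIV f vs)"
  using f
proof (induction vs arbitrary: f)
  case (Cons v vs)
  have "C_on (Suc 0) UNIV f" by (intro C_on_mono[OF Cons.prems]) simp
  from kernel_mean_has_derivative[OF k this]
  have "(\<lambda>x. frechet_derivative (kernel_mean (cbox a b) k f) (at x) v)
    = kernel_mean (cbox a b) k (\<lambda>y. frechet_derivative f (at y) v)"
    by (intro ext) (metis frechet_derivative_at)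
  then show ?case using Cons by simp
qed simp

lemma continuous_iter_deriv:
  "C_on (length vs) UNIV f \<Longrightarrow> continuous_on UNIV (iter_deriv UNIV f vs)"
  by (induction vs arbitrary: f) auto

lemma C_on_real_polynomial: "real_polynomial_function p \<Longrightarrow> C_on k UNIV p"
proof (induction p rule: real_polynomial_function.induct)
  case (linear f)
  then show ?case by (intro C_on_linear) (simp add: linear_conv_bounded_linear)
next
  case (const c)
  show ?case by (rule C_on_const)
next
  case (add f g)
  show ?case by (rule C_on_add[OF add.IH])
next
  case (mult f g)
  show ?case by (rule C_on_mult[OF mult.IH])
qed

lemma continuous_real_polynomial: "real_polynomial_function p \<Longrightarrow> continuous_on S p"
  by (simp add: continuous_on_polymonial_function flip: real_polynomial_function_eq)

text \<open>A tent function of small support, replaced by a polynomial through Stone-Weierstrass.\<close>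

lemma polynomial_kernel:
  fixes c h :: real and B :: "'a::euclidean_space set"
  assumes "c > 0" "h > 0"
  defines "B \<equiv> cbox (- c *\<^sub>R One) (c *\<^sub>R One)"
  obtains p t :: "'a \<Rightarrow> real" where "real_polynomial_function p" "continuous_on UNIV t"
    "\<And>u. 0 \<le> t u" "\<And>u. norm u \<ge> h \<Longrightarrow> t u = 0" "integral B t = 1" "\<And>u. u \<in> B \<Longrightarrow> \<bar>p u - t u\<bar> \<le> h"
proof -
  define s :: "'a \<Rightarrow> real" where "s u = max 0 (h - norm u)" for u
  have cs: "continuous_on S s" for S
    unfolding s_def by (intro continuous_intros)
  have ints: "s integrable_on B" unfolding B_def by (intro integrable_continuous cs)
  have box: "0 \<in> box (- c *\<^sub>R One) (c *\<^sub>R One :: 'a)" using assms(1) by (simp add: mem_box)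
  \<comment> \<open>A nonnegative continuous function with integral 0 over a box vanishes on it, but
    the tent has the value \<open>h\<close> at the origin.\<close>
  have "integral B s \<noteq> 0"
  proof
    assume "integral B s = 0"
    then have "(s has_integral 0) B" using ints integrable_integral by metis
    then have "s 0 = 0" unfolding B_def
      by (rule has_integral_0_cbox_imp_0[OF cs, rotated])
        (use box box_subset_cbox in \<open>auto simp: s_def\<close>)
    then show False using assms(2) by (simp add: s_def)
  qed
  moreover have "integral B s \<ge> 0"
    by (rule integral_nonneg[OF ints]) (simp add: s_def)
  ultimately have I: "integral B s > 0" by simp
  define t where "t u = s u / integral B s" for u
  have ct: "continuous_on S t" for S
    unfolding t_def using I by (intro continuous_intros cs) auto
  have "integral B t = 1" unfolding t_def using I by simp
  moreover have "0 \<le> t u" for u using I by (simp add: t_def s_def)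
  moreover have "t u = 0" if "norm u \<ge> h" for u using that by (simp add: t_def s_def)
  moreover obtain p where p: "real_polynomial_function p" "\<And>u. u \<in> B \<Longrightarrow> \<bar>t u - p u\<bar> < h"
    using Stone_Weierstrass_real_polynomial_function[of B t h] ct assms(2)
    unfolding B_def by (metis compact_cbox)
  moreover have "\<bar>p u - t u\<bar> \<le> h" if "u \<in> B" for u using p(2)[OF that] by simp
  ultimately show thesis using ct that by blast
qed

text \<open>The kernels are chosen before \<open>g\<close>, so the same \<open>p n\<close> serves
  all iterated derivatives of a function at once.\<close>

lemma kernel_mean_close:
  fixes c :: real and B :: "'a::euclidean_space set"
  assumes c: "c > 0"
  defines "B \<equiv> cbox (- c *\<^sub>R One) (c *\<^sub>R One)"
  obtains p :: "nat \<Rightarrow> 'a \<Rightarrow> real" where "\<And>n. real_polynomial_function (p n)"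
    "\<And>g R e. continuous_on UNIV g \<Longrightarrow> e > 0 \<Longrightarrow>
       \<forall>\<^sub>F n in sequentially. \<forall>x\<in>cball 0 R. \<bar>kernel_mean B (p n) g x - g x\<bar> \<le> e"
proof -
  let ?h = "\<lambda>n. inverse (real (Suc n))"
  have "\<exists>p t. real_polynomial_function p \<and> continuous_on UNIV t \<and> (\<forall>u. 0 \<le> t u) \<and>
    (\<forall>u. norm u \<ge> ?h n \<longrightarrow> t u = 0) \<and> integral B t = 1 \<and> (\<forall>u\<in>B. \<bar>p u - t u\<bar> \<le> ?h n)" for n
    using polynomial_kernel[OF c, of "?h n"] unfolding B_def by (metis inverse_positive_iff_positive of_nat_0_less_iff zero_less_Suc)
  then obtain p t where p: "\<And>n. real_polynomial_function (p n)" and t: "\<And>n. continuous_on UNIV (t n)"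
    "\<And>n u. 0 \<le> t n u" "\<And>n u. norm u \<ge> ?h n \<Longrightarrow> t n u = 0" "\<And>n. integral B (t n) = 1"
    and pt: "\<And>n u. u \<in> B \<Longrightarrow> \<bar>p n u - t n u\<bar> \<le> ?h n"
    by metis
  have "\<forall>\<^sub>F n in sequentially. \<forall>x\<in>cball 0 R. \<bar>kernel_mean B (p n) g x - g x\<bar> \<le> e"
    if g: "continuous_on UNIV g" and e: "e > 0" for g :: "'a \<Rightarrow> real" and R e
  proof -
    let ?K = "cball 0 (R + norm (c *\<^sub>R One :: 'a)) :: 'a set"
    have KB: "x + u \<in> ?K" if "x \<in> cball 0 R" "u \<in> B" for x u
    proof -
      have "norm u \<le> norm (c *\<^sub>R One :: 'a)"
        using that(2) unfolding B_def
        by (intro norm_le_componentwise) (auto simp: mem_box abs_le_iff inner_simps)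
      then show ?thesis using that(1) norm_triangle_ineq[of x u] by simp
    qed
    have "compact (g ` ?K)" by (intro compact_continuous_image continuous_on_subset[OF g]) auto
    then obtain M where M: "M > 0" "\<And>y. y \<in> ?K \<Longrightarrow> \<bar>g y\<bar> \<le> M"
      using compact_imp_bounded bounded_pos[of "g ` ?K"] by auto
    have "uniformly_continuous_on ?K g"
      by (intro compact_uniformly_continuous continuous_on_subset[OF g]) auto
    then obtain d where d: "d > 0" "\<And>y z. y \<in> ?K \<Longrightarrow> z \<in> ?K \<Longrightarrow> dist z y < d \<Longrightarrow> dist (g z) (g y) < e / 2"
      using e unfolding uniformly_continuous_on_def by (meson half_gt_zero)
    \<comment> \<open>Replacing the tent by the polynomial costs at most \<open>?h n * M\<close> at
      each \<open>u\<close>, hence this much after integration. The tent itself costs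
      \<open>e / 2\<close> once its support lies within the distance \<open>d\<close> of uniform
      continuity.\<close>
    have lim: "((\<lambda>n. ?h n * M * measure lborel B) \<longlongrightarrow> 0 * M * measure lborel B) sequentially"
      by (intro tendsto_intros LIMSEQ_inverse_real_of_nat)
    have ev1: "\<forall>\<^sub>F n in sequentially. ?h n * M * measure lborel B < e / 2"
      by (rule order_tendstoD(2)[OF lim]) (use e in simp)
    have ev2: "\<forall>\<^sub>F n in sequentially. ?h n < d"
      by (rule order_tendstoD(2)[OF LIMSEQ_inverse_real_of_nat d(1)])
    show ?thesis
      using ev1 ev2
    proof eventually_elim
      case (elim n)
      show ?case
      proof
        fix x :: 'a assume x: "x \<in> cball 0 R"
        have cg: "continuous_on B (\<lambda>u. g (x + u))"
          by (intro continuous_on_compose2[OF g]) (auto intro: continuous_intros)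
        have cp: "continuous_on B (p n)" by (rule continuous_real_polynomial[OF p])
        have ct: "continuous_on B (t n)" by (rule continuous_on_subset[OF t(1)]) simp
        have xK: "x \<in> ?K" using KB[OF x, of 0] c by (simp add: B_def mem_box)
        have "integral B (\<lambda>u. t n u * g x) = g x" by (simp add: t(4))
        then have "kernel_mean B (p n) g x - g x = integral B (\<lambda>u. p n u * g (x + u)) - integral B (\<lambda>u. t n u * g x)"
          by (simp add: kernel_mean_def)
        also have "\<dots> = integral B (\<lambda>u. p n u * g (x + u) - t n u * g x)"
          unfolding B_def
          by (intro integral_diff[symmetric] integrable_continuous continuous_intros cg[unfolded B_def]
              cp[unfolded B_def] ct[unfolded B_def])
        finally have eq: "kernel_mean B (p n) g x - g x = integral B (\<lambda>u. p n u * g (x + u) - t n u * g x)" .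
        have "norm (integral B (\<lambda>u. p n u * g (x + u) - t n u * g x))
          \<le> integral B (\<lambda>u. ?h n * M + t n u * (e / 2))"
        proof (rule integral_norm_bound_integral)
          show "(\<lambda>u. p n u * g (x + u) - t n u * g x) integrable_on B"
            unfolding B_def
            by (intro integrable_continuous continuous_intros cg[unfolded B_def]
                cp[unfolded B_def] ct[unfolded B_def])
          show "(\<lambda>u. ?h n * M + t n u * (e / 2)) integrable_on B"
            unfolding B_def
            by (intro integrable_continuous continuous_intros ct[unfolded B_def])
          fix u assume u: "u \<in> B"
          have 1: "\<bar>(p n u - t n u) * g (x + u)\<bar> \<le> ?h n * M"
            unfolding abs_mult by (intro mult_mono pt u M KB x) auto
          have 2: "\<bar>t n u * (g (x + u) - g x)\<bar> \<le> t n u * (e / 2)"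
          proof (cases "norm u \<ge> ?h n")
            case False
            then have "dist (g (x + u)) (g x) < e / 2"
              using elim(2) by (intro d KB x u xK) (auto simp: dist_norm)
            then show ?thesis unfolding abs_mult
              using t(2) by (intro mult_mono) (auto simp: dist_norm)
          qed (simp add: t(3))
          have "p n u * g (x + u) - t n u * g x = (p n u - t n u) * g (x + u) + t n u * (g (x + u) - g x)"
            by (simp add: algebra_simps)
          then show "norm (p n u * g (x + u) - t n u * g x) \<le> ?h n * M + t n u * (e / 2)"
            using 1 2 abs_triangle_ineq[of "(p n u - t n u) * g (x + u)" "t n u * (g (x + u) - g x)"] by simp
        qed
        also have "\<dots> = integral B (\<lambda>u. ?h n * M) + integral B (\<lambda>u. t n u * (e / 2))"
          unfolding B_def
          by (intro integral_add integrable_continuous continuous_intros ct[unfolded B_def])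
        also have "integral B (\<lambda>u. t n u * (e / 2)) = e / 2" by (simp add: t(4))
        also have "integral B (\<lambda>u. ?h n * M) = ?h n * M * measure lborel B"
          unfolding B_def by simp
        finally show "\<bar>kernel_mean B (p n) g x - g x\<bar> \<le> e"
          using elim(1) eq by simp
      qed
    qed
  qed
  then show thesis using that p by blast
qed

text \<open>Degenerate kernels: integrating out \<open>y\<close> leaves a polynomial in
  \<open>x\<close>, and multiplication by a polynomial in \<open>y - x\<close> preserves the
  form.\<close>

inductive separable :: "('a::euclidean_space \<Rightarrow> 'a \<Rightarrow> real) \<Rightarrow> bool" where
  base: "real_polynomial_function a \<Longrightarrow> continuous_on UNIV b \<Longrightarrow> separable (\<lambda>x y. a x * b y)"
| add: "separable s \<Longrightarrow> separable s' \<Longrightarrow> separable (\<lambda>x y. s x y + s' x y)"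

text \<open>A linear functional splits as \<open>f (y - x) = f y - f x\<close>; products are handled
  by multiplying with one factor after the other, which is why \<open>s\<close> is generalized in
  the induction.\<close>

lemma separable_mult_kernel:
  assumes "real_polynomial_function k" "separable s"
  shows "separable (\<lambda>x y. s x y * k (y - x))"
  using assms
proof (induction k arbitrary: s rule: real_polynomial_function.induct)
  case (linear f)
  have f: "f (y - x) = f y - f x" for x y using linear(1) by (rule bounded_linear.linear[THEN linear_diff])
  have cf: "continuous_on UNIV f" using linear(1) by (simp add: linear_continuous_on)
  from linear(2) show ?case
  proof induction
    case (base a b)
    have "separable (\<lambda>x y. a x * (b y * f y) + (- (a x * f x)) * b y)"
      using base linear(1) cf
      by (intro separable.intros continuous_intros real_polynomial_function_minus) auto
    then show ?case by (simp add: f algebra_simps)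
  next
    case (add s s')
    then show ?case using separable.add[of "\<lambda>x y. s x y * f (y - x)"] by (simp add: algebra_simps)
  qed
next
  case (const c)
  from const show ?case
  proof induction
    case (base a b)
    have "separable (\<lambda>x y. a x * (b y * c))"
      using base by (intro separable.intros continuous_intros)
    then show ?case by (simp add: algebra_simps)
  next
    case (add s s')
    then show ?case using separable.add[of "\<lambda>x y. s x y * c"] by (simp add: algebra_simps)
  qed
next
  case (add f g)
  show ?case
    using separable.add[OF add.IH(1)[OF add.prems] add.IH(2)[OF add.prems]] by (simp add: algebra_simps)
next
  case (mult f g)
  show ?case
    using mult.IH(2)[OF mult.IH(1)[OF mult.prems]] by (simp add: algebra_simps)
qed

lemma separable_integral:
  assumes "separable s"
  shows "(\<forall>x. s x integrable_on cbox a b) \<and> real_polynomial_function (\<lambda>x. integral (cbox a b) (s x))"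
  using assms
proof induction
  case (base p q)
  have q: "q integrable_on cbox a b"
    by (intro integrable_continuous continuous_on_subset[OF base(2)]) simp
  have "real_polynomial_function (\<lambda>x. p x * integral (cbox a b) q)"
    using base by auto
  then show ?case using q by (simp add: integrable_on_mult_right)
next
  case (add s s')
  then show ?case
    by (auto simp: integral_add intro: integrable_add)
qed

text \<open>Substituting \<open>y = x + u\<close> moves \<open>x\<close> from \<open>f\<close> into
  the kernel. The box moves as well, but by \<open>d + R \<le> c\<close> the old and the new box
  both contain the support of \<open>f\<close>, so the integral may be taken over a fixed
  one.\<close>

lemma kernel_mean_polynomial:
  fixes c R d :: real and f k :: "'a::euclidean_space \<Rightarrow> real"
  defines "B \<equiv> cbox (- c *\<^sub>R One) (c *\<^sub>R One :: 'a)"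
  assumes f: "continuous_on UNIV f" "\<And>x. norm x \<ge> d \<Longrightarrow> f x = 0" and c: "d + R \<le> c" "R \<ge> 0"
    and k: "real_polynomial_function k"
  obtains p where "real_polynomial_function p" "\<And>x. norm x \<le> R \<Longrightarrow> p x = kernel_mean B k f x"
proof
  let ?\<phi> = "\<lambda>x y. f y * k (y - x)"
  have "separable (\<lambda>x y. 1 * f y)"
    by (rule separable.base[OF _ f(1)]) auto
  then have sep: "separable ?\<phi>" using separable_mult_kernel[OF k, of "\<lambda>x y. f y"] by simp
  show "real_polynomial_function (\<lambda>x. integral B (?\<phi> x))"
    unfolding B_def using separable_integral[OF sep] by blast
  fix x :: 'a assume x: "norm x \<le> R"
  let ?B' = "cbox (- c *\<^sub>R One + x) (c *\<^sub>R One + x)"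
  have far: "norm y > c" if "y \<notin> B" for y
  proof -
    obtain i where i: "i \<in> Basis" "\<not> (- c \<le> y \<bullet> i \<and> y \<bullet> i \<le> c)"
      using \<open>y \<notin> B\<close> by (auto simp: B_def mem_box)
    then have "\<bar>y \<bullet> i\<bar> > c" by auto
    then show ?thesis using Basis_le_norm[OF i(1), of y] by simp
  qed
  have out: "?\<phi> x y = 0" if "y \<notin> B" for y
    using far[OF that] f(2)[of y] c by simp
  have out': "?\<phi> x y = 0" if "y \<notin> ?B'" for y
  proof -
    have "y - x \<notin> B" using that by (simp add: B_def mem_box algebra_simps)
    then have "norm (y - x) > c" by (rule far)
    then have "norm y > d" using norm_triangle_ineq4[of y x] x c by simp
    then show ?thesis using f(2) by simp
  qed
  have "integral B (?\<phi> x) = integral UNIV (\<lambda>y. if y \<in> B then ?\<phi> x y else 0)"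
    by (simp add: Henstock_Kurzweil_Integration.integral_restrict_UNIV)
  also have "(\<lambda>y. if y \<in> B then ?\<phi> x y else 0) = (\<lambda>y. if y \<in> ?B' then ?\<phi> x y else 0)"
    using out out' by fastforce
  also have "integral UNIV \<dots> = integral ?B' (?\<phi> x)"
    by (simp add: Henstock_Kurzweil_Integration.integral_restrict_UNIV)
  also have "\<dots> = integral B (\<lambda>u. ?\<phi> x (u + x))"
    using integral_shift_cbox[of "- c *\<^sub>R One + x" x "c *\<^sub>R One + x" "?\<phi> x"] by (simp add: B_def)
  also have "\<dots> = kernel_mean B k f x"
    by (simp add: kernel_mean_def mult.commute add.commute)
  finally show "integral B (?\<phi> x) = kernel_mean B k f x" .
qed

theorem C_closure_real_polynomial:
  fixes f :: "'a::euclidean_space \<Rightarrow> real"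
  assumes f: "C_on r UNIV f"
  shows "f \<in> C_closure r (Collect real_polynomial_function)"
proof -
  have "\<exists>p\<in>Collect real_polynomial_function. C_close r (cball 0 R) e p f" if e: "e > 0" for R e
  proof -
    \<comment> \<open>The cut-off function equals 1 on the open ball of radius
      \<open>\<rho> > R\<close>, so derivatives on \<open>cball 0 R\<close> are unaffected.\<close>
    define \<rho> where "\<rho> = max R 0 + 1"
    have \<rho>: "\<rho> > 0" "R < \<rho>" by (auto simp: \<rho>_def)
    obtain \<beta> :: "'a \<Rightarrow> real" where \<beta>: "C_on r UNIV \<beta>" "\<And>x. norm x \<le> \<rho> \<Longrightarrow> \<beta> x = 1"
       "\<And>x. norm x \<ge> 2 * \<rho> \<Longrightarrow> \<beta> x = 0"
      using bump_function[OF \<rho>(1), where k = r and 'a = 'a] by metis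
    let ?g = "\<lambda>x. \<beta> x * f x"
    have g: "C_on r UNIV ?g" by (rule C_on_mult[OF \<beta>(1) f])
    \<comment> \<open>The support has radius \<open>2 * \<rho>\<close> and the points have norm at
      most \<rho>; the box must accommodate the sum.\<close>
    have c: "3 * \<rho> > 0" using \<rho> by simp
    let ?B = "cbox (- (3 * \<rho>) *\<^sub>R One) ((3 * \<rho>) *\<^sub>R One :: 'a)"
    obtain p where p: "\<And>n. real_polynomial_function (p n)"
      and conv: "\<And>g R e. continuous_on UNIV g \<Longrightarrow> e > 0 \<Longrightarrow>
        \<forall>\<^sub>F n in sequentially. \<forall>x\<in>cball 0 R. \<bar>kernel_mean ?B (p n) g x - g x\<bar> \<le> e"
      using kernel_mean_close[OF c] by blast
    let ?L = "{bs. set bs \<subseteq> (Basis :: 'a set) \<and> length bs \<le> r}"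
    \<comment> \<open>Because averaging commutes with derivatives, \<open>C\<^sup>r\<close>
      closeness reduces to finitely many uniform estimates, one for each iterated derivative of
      \<open>?g\<close>.\<close>
    have "\<forall>\<^sub>F n in sequentially. \<forall>bs\<in>?L. \<forall>x\<in>cball 0 R.
       \<bar>kernel_mean ?B (p n) (iter_deriv UNIV ?g bs) x - iter_deriv UNIV ?g bs x\<bar> \<le> e"
      using finite_lists_length_le[of "Basis :: 'a set" r]
      by (intro eventually_ball_finite ballI conv e continuous_iter_deriv)
        (auto intro: C_on_mono[OF g])
    then obtain n where n: "\<forall>bs\<in>?L. \<forall>x\<in>cball 0 R.
       \<bar>kernel_mean ?B (p n) (iter_deriv UNIV ?g bs) x - iter_deriv UNIV ?g bs x\<bar> \<le> e"
      using eventually_happens'[OF sequentially_bot] by blast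
    have close: "C_close r (cball 0 R) e (kernel_mean ?B (p n) ?g) ?g"
      unfolding C_close_def
    proof safe
      fix bs and x :: 'a assume bs: "set bs \<subseteq> (Basis :: 'a set)" "length bs \<le> r" "x \<in> cball 0 R"
      have "iter_deriv UNIV (kernel_mean ?B (p n) ?g) bs = kernel_mean ?B (p n) (iter_deriv UNIV ?g bs)"
        by (rule iter_deriv_kernel_mean) (use bs in \<open>auto intro: continuous_real_polynomial p C_on_mono[OF g]\<close>)
      then show "norm (iter_deriv UNIV (kernel_mean ?B (p n) ?g) bs x - iter_deriv UNIV ?g bs x) \<le> e"
        using n bs by simp
    qed
    obtain q where q: "real_polynomial_function q" "\<And>x. norm x \<le> \<rho> \<Longrightarrow> q x = kernel_mean ?B (p n) ?g x"
      by (rule kernel_mean_polynomial[where d = "2 * \<rho>" and R = \<rho> and c = "3 * \<rho>" and f = ?g and k = "p n"])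
        (use C_on_continuous[OF g] \<beta>(3) \<rho>(1) p in simp_all)
    have "C_close r (cball 0 R) e q f = C_close r (cball 0 R) e (kernel_mean ?B (p n) ?g) ?g"
      using \<rho>(2) q(2) \<beta>(2) by (intro C_close_cong_open[of "ball 0 \<rho>"]) auto
    then show ?thesis using close q(1) by blast
  qed
  then show ?thesis using f by (simp add: C_closure_def)
qed

section \<open>Density of multilayer perceptrons in \<open>C\<^sup>k\<close>\<close>

lemma Cconv_param:
  assumes "(c \<longlongrightarrow> c0) G"
  shows "Cconv k G (\<lambda>i (x::'a::euclidean_space). c i) (\<lambda>x. c0)"
proof -
  have j: "jlim G (\<lambda>i (x::'a). c i) (\<lambda>x. c0)"
    unfolding jlim_def case_prod_beta'
    by (intro allI filterlim_compose[OF assms filterlim_fst])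
  show ?thesis
  proof (cases k)
    case (Suc k')
    show ?thesis
      unfolding Suc by (rule Cconv_SucI[OF j, where F' = "\<lambda>i x v. 0" and f' = "\<lambda>x v. 0"])
        (auto intro: Cconv_const)
  qed (simp add: j)
qed

lemma Cconv_ident:
  assumes "G \<noteq> bot"
  shows "Cconv k G (\<lambda>_ x. x) (\<lambda>x. x)"
  using Cconv_const_iff[OF assms, of k "\<lambda>x. x"] C_on_ident by blast

text \<open>On the line, derivatives converging uniformly on bounded sets together with equal values
  at 0 force convergence of the functions, by the mean value inequality.\<close>

lemma Cconv_SucI_real:
  fixes F F' :: "'i \<Rightarrow> real \<Rightarrow> real"
  assumes F: "\<forall>\<^sub>F i in G. F i 0 = f 0 \<and> (\<forall>x. (F i has_real_derivative F' i x) (at x))"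
    and f: "\<And>x. (f has_real_derivative f' x) (at x)"
    and conv: "Cconv k G F' f'" and f'C: "C_on k UNIV f'"
  shows "Cconv (Suc k) G F f"
proof (rule Cconv_SucI)
  show "\<forall>\<^sub>F i in G. \<forall>x. (F i has_derivative (\<lambda>v. F' i x * v)) (at x)"
    using F by eventually_elim (auto simp: has_field_derivative_def)
  show "(f has_derivative (\<lambda>v. f' x * v)) (at x)" for x
    using f by (simp add: has_field_derivative_def)
  show "Cconv k G (\<lambda>i x. F' i x * v) (\<lambda>x. f' x * v)" for v
    using Cconv_scaleR[OF conv Cconv_const, of v] by simp
  show "jlim G F f"
  proof (rule C_close_imp_jlim)
    show "continuous_on UNIV f"
      using f by (meson DERIV_continuous continuous_at_imp_continuous_on)
    fix R e :: real assume e: "e > 0"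
    have "e / (\<bar>R\<bar> + 1) > 0" using e by simp
    then have "\<forall>\<^sub>F i in G. \<forall>x\<in>cball 0 R. norm (F' i x - f' x) \<le> e / (\<bar>R\<bar> + 1)"
      by (intro jlim_imp_uniform_on_compact[OF Cconv_jlim[OF conv] C_on_continuous[OF f'C]]) auto
    with F show "\<forall>\<^sub>F i in G. C_close 0 (cball 0 R) e (F i) f"
    proof eventually_elim
      case (elim i)
      have "norm (F i x - f x) \<le> e" if x: "x \<in> cball 0 R" for x
      proof -
        have "norm ((F i x - f x) - (F i 0 - f 0)) \<le> e / (\<bar>R\<bar> + 1) * norm (x - 0)"
        proof (rule field_differentiable_bound[of "cball 0 R" _ "\<lambda>x. F' i x - f' x"])
          show "((\<lambda>x. F i x - f x) has_real_derivative F' i z - f' z) (at z within cball 0 R)" for z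
            by (rule has_field_derivative_at_within[OF DERIV_diff[OF elim(1)[THEN conjunct2, THEN spec] f]])
        qed (use elim x in auto)
        also have "\<dots> \<le> e / (\<bar>R\<bar> + 1) * (\<bar>R\<bar> + 1)"
          using x e by (intro mult_left_mono) auto
        also have "\<dots> = e" by simp
        finally show ?thesis using elim(1) by simp
      qed
      then show ?case by (simp add: C_close_0)
    qed
  qed
qed

definition fderiv :: "(real \<Rightarrow> real) \<Rightarrow> real \<Rightarrow> real" where
  "fderiv f x = frechet_derivative f (at x) 1"

lemma C_on_fderiv: "C_on (Suc k) UNIV f \<Longrightarrow> C_on k UNIV (fderiv f)"
  unfolding fderiv_def[abs_def] by simp

lemma fderiv:
  assumes "C_on (Suc k) UNIV f"
  shows "(f has_real_derivative fderiv f x) (at x)"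
proof -
  have d: "(f has_derivative frechet_derivative f (at x)) (at x)"
    by (rule C_on_has_derivative[OF assms])
  have "frechet_derivative f (at x) = (*) (fderiv f x)"
  proof
    fix v
    show "frechet_derivative f (at x) v = fderiv f x * v"
      using linear_cmul[OF has_derivative_linear[OF d], of v 1] by (simp add: fderiv_def mult.commute)
  qed
  then show ?thesis using d by (simp add: has_field_derivative_def)
qed

lemma Cconv_rescaled:
  fixes \<sigma> :: "real \<Rightarrow> real"
  assumes "C_on k UNIV \<sigma>"
  shows "Cconv k (at 0) (\<lambda>h t. \<sigma> (b + h * t)) (\<lambda>_. \<sigma> b)"
proof -
  have "Cconv k (at 0) (\<lambda>h t. b + h *\<^sub>R t) (\<lambda>t::real. b + 0 *\<^sub>R t)"
    by (intro Cconv_add Cconv_const Cconv_scaleR Cconv_param Cconv_ident tendsto_ident_at) simp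
  from Cconv_compose[OF _ this, of "\<lambda>_. \<sigma>" \<sigma>] show ?thesis
    using assms by (simp add: Cconv_const_iff)
qed

text \<open>The derivative in \<open>t\<close> is
  \<open>fderiv \<sigma> (b + h * t) / fderiv \<sigma> b\<close>, a rescaled function tending to 1.
  Hence the convergence has the full order of smoothness of \<sigma>.\<close>

lemma difference_quotient_Cconv:
  fixes \<sigma> :: "real \<Rightarrow> real"
  assumes C: "C_on (Suc k) UNIV \<sigma>" and b: "fderiv \<sigma> b \<noteq> 0"
  shows "Cconv (Suc k) (at 0) (\<lambda>h t. (\<sigma> (b + h * t) - \<sigma> b) / (h * fderiv \<sigma> b)) (\<lambda>t. t)"
proof (rule Cconv_SucI_real)
  have "\<forall>\<^sub>F h::real in at 0. h \<noteq> 0" by (rule eventually_neq_at_within)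
  then show "\<forall>\<^sub>F h in at 0. (\<sigma> (b + h * 0) - \<sigma> b) / (h * fderiv \<sigma> b) = 0 \<and>
     (\<forall>t. ((\<lambda>t. (\<sigma> (b + h * t) - \<sigma> b) / (h * fderiv \<sigma> b)) has_real_derivative
        fderiv \<sigma> (b + h * t) / fderiv \<sigma> b) (at t))"
  proof eventually_elim
    case (elim h)
    have "((\<lambda>t. \<sigma> (b + h * t)) has_real_derivative fderiv \<sigma> (b + h * t) * h) (at t)" for t
      by (rule DERIV_chain2[OF fderiv[OF C]]) (auto intro!: derivative_eq_intros)
    then have "((\<lambda>t. (\<sigma> (b + h * t) - \<sigma> b) / (h * fderiv \<sigma> b)) has_real_derivative
        (fderiv \<sigma> (b + h * t) * h - 0) / (h * fderiv \<sigma> b)) (at t)" for t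
      by (intro DERIV_cdivide DERIV_diff DERIV_const)
    then show ?case using elim by simp
  qed
  show "((\<lambda>t. t) has_real_derivative (\<lambda>_. fderiv \<sigma> b * inverse (fderiv \<sigma> b)) t) (at t)" for t
    using b by simp
  have "Cconv k (at 0) (\<lambda>h t. fderiv \<sigma> (b + h * t) *\<^sub>R inverse (fderiv \<sigma> b))
      (\<lambda>_. fderiv \<sigma> b *\<^sub>R inverse (fderiv \<sigma> b))"
    by (intro Cconv_scaleR Cconv_const Cconv_rescaled C_on_fderiv C)
  then show "Cconv k (at 0) (\<lambda>h t. fderiv \<sigma> (b + h * t) / fderiv \<sigma> b)
      (\<lambda>_. fderiv \<sigma> b * inverse (fderiv \<sigma> b))"
    by (simp add: divide_inverse)
qed (rule C_on_const)

text \<open>With \<open>?Q\<close> the normalized difference quotient of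
  \<open>fderiv \<sigma>\<close>, the derivative in \<open>t\<close> is
  \<open>?Q h t - ?Q h (- t)\<close>, which tends to \<open>2 * t\<close>. Again no order is
  lost.\<close>

lemma second_difference_Cconv:
  fixes \<sigma> :: "real \<Rightarrow> real"
  assumes C: "C_on (Suc (Suc k)) UNIV \<sigma>" and b: "fderiv (fderiv \<sigma>) b \<noteq> 0"
  shows "Cconv (Suc (Suc k)) (at 0)
    (\<lambda>h t. (\<sigma> (b + h * t) + \<sigma> (b + h * (- t)) - 2 * \<sigma> b) / (h\<^sup>2 * fderiv (fderiv \<sigma>) b)) (\<lambda>t. t\<^sup>2)"
proof (rule Cconv_SucI_real)
  let ?Q = "\<lambda>h t. (fderiv \<sigma> (b + h * t) - fderiv \<sigma> b) / (h * fderiv (fderiv \<sigma>) b)"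
  have "\<forall>\<^sub>F h::real in at 0. h \<noteq> 0" by (rule eventually_neq_at_within)
  then show "\<forall>\<^sub>F h in at 0.
     (\<sigma> (b + h * 0) + \<sigma> (b + h * (- 0)) - 2 * \<sigma> b) / (h\<^sup>2 * fderiv (fderiv \<sigma>) b) = 0\<^sup>2 \<and>
     (\<forall>t. ((\<lambda>t. (\<sigma> (b + h * t) + \<sigma> (b + h * (- t)) - 2 * \<sigma> b) / (h\<^sup>2 * fderiv (fderiv \<sigma>) b))
        has_real_derivative ?Q h t + (-1) *\<^sub>R ?Q h ((-1) *\<^sub>R t)) (at t))"
  proof eventually_elim
    case (elim h)
    have 1: "((\<lambda>t. \<sigma> (b + h * t)) has_real_derivative fderiv \<sigma> (b + h * t) * h) (at t)" for t
      by (rule DERIV_chain2[OF fderiv[OF C]]) (auto intro!: derivative_eq_intros)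
    have 2: "((\<lambda>t. \<sigma> (b + h * (- t))) has_real_derivative fderiv \<sigma> (b + h * (- t)) * (- h)) (at t)" for t
      by (rule DERIV_chain2[OF fderiv[OF C]]) (auto intro!: derivative_eq_intros)
    have 3: "((\<lambda>t. (\<sigma> (b + h * t) + \<sigma> (b + h * (- t)) - 2 * \<sigma> b) / (h\<^sup>2 * fderiv (fderiv \<sigma>) b))
      has_real_derivative (fderiv \<sigma> (b + h * t) * h + fderiv \<sigma> (b + h * (- t)) * (- h) - 0)
        / (h\<^sup>2 * fderiv (fderiv \<sigma>) b)) (at t)" for t
      by (intro DERIV_cdivide DERIV_diff DERIV_add DERIV_const 1 2)
    have "(fderiv \<sigma> (b + h * t) * h + fderiv \<sigma> (b + h * (- t)) * (- h) - 0)
        / (h\<^sup>2 * fderiv (fderiv \<sigma>) b) = ?Q h t + (-1) *\<^sub>R ?Q h ((-1) *\<^sub>R t)" for t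
      using elim b by (simp add: divide_simps power2_eq_square) (simp add: algebra_simps)
    then show ?case using 3 by simp
  qed
  have Q: "Cconv (Suc k) (at 0) ?Q (\<lambda>t. t)"
    by (rule difference_quotient_Cconv[OF C_on_fderiv[OF C] b])
  have m: "Cconv (Suc k) (at (0::real)) (\<lambda>_ t. (-1) *\<^sub>R t) (\<lambda>t::real. (-1) *\<^sub>R t)"
    by (intro Cconv_scaleR Cconv_const Cconv_ident) simp
  show "Cconv (Suc k) (at 0) (\<lambda>h t. ?Q h t + (-1) *\<^sub>R ?Q h ((-1) *\<^sub>R t)) (\<lambda>t. t + (-1) *\<^sub>R ((-1) *\<^sub>R t))"
    by (rule Cconv_add[OF Q Cconv_scaleR[OF Cconv_const Cconv_compose[OF Q m]]])
  show "((\<lambda>t. t\<^sup>2) has_real_derivative t + (-1) *\<^sub>R ((-1) *\<^sub>R t)) (at t)" for t :: real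
    by (auto intro!: derivative_eq_intros)
  show "C_on (Suc k) UNIV (\<lambda>t::real. t + (-1) *\<^sub>R ((-1) *\<^sub>R t))"
    by (intro C_on_add C_on_scaleR C_on_const C_on_ident)
qed

section \<open>Points where the derivatives of \<sigma> do not vanish\<close>

lemma activation_fderiv_nonzero:
  assumes "\<sigma> \<in> activations (Suc k)"
  obtains b where "fderiv \<sigma> b \<noteq> 0"
proof -
  have C: "C_on (Suc k) UNIV \<sigma>" using assms by (simp add: activations_def)
  have "\<exists>b. fderiv \<sigma> b \<noteq> 0"
  proof (rule ccontr)
    assume "\<nexists>b. fderiv \<sigma> b \<noteq> 0"
    then have "(\<sigma> has_real_derivative 0) (at x)" for x using fderiv[OF C, of x] by simp
    then have "\<sigma> x = \<sigma> 0" for x using DERIV_const_ratio_const DERIV_isconst_all by blast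
    then show False using assms by (auto simp: activations_def constant_on_def)
  qed
  then show thesis using that by blast
qed

text \<open>Otherwise \<sigma> would be affine with nonzero slope, in conflict with
  boundedness.\<close>

lemma activation_fderiv2_nonzero:
  assumes "\<sigma> \<in> activations (Suc (Suc k))"
  obtains b where "fderiv (fderiv \<sigma>) b \<noteq> 0"
proof -
  have C: "C_on (Suc (Suc k)) UNIV \<sigma>" using assms by (simp add: activations_def)
  obtain b0 where b0: "fderiv \<sigma> b0 \<noteq> 0" using activation_fderiv_nonzero[OF assms] .
  have "\<exists>b. fderiv (fderiv \<sigma>) b \<noteq> 0"
  proof (rule ccontr)
    assume "\<nexists>b. fderiv (fderiv \<sigma>) b \<noteq> 0"
    then have "(fderiv \<sigma> has_real_derivative 0) (at x)" for x
      using fderiv[OF C_on_fderiv[OF C], of x] by simp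
    then have const: "fderiv \<sigma> x = fderiv \<sigma> b0" for x using DERIV_isconst_all by blast
    let ?s = "fderiv \<sigma> b0"
    have "((\<lambda>x. \<sigma> x - ?s * x) has_real_derivative 0) (at x)" for x
      using fderiv[OF C, of x] const[of x] by (auto intro!: derivative_eq_intros)
    then have "\<sigma> x - ?s * x = \<sigma> 0 - ?s * 0" for x using DERIV_isconst_all by blast
    then have aff: "\<sigma> x = \<sigma> 0 + ?s * x" for x by (metis add.commute diff_add_cancel diff_zero mult_zero_right)
    obtain M where M: "\<And>x. \<bar>\<sigma> x\<bar> \<le> M"
      using assms unfolding activations_def bounded_iff by auto
    \<comment> \<open>The argument is chosen so that the affine function has a value of at least
      \<open>M + 1\<close> there.\<close>
    have "\<sigma> ((M + \<bar>\<sigma> 0\<bar> + 1) / ?s) = \<sigma> 0 + (M + \<bar>\<sigma> 0\<bar> + 1)"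
      using aff[of "(M + \<bar>\<sigma> 0\<bar> + 1) / ?s"] b0 by simp
    then show False using M[of "(M + \<bar>\<sigma> 0\<bar> + 1) / ?s"] by linarith
  qed
  then show thesis using that by blast
qed

text \<open>\<open>L\<close> counts the hidden layers after the first. \<open>hidden_layers\<close>
  forgets the depth, but only stacks of equal depth can be placed side by side, and this is how
  perceptrons are added.\<close>

primrec layer ::
  "(real \<Rightarrow> real) \<Rightarrow> nat \<Rightarrow> nat \<Rightarrow> ('a::euclidean_space \<Rightarrow> nat \<Rightarrow> real) \<Rightarrow> bool" where
  "layer \<sigma> 0 N h \<longleftrightarrow> N \<ge> 1 \<and> (\<exists>w b. h = (\<lambda>x j. \<sigma> (w j \<bullet> x + b j)))"
| "layer \<sigma> (Suc L) N h \<longleftrightarrow> N \<ge> 1 \<and>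
     (\<exists>M g W b. layer \<sigma> L M g \<and> h = (\<lambda>x j. \<sigma> ((\<Sum>k<M. W j k * g x k) + b j)))"

definition perceptrons ::
  "(real \<Rightarrow> real) \<Rightarrow> nat \<Rightarrow> ('a::euclidean_space \<Rightarrow> 'b::real_normed_vector) set" where
  "perceptrons \<sigma> L = {g. \<exists>N h v c. layer \<sigma> L N h \<and> g = (\<lambda>x. (\<Sum>j<N. h x j *\<^sub>R v j) + c)}"

lemma perceptronsI:
  "layer \<sigma> L N h \<Longrightarrow> g = (\<lambda>x. (\<Sum>j<N. h x j *\<^sub>R v j) + c) \<Longrightarrow> g \<in> perceptrons \<sigma> L"
  unfolding perceptrons_def by blast

lemma layer_hidden_layers: "layer \<sigma> L N h \<Longrightarrow> hidden_layers \<sigma> N h"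
  by (induction L arbitrary: N h) (auto intro: hidden_layers.intros)

lemma perceptrons_subset_networks:
  "\<sigma> \<in> activations s \<Longrightarrow> perceptrons \<sigma> L \<subseteq> networks s \<sigma>"
  unfolding perceptrons_def networks_def using layer_hidden_layers by blast

lemma sum_lessThan_add: "(\<Sum>k<M + N. F k) = (\<Sum>k<M. F k) + (\<Sum>k<N. F (M + k :: nat))"
  for F :: "nat \<Rightarrow> 'c::comm_monoid_add"
  by (induction N) (auto simp: add.assoc)

text \<open>The weights of the two stacks form block diagonal matrices, so the stacks do not
  interact.\<close>

lemma layer_append:
  assumes "layer \<sigma> L N1 h1" "layer \<sigma> L N2 h2"
  shows "layer \<sigma> L (N1 + N2) (\<lambda>x j. if j < N1 then h1 x j else h2 x (j - N1))"
  using assms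
proof (induction L arbitrary: N1 N2 h1 h2)
  case 0
  from 0 obtain w1 b1 w2 b2 where "h1 = (\<lambda>x j. \<sigma> (w1 j \<bullet> x + b1 j))" "h2 = (\<lambda>x j. \<sigma> (w2 j \<bullet> x + b2 j))"
    by auto
  then have "(\<lambda>x j. if j < N1 then h1 x j else h2 x (j - N1)) =
      (\<lambda>x j. \<sigma> ((\<lambda>j. if j < N1 then w1 j else w2 (j - N1)) j \<bullet> x
        + (\<lambda>j. if j < N1 then b1 j else b2 (j - N1)) j))" by (auto simp: fun_eq_iff)
  moreover have "N1 + N2 \<ge> 1" using 0 by simp
  ultimately show ?case unfolding layer.simps by (intro conjI exI)
next
  case (Suc L)
  obtain M1 g1 W1 b1 where 1: "layer \<sigma> L M1 g1" "h1 = (\<lambda>x j. \<sigma> ((\<Sum>k<M1. W1 j k * g1 x k) + b1 j))"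
    using Suc.prems(1) by auto
  obtain M2 g2 W2 b2 where 2: "layer \<sigma> L M2 g2" "h2 = (\<lambda>x j. \<sigma> ((\<Sum>k<M2. W2 j k * g2 x k) + b2 j))"
    using Suc.prems(2) by auto
  let ?g = "\<lambda>x j. if j < M1 then g1 x j else g2 x (j - M1)"
  define W where "W j k = (if j < N1 then (if k < M1 then W1 j k else 0)
    else (if k < M1 then 0 else W2 (j - N1) (k - M1)))" for j k
  define b where "b j = (if j < N1 then b1 j else b2 (j - N1))" for j
  have "(\<lambda>x j. if j < N1 then h1 x j else h2 x (j - N1)) = (\<lambda>x j. \<sigma> ((\<Sum>k<M1 + M2. W j k * ?g x k) + b j))"
    by (auto simp: fun_eq_iff sum_lessThan_add 1 2 W_def b_def)
  moreover have "N1 + N2 \<ge> 1" using Suc.prems by simp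
  ultimately show ?case unfolding layer.simps using Suc.IH[OF 1(1) 2(1)] by blast
qed

lemma layer_exists: "\<exists>N (h :: 'a::euclidean_space \<Rightarrow> nat \<Rightarrow> real). layer \<sigma> L N h"
proof (induction L)
  case (Suc L)
  then obtain N and h :: "'a \<Rightarrow> nat \<Rightarrow> real" where "layer \<sigma> L N h" by blast
  then have "layer \<sigma> (Suc L) 1 (\<lambda>x j. \<sigma> ((\<Sum>k<N. 0 * h x k) + 0))"
    unfolding layer.simps
    by (intro conjI exI[of _ N] exI[of _ h] exI[of _ "\<lambda>_ _. 0"] exI[of _ "\<lambda>_. 0"]) auto
  then show ?case by blast
qed auto

lemma perceptrons_const: "(\<lambda>x::'a::euclidean_space. c) \<in> perceptrons \<sigma> L"
proof -
  obtain N and h :: "'a \<Rightarrow> nat \<Rightarrow> real" where "layer \<sigma> L N h" using layer_exists by blast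
  then show ?thesis by (rule perceptronsI[where v = "\<lambda>_. 0" and c = c]) simp
qed

lemma perceptrons_add:
  assumes "f \<in> perceptrons \<sigma> L" "g \<in> perceptrons \<sigma> L"
  shows "(\<lambda>x. f x + g x) \<in> perceptrons \<sigma> L"
proof -
  obtain N1 h1 v1 c1 where 1: "layer \<sigma> L N1 h1" "f = (\<lambda>x. (\<Sum>j<N1. h1 x j *\<^sub>R v1 j) + c1)"
    using assms(1) unfolding perceptrons_def by blast
  obtain N2 h2 v2 c2 where 2: "layer \<sigma> L N2 h2" "g = (\<lambda>x. (\<Sum>j<N2. h2 x j *\<^sub>R v2 j) + c2)"
    using assms(2) unfolding perceptrons_def by blast
  have "(\<lambda>x. f x + g x) = (\<lambda>x. (\<Sum>j<N1 + N2. (if j < N1 then h1 x j else h2 x (j - N1)) *\<^sub>R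
      (if j < N1 then v1 j else v2 (j - N1))) + (c1 + c2))"
    by (auto simp: fun_eq_iff sum_lessThan_add 1 2)
  then show ?thesis by (rule perceptronsI[OF layer_append[OF 1(1) 2(1)]])
qed

lemma perceptrons_linear:
  assumes "linear T" "f \<in> perceptrons \<sigma> L"
  shows "(\<lambda>x. T (f x)) \<in> perceptrons \<sigma> L"
proof -
  obtain N h v c where 1: "layer \<sigma> L N h" "f = (\<lambda>x. (\<Sum>j<N. h x j *\<^sub>R v j) + c)"
    using assms(2) unfolding perceptrons_def by blast
  have "(\<lambda>x. T (f x)) = (\<lambda>x. (\<Sum>j<N. h x j *\<^sub>R T (v j)) + T c)"
    by (simp add: 1 linear_add[OF assms(1)] linear_sum[OF assms(1)] linear_cmul[OF assms(1)])
  then show ?thesis by (rule perceptronsI[OF 1(1)])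
qed

lemma perceptrons_scale: "f \<in> perceptrons \<sigma> L \<Longrightarrow> (\<lambda>x. c * f x :: real) \<in> perceptrons \<sigma> L"
  using perceptrons_linear[of "\<lambda>y. c * y"] by (simp add: bounded_linear_mult_right linear_conv_bounded_linear)

lemma perceptrons_first: "(\<lambda>x. \<sigma> (w \<bullet> x + b)) \<in> perceptrons \<sigma> 0"
proof -
  have "layer \<sigma> 0 1 (\<lambda>x j. \<sigma> (w \<bullet> x + b))" by (auto intro: exI[of _ "\<lambda>_. w"])
  then show ?thesis by (rule perceptronsI[where v = "\<lambda>_. 1" and c = 0]) simp
qed

text \<open>The output layer is affine, so it merges with the affine map that enters a neuron of the
  next layer.\<close>

lemma perceptrons_next:
  fixes f :: "'a::euclidean_space \<Rightarrow> real"
  assumes "f \<in> perceptrons \<sigma> L"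
  shows "(\<lambda>x. \<sigma> (b + f x)) \<in> perceptrons \<sigma> (Suc L)"
proof -
  obtain N h v c where 1: "layer \<sigma> L N h" "f = (\<lambda>x. (\<Sum>j<N. h x j *\<^sub>R v j) + c)"
    using assms unfolding perceptrons_def by blast
  have "layer \<sigma> (Suc L) 1 (\<lambda>x j. \<sigma> ((\<Sum>k<N. v k * h x k) + (b + c)))"
    unfolding layer.simps using 1(1)
    by (intro conjI exI[of _ N] exI[of _ h] exI[of _ "\<lambda>_ k. v k"] exI[of _ "\<lambda>_. b + c"]) auto
  then show ?thesis
    by (rule perceptronsI[where v = "\<lambda>_. 1" and c = 0]) (simp add: 1 mult.commute add_ac)
qed

section \<open>Smoothness of perceptrons and operations on their closure\<close>

lemma layer_C_on:
  assumes "C_on m UNIV \<sigma>" "layer \<sigma> L N h"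
  shows "C_on m UNIV (\<lambda>x. h x j)"
  using assms(2)
proof (induction L arbitrary: N h j)
  case 0
  then obtain w b where "h = (\<lambda>x j. \<sigma> (w j \<bullet> x + b j))" by auto
  moreover have "C_on m UNIV (\<lambda>x. w j \<bullet> x + b j)"
    by (intro C_on_add C_on_const C_on_bounded_linear[OF bounded_linear_inner_right] C_on_ident)
  ultimately show ?case using C_on_compose[OF assms(1)] by simp
next
  case (Suc L)
  then obtain M g W b where g: "layer \<sigma> L M g" "h = (\<lambda>x j. \<sigma> ((\<Sum>k<M. W j k * g x k) + b j))" by auto
  have "C_on m UNIV (\<lambda>x. (\<Sum>k<M. W j k * g x k) + b j)"
    by (intro C_on_add C_on_sum C_on_mult C_on_const Suc.IH[OF g(1)])
  then show ?case using C_on_compose[OF assms(1)] g(2) by simp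
qed

lemma perceptrons_C_on:
  assumes "C_on m UNIV \<sigma>" "f \<in> perceptrons \<sigma> L"
  shows "C_on m UNIV f"
proof -
  obtain N h v c where 1: "layer \<sigma> L N h" "f = (\<lambda>x. (\<Sum>j<N. h x j *\<^sub>R v j) + c)"
    using assms unfolding perceptrons_def by blast
  show ?thesis unfolding 1(2)
    by (intro C_on_add C_on_sum C_on_scaleR C_on_const layer_C_on[OF assms(1) 1(1)])
qed

lemma C_closure_perceptrons_add:
  assumes "C_on m UNIV \<sigma>" "k \<le> m"
    and "f \<in> C_closure k (perceptrons \<sigma> L)" "g \<in> C_closure k (perceptrons \<sigma> L)"
  shows "(\<lambda>x. f x + g x) \<in> C_closure k (perceptrons \<sigma> L)"
proof -
  have C: "C_on k UNIV p" if "p \<in> perceptrons \<sigma> L" for p :: "'a \<Rightarrow> 'b"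
    using perceptrons_C_on[OF C_on_mono[OF assms(1,2)] that] .
  obtain F where F: "\<And>n. F n \<in> perceptrons \<sigma> L" "Cconv k sequentially F f"
    using C_closure_sequence[OF assms(3) C] by blast
  obtain H where H: "\<And>n. H n \<in> perceptrons \<sigma> L" "Cconv k sequentially H g"
    using C_closure_sequence[OF assms(4) C] by blast
  show ?thesis
  proof (rule Cconv_imp_C_closure[OF Cconv_add[OF F(2) H(2)]])
    have "(\<lambda>x. F n x + H n x) \<in> C_closure k (perceptrons \<sigma> L)" for n
      by (intro C_closure_subset C perceptrons_add F H)
    then show "\<forall>\<^sub>F n in sequentially. (\<lambda>x. F n x + H n x) \<in> C_closure k (perceptrons \<sigma> L)" by simp
  qed simp
qed

lemma C_closure_perceptrons_linear:
  fixes f :: "'a::euclidean_space \<Rightarrow> 'b::real_normed_vector"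
  assumes "C_on m UNIV \<sigma>" "k \<le> m" "bounded_linear T"
    and "f \<in> C_closure k (perceptrons \<sigma> L)"
  shows "(\<lambda>x. T (f x)) \<in> C_closure k (perceptrons \<sigma> L)"
proof -
  have C: "C_on k UNIV p" if "p \<in> perceptrons \<sigma> L" for p :: "'a \<Rightarrow> 'b"
    using perceptrons_C_on[OF C_on_mono[OF assms(1,2)] that] .
  obtain F where F: "\<And>n. F n \<in> perceptrons \<sigma> L" "Cconv k sequentially F f"
    using C_closure_sequence[OF assms(4) C] by blast
  show ?thesis
  proof (rule Cconv_imp_C_closure[OF Cconv_bounded_linear[OF assms(3) F(2)]])
    have "(\<lambda>x. T (F n x)) \<in> C_closure k (perceptrons \<sigma> L)" for n
      by (rule C_closure_subset[OF perceptrons_linear[OF bounded_linear.linear[OF assms(3)] F(1)]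
            C_on_bounded_linear[OF assms(3) C[OF F(1)]]])
    then show "\<forall>\<^sub>F n in sequentially. (\<lambda>x. T (F n x)) \<in> C_closure k (perceptrons \<sigma> L)" by simp
  qed simp
qed

text \<open>
  Difference quotients of \<open>\<sigma>\<close> along \<open>g\<close> converge to \<open>g\<close>, and second differences to \<open>g\<^sup>2\<close>; so one
  more hidden layer suffices to carry \<open>g\<close> along or to square it.
\<close>

lemma closure_ident_square:
  fixes g :: "'a::euclidean_space \<Rightarrow> real"
  assumes \<sigma>: "\<sigma> \<in> activations (Suc (Suc k))" and g: "C_on (Suc (Suc k)) UNIV g"
    and S: "\<And>a b. (\<lambda>x. \<sigma> (b + a * g x)) \<in> perceptrons \<sigma> L"
  shows "g \<in> C_closure (Suc (Suc k)) (perceptrons \<sigma> L)"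
    and "(\<lambda>x. (g x)\<^sup>2) \<in> C_closure (Suc (Suc k)) (perceptrons \<sigma> L)"
proof -
  let ?m = "Suc (Suc k)"
  have C: "C_on ?m UNIV \<sigma>" using \<sigma> by (simp add: activations_def)
  have gc: "Cconv ?m (at (0::real)) (\<lambda>_. g) g" using g by (simp only: Cconv_const_iff[OF at_neq_bot])
  have in_closure: "p \<in> C_closure ?m (perceptrons \<sigma> L)" if "p \<in> perceptrons \<sigma> L" for p :: "'a \<Rightarrow> real"
    using that perceptrons_C_on[OF C that] by (rule C_closure_subset)
  obtain b where b: "fderiv \<sigma> b \<noteq> 0" using activation_fderiv_nonzero[OF \<sigma>] .
  let ?F = "\<lambda>h x. (\<sigma> (b + h * g x) - \<sigma> b) / (h * fderiv \<sigma> b)"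
  have "?F h \<in> perceptrons \<sigma> L" for h
  proof -
    have "(\<lambda>x. inverse (h * fderiv \<sigma> b) * (\<sigma> (b + h * g x) + (- \<sigma> b))) \<in> perceptrons \<sigma> L"
      by (intro perceptrons_scale perceptrons_add S perceptrons_const)
    then show ?thesis by (simp add: divide_inverse mult.commute)
  qed
  then have "\<forall>\<^sub>F h in at 0. ?F h \<in> C_closure ?m (perceptrons \<sigma> L)"
    by (intro always_eventually allI in_closure)
  then show "g \<in> C_closure ?m (perceptrons \<sigma> L)"
    by (rule Cconv_imp_C_closure[OF Cconv_compose[OF difference_quotient_Cconv[OF C b] gc] at_neq_bot])
  obtain b where b: "fderiv (fderiv \<sigma>) b \<noteq> 0" using activation_fderiv2_nonzero[OF \<sigma>] .
  let ?F = "\<lambda>h x. (\<sigma> (b + h * g x) + \<sigma> (b + h * (- g x)) - 2 * \<sigma> b) / (h\<^sup>2 * fderiv (fderiv \<sigma>) b)"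
  have "?F h \<in> perceptrons \<sigma> L" for h
  proof -
    have "(\<lambda>x. inverse (h\<^sup>2 * fderiv (fderiv \<sigma>) b) *
        ((\<sigma> (b + h * g x) + \<sigma> (b + (- h) * g x)) + (- 2 * \<sigma> b))) \<in> perceptrons \<sigma> L"
      by (intro perceptrons_scale perceptrons_add S perceptrons_const)
    then show ?thesis by (simp add: divide_inverse mult.commute)
  qed
  then have "\<forall>\<^sub>F h in at 0. ?F h \<in> C_closure ?m (perceptrons \<sigma> L)"
    by (intro always_eventually allI in_closure)
  then show "(\<lambda>x. (g x)\<^sup>2) \<in> C_closure ?m (perceptrons \<sigma> L)"
    by (rule Cconv_imp_C_closure[OF Cconv_compose[OF second_difference_Cconv[OF C b] gc] at_neq_bot])
qed

text \<open>For a perceptron this is \<open>closure_ident_square\<close> with the new layer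
  evaluating \<sigma> on its output; for a limit, the squares converge together with the
  functions.\<close>

lemma perceptrons_closure_step:
  fixes f :: "'a::euclidean_space \<Rightarrow> real"
  assumes \<sigma>: "\<sigma> \<in> activations (Suc (Suc k))"
    and f: "f \<in> C_closure (Suc (Suc k)) (perceptrons \<sigma> L)"
  shows "f \<in> C_closure (Suc (Suc k)) (perceptrons \<sigma> (Suc L))"
    and "(\<lambda>x. (f x)\<^sup>2) \<in> C_closure (Suc (Suc k)) (perceptrons \<sigma> (Suc L))"
proof -
  let ?m = "Suc (Suc k)"
  have C: "C_on ?m UNIV \<sigma>" using \<sigma> by (simp add: activations_def)
  have next_layer: "(\<lambda>x. \<sigma> (b + a * g x)) \<in> perceptrons \<sigma> (Suc L)"
    if "g \<in> perceptrons \<sigma> L" for g :: "'a \<Rightarrow> real" and a b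
    by (rule perceptrons_next[OF perceptrons_scale[OF that]])
  have step: "g \<in> C_closure ?m (perceptrons \<sigma> (Suc L))"
    "(\<lambda>x. (g x)\<^sup>2) \<in> C_closure ?m (perceptrons \<sigma> (Suc L))"
    if "g \<in> perceptrons \<sigma> L" for g :: "'a \<Rightarrow> real"
    by (rule closure_ident_square[OF \<sigma> perceptrons_C_on[OF C that] next_layer[OF that]])+
  show "f \<in> C_closure ?m (perceptrons \<sigma> (Suc L))"
    by (rule C_closure_closure[OF f]) (use step(1) in blast)
  have C': "C_on ?m UNIV p" if "p \<in> perceptrons \<sigma> L" for p :: "'a \<Rightarrow> real"
    by (rule perceptrons_C_on[OF C that])
  obtain F where F: "\<And>n. F n \<in> perceptrons \<sigma> L" "Cconv ?m sequentially F f"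
    using C_closure_sequence[OF f C'] by blast
  have "Cconv ?m sequentially (\<lambda>n x. F n x *\<^sub>R F n x) (\<lambda>x. f x *\<^sub>R f x)"
    by (rule Cconv_scaleR[OF F(2) F(2)])
  then have "Cconv ?m sequentially (\<lambda>n x. (F n x)\<^sup>2) (\<lambda>x. (f x)\<^sup>2)"
    by (simp only: real_scaleR_def power2_eq_square)
  moreover have "\<forall>\<^sub>F n in sequentially. (\<lambda>x. (F n x)\<^sup>2) \<in> C_closure ?m (perceptrons \<sigma> (Suc L))"
    by (intro always_eventually allI step(2) F(1))
  ultimately show "(\<lambda>x. (f x)\<^sup>2) \<in> C_closure ?m (perceptrons \<sigma> (Suc L))"
    by (rule Cconv_imp_C_closure[OF _ sequentially_bot])
qed

text \<open>Carrying a function along layer by layer brings functions of different depths to a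
  common one, so that they can be added.\<close>

lemma perceptrons_closure_le:
  fixes f :: "'a::euclidean_space \<Rightarrow> real"
  assumes "\<sigma> \<in> activations (Suc (Suc k))" "L \<le> L'"
    and "f \<in> C_closure (Suc (Suc k)) (perceptrons \<sigma> L)"
  shows "f \<in> C_closure (Suc (Suc k)) (perceptrons \<sigma> L')"
  using assms(2)
  by (induction rule: dec_induct) (rule assms(3), rule perceptrons_closure_step(1)[OF assms(1)])

text \<open>Products come from polarization,
  \<open>f g = ((f + g)\<^sup>2 - f\<^sup>2 - g\<^sup>2) / 2\<close>, and cost one layer more than a
  common depth of the factors; the depth therefore depends on \<open>p\<close>.\<close>

lemma real_polynomial_in_closure:
  fixes p :: "'a::euclidean_space \<Rightarrow> real"
  assumes \<sigma>: "\<sigma> \<in> activations (Suc (Suc k))" and p: "real_polynomial_function p"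
  shows "\<exists>L. p \<in> C_closure (Suc (Suc k)) (perceptrons \<sigma> L)"
proof -
  let ?m = "Suc (Suc k)"
  have C: "C_on ?m UNIV \<sigma>" using \<sigma> by (simp add: activations_def)
  have common: "\<exists>L. f \<in> C_closure ?m (perceptrons \<sigma> L) \<and> g \<in> C_closure ?m (perceptrons \<sigma> L)"
    if "\<exists>L. f \<in> C_closure ?m (perceptrons \<sigma> L)" "\<exists>L. g \<in> C_closure ?m (perceptrons \<sigma> L)"
    for f g :: "'a \<Rightarrow> real"
  proof -
    obtain L1 L2 where "f \<in> C_closure ?m (perceptrons \<sigma> L1)" "g \<in> C_closure ?m (perceptrons \<sigma> L2)"
      using \<open>\<exists>L. f \<in> _\<close> \<open>\<exists>L. g \<in> _\<close> by blast
    then have "f \<in> C_closure ?m (perceptrons \<sigma> (max L1 L2))" "g \<in> C_closure ?m (perceptrons \<sigma> (max L1 L2))"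
      using perceptrons_closure_le[OF \<sigma> max.cobounded1] perceptrons_closure_le[OF \<sigma> max.cobounded2] by blast+
    then show ?thesis by blast
  qed
  note lin = C_closure_perceptrons_linear[OF C order_refl bounded_linear_mult_right]
  from p show ?thesis
  proof induction
    case (linear f)
    define w where "w = (\<Sum>b\<in>Basis. f b *\<^sub>R b)"
    have f: "f x = w \<bullet> x" for x
      unfolding w_def using linear_basis_expand[OF bounded_linear.linear[OF linear], of x]
      by (simp add: inner_sum_left inner_sum_right inner_commute mult.commute)
    have "f \<in> C_closure ?m (perceptrons \<sigma> 0)"
    proof (rule closure_ident_square(1)[OF \<sigma>])
      show "C_on ?m UNIV f" by (rule C_on_linear[OF bounded_linear.linear[OF linear]])
      show "(\<lambda>x. \<sigma> (b + a * f x)) \<in> perceptrons \<sigma> 0" for a b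
        using perceptrons_first[of \<sigma> "a *\<^sub>R w" b] by (simp add: f add.commute)
    qed
    then show ?case by blast
  next
    case (const c)
    then show ?case using C_closure_subset[OF perceptrons_const C_on_const] by blast
  next
    case (add f g)
    show ?case using common[OF add.IH] C_closure_perceptrons_add[OF C order_refl] by blast
  next
    case (mult f g)
    obtain L where L: "f \<in> C_closure ?m (perceptrons \<sigma> L)" "g \<in> C_closure ?m (perceptrons \<sigma> L)"
      using common[OF mult.IH] by blast
    have "(\<lambda>x. (1/2) * (((f x + g x)\<^sup>2 + (-1) * (f x)\<^sup>2) + (-1) * (g x)\<^sup>2)) \<in> C_closure ?m (perceptrons \<sigma> (Suc L))"
      by (intro lin C_closure_perceptrons_add[OF C order_refl] perceptrons_closure_step(2)[OF \<sigma>] L)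
    moreover have "(1/2) * (((f x + g x)\<^sup>2 + (-1) * (f x)\<^sup>2) + (-1) * (g x)\<^sup>2) = f x * g x" for x
      by (simp add: power2_eq_square algebra_simps)
    ultimately show ?case by auto
  qed
qed

text \<open>The order \<open>k\<close> of approximation is separate from the class \<open>s\<close>
  of the networks: the force is approximated with \<open>k = r\<close> and \<open>s = r + 1\<close>,
  the function \<open>T\<close> with one more in both.\<close>

theorem networks_dense:
  fixes f :: "'a::euclidean_space \<Rightarrow> 'b::euclidean_space"
  assumes \<sigma>: "\<sigma> \<in> activations (Suc (Suc m))" and k: "k \<le> Suc (Suc m)" and s: "\<sigma> \<in> activations s"
    and f: "C_on k UNIV f"
  shows "f \<in> C_closure k (networks s \<sigma>)"
proof -
  let ?m = "Suc (Suc m)"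
  have C: "C_on ?m UNIV \<sigma>" using \<sigma> by (simp add: activations_def)
  have "\<exists>F. (\<forall>n::nat. real_polynomial_function (F n)) \<and> Cconv k sequentially F (\<lambda>x. f x \<bullet> b)" for b
  proof -
    have "C_on k UNIV (\<lambda>x. f x \<bullet> b)" by (rule C_on_bounded_linear[OF bounded_linear_inner_left f])
    from C_closure_sequence[OF C_closure_real_polynomial[OF this] C_on_real_polynomial]
    show ?thesis by (metis mem_Collect_eq)
  qed
  then obtain F where F: "\<And>b n. real_polynomial_function (F b n)"
    "\<And>b. Cconv k sequentially (F b) (\<lambda>x. f x \<bullet> b)" by metis
  have "Cconv k sequentially (\<lambda>n x. \<Sum>b\<in>Basis. F b n x *\<^sub>R b) (\<lambda>x. \<Sum>b\<in>Basis. (f x \<bullet> b) *\<^sub>R b)"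
    by (intro Cconv_sum Cconv_scaleR Cconv_const F(2))
  then have lim: "Cconv k sequentially (\<lambda>n x. \<Sum>b\<in>Basis. F b n x *\<^sub>R b) f"
    by (simp only: euclidean_representation)
  have "(\<lambda>x. \<Sum>b\<in>Basis. F b n x *\<^sub>R b) \<in> C_closure k (networks s \<sigma>)" for n
  proof -
    obtain L where L: "\<And>b. F b n \<in> C_closure ?m (perceptrons \<sigma> (L b))"
      using choice[of "\<lambda>b L. F b n \<in> C_closure ?m (perceptrons \<sigma> L)"]
        real_polynomial_in_closure[OF \<sigma> F(1)] by blast
    \<comment> \<open>The coordinates may need different depths, but there are finitely many, and
      all can be carried to the largest.\<close>
    define L' where "L' = Max (L ` (Basis :: 'b set))"
    have b: "(\<lambda>x. F b n x *\<^sub>R b) \<in> C_closure k (perceptrons \<sigma> L')" if "b \<in> Basis" for b :: 'b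
    proof (rule C_closure_perceptrons_linear[OF C k bounded_linear_scaleR_left])
      have "L b \<le> L'" unfolding L'_def using that by simp
      then show "F b n \<in> C_closure k (perceptrons \<sigma> L')"
        by (intro C_closure_le[OF perceptrons_closure_le[OF \<sigma> _ L]] k)
    qed
    have "(\<lambda>x. \<Sum>b\<in>B. F b n x *\<^sub>R b) \<in> C_closure k (perceptrons \<sigma> L')" if "finite B" "B \<subseteq> Basis" for B :: "'b set"
      using that
    proof (induction rule: finite_induct)
      case empty
      then show ?case using C_closure_subset[OF perceptrons_const C_on_const] by simp
    next
      case (insert b B)
      then show ?case using C_closure_perceptrons_add[OF C k b] by simp
    qed
    then have "(\<lambda>x. \<Sum>b\<in>Basis. F b n x *\<^sub>R b) \<in> C_closure k (perceptrons \<sigma> L')" by simp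
    then show ?thesis by (rule C_closure_mono[OF _ perceptrons_subset_networks[OF s]])
  qed
  then have "\<forall>\<^sub>F n in sequentially. (\<lambda>x. \<Sum>b\<in>Basis. F b n x *\<^sub>R b) \<in> C_closure k (networks s \<sigma>)" by simp
  with lim show ?thesis by (rule Cconv_imp_C_closure[OF _ sequentially_bot])
qed

section \<open>Compositions of Lagrange-d'Alembert-Euler maps\<close>

lemma hidden_layers_layer: "hidden_layers \<sigma> N h \<Longrightarrow> \<exists>L. layer \<sigma> L N h"
proof (induction rule: hidden_layers.induct)
  case (first N w b)
  then have "layer \<sigma> 0 N (\<lambda>x j. \<sigma> (w j \<bullet> x + b j))" by auto
  then show ?case by blast
next
  case (next_layer M h N W b)
  then obtain L where "layer \<sigma> L M h" by blast
  then have "layer \<sigma> (Suc L) N (\<lambda>x j. \<sigma> ((\<Sum>k<M. W j k * h x k) + b j))"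
    using next_layer(2) unfolding layer.simps by blast
  then show ?case by blast
qed

lemma networks_C_on:
  assumes "g \<in> networks s \<sigma>"
  shows "C_on s UNIV g"
proof -
  obtain N h v c where h: "hidden_layers \<sigma> N h" "g = (\<lambda>x. (\<Sum>j<N. h x j *\<^sub>R v j) + c)"
    and \<sigma>: "C_on s UNIV \<sigma>"
    using assms unfolding networks_def activations_def by blast
  obtain L where "layer \<sigma> L N h" using hidden_layers_layer[OF h(1)] by blast
  then have "g \<in> perceptrons \<sigma> L" using h(2) by (rule perceptronsI)
  then show ?thesis by (rule perceptrons_C_on[OF \<sigma>])
qed

lemma zero_network: "\<sigma> \<in> activations s \<Longrightarrow> (\<lambda>_. 0) \<in> networks s \<sigma>"
  using perceptrons_subset_networks[of \<sigma> s 0] perceptrons_const by blast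

lemma activations_mono:
  assumes "\<sigma> \<in> activations m" "k \<le> m"
  shows "\<sigma> \<in> activations k"
  using assms(1) C_on_mono[OF _ assms(2), of \<sigma>] by (simp add: activations_def)

section \<open>Gradients and the smoothness of LDE maps\<close>

lemma gradient_eq:
  fixes f :: "'a::euclidean_space \<Rightarrow> real"
  assumes "(f has_derivative D) (at x)"
  shows "gradient f x = (\<Sum>b\<in>Basis. D b *\<^sub>R b)"
proof -
  have "D h = h \<bullet> (\<Sum>b\<in>Basis. D b *\<^sub>R b)" for h
    by (subst linear_basis_expand[OF has_derivative_linear[OF assms]])
      (simp add: inner_sum_right mult.commute)
  then have *: "D = (\<lambda>h. h \<bullet> (\<Sum>b\<in>Basis. D b *\<^sub>R b))" by blast
  show ?thesis
    unfolding gradient_def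
  proof (rule the_equality)
    show "GDERIV f x :> (\<Sum>b\<in>Basis. D b *\<^sub>R b)"
      unfolding gderiv_def using assms * by metis
    fix E assume "GDERIV f x :> E"
    then have "D = (\<lambda>h. h \<bullet> E)"
      unfolding gderiv_def using assms has_derivative_unique by blast
    then have "h \<bullet> E = h \<bullet> (\<Sum>b\<in>Basis. D b *\<^sub>R b)" for h using * by metis
    then show "E = (\<Sum>b\<in>Basis. D b *\<^sub>R b)" using vector_eq_ldot by blast
  qed
qed

lemma gradient_const: "gradient (\<lambda>_. c) x = (0 :: 'a::euclidean_space)"
  by (subst gradient_eq[OF has_derivative_const]) simp

text \<open>The loss of one order here is the reason for approximating \<open>T\<close> in order
  \<open>Suc r\<close> when the maps are to converge in order \<open>r\<close>.\<close>

lemma Cconv_gradient: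
  fixes f :: "'a::euclidean_space \<Rightarrow> real"
  assumes "Cconv (Suc k) G F f"
  shows "Cconv k G (\<lambda>i. gradient (F i)) (gradient f)"
proof -
  have f: "gradient f = (\<lambda>x. \<Sum>b\<in>Basis. frechet_derivative f (at x) b *\<^sub>R b)"
    using gradient_eq[OF Cconv_lim_deriv[OF assms]] by blast
  have F: "\<forall>\<^sub>F i in G. \<forall>x. gradient (F i) x = (\<Sum>b\<in>Basis. frechet_derivative (F i) (at x) b *\<^sub>R b)"
    using Cconv_ev_deriv[OF assms] by eventually_elim (blast intro: gradient_eq)
  have "Cconv k G (\<lambda>i x. \<Sum>b\<in>Basis. frechet_derivative (F i) (at x) b *\<^sub>R b)
      (\<lambda>x. \<Sum>b\<in>Basis. frechet_derivative f (at x) b *\<^sub>R b)"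
    by (rule Cconv_sum, rule Cconv_scaleR[OF Cconv_deriv[OF assms] Cconv_const])
  then show ?thesis
    unfolding f by (subst Cconv_cong[OF F])
qed

lemma C_on_gradient: "C_on (Suc k) UNIV f \<Longrightarrow> C_on k UNIV (gradient f)"
  unfolding C_on_Cconv by (rule Cconv_gradient)

lemma LDE_eq:
  "LDE T U f = (\<lambda>z. (fst z + gradient T (snd z),
     (snd z - gradient U (fst z + gradient T (snd z))) + f (fst z + gradient T (snd z), snd z)))"
  by (auto simp: LDE_def fun_eq_iff Let_def)

lemma LDE_C_on:
  assumes "C_on (Suc k) UNIV T" "C_on (Suc k) UNIV U" "C_on k UNIV f"
  shows "C_on k UNIV (LDE T U f)"
proof -
  have q: "C_on k UNIV (\<lambda>z. fst z + gradient T (snd z))"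
    by (rule C_on_add[OF C_on_fst[OF C_on_ident]
          C_on_compose[OF C_on_gradient[OF assms(1)] C_on_snd[OF C_on_ident]]])
  show ?thesis
    unfolding LDE_eq
    by (rule C_on_Pair[OF q C_on_add[OF C_on_diff[OF C_on_snd[OF C_on_ident]
              C_on_compose[OF C_on_gradient[OF assms(2)] q]]
            C_on_compose[OF assms(3) C_on_Pair[OF q C_on_snd[OF C_on_ident]]]]])
qed

text \<open>Only nonempty compositions, as the final sequence has at least one member. The added map
  is the outermost, in agreement with the order in which \<open>fold\<close> works through its
  list.\<close>

inductive_set LDE_comps :: "nat \<Rightarrow> (real \<Rightarrow> real) \<Rightarrow> ('n::finite phase \<Rightarrow> 'n phase) set" for s \<sigma> where
  single: "\<Psi> \<in> LDE_networks s \<sigma> \<Longrightarrow> \<Psi> \<in> LDE_comps s \<sigma>"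
| comp: "\<Psi> \<in> LDE_networks s \<sigma> \<Longrightarrow> \<Phi> \<in> LDE_comps s \<sigma> \<Longrightarrow> (\<lambda>z. \<Psi> (\<Phi> z)) \<in> LDE_comps s \<sigma>"

lemma LDE_networks_C_on: "\<Psi> \<in> LDE_networks s \<sigma> \<Longrightarrow> C_on s UNIV \<Psi>"
  unfolding LDE_networks_def by (auto intro!: LDE_C_on dest!: networks_C_on)

lemma LDE_comps_C_on: "\<Phi> \<in> LDE_comps s \<sigma> \<Longrightarrow> C_on s UNIV \<Phi>"
proof (induction rule: LDE_comps.induct)
  case (single \<Psi>)
  then show ?case by (rule LDE_networks_C_on)
next
  case (comp \<Psi> \<Phi>)
  show ?case by (rule C_on_compose[OF LDE_networks_C_on[OF comp(1)] comp(3)])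
qed

lemma LDE_comps_compose:
  assumes "\<Phi> \<in> LDE_comps s \<sigma>" "\<Phi>' \<in> LDE_comps s \<sigma>"
  shows "(\<lambda>z. \<Phi> (\<Phi>' z)) \<in> LDE_comps s \<sigma>"
  using assms(1)
proof (induction rule: LDE_comps.induct)
  case (single \<Psi>)
  then show ?case using assms(2) by (rule LDE_comps.comp)
next
  case (comp \<Psi> \<Phi>)
  show ?case by (rule LDE_comps.comp[OF comp(1,3)])
qed

text \<open>\<open>CC\<close> has the order \<open>r\<close> of the final norm. Once it is known to
  be closed under composition, approximating a map becomes factorizing it.\<close>

locale LDE_approximation =
  fixes r :: nat and \<sigma> :: "real \<Rightarrow> real" and CC :: "('n::finite phase \<Rightarrow> 'n phase) set"
  assumes \<sigma>: "\<sigma> \<in> activations (Suc (Suc r))"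
  defines CC: "CC \<equiv> C_closure r (LDE_comps (Suc r) \<sigma>)"
begin

lemma comps_C_on: "\<Phi> \<in> LDE_comps (Suc r) \<sigma> \<Longrightarrow> C_on r UNIV \<Phi>"
  by (rule C_on_mono[OF LDE_comps_C_on le_SucI[OF order_refl]])

lemma \<sigma>_Suc: "\<sigma> \<in> activations (Suc r)"
  by (rule activations_mono[OF \<sigma>]) simp

lemma CC_compose:
  assumes "f \<in> CC" "g \<in> CC"
  shows "(\<lambda>z. f (g z)) \<in> CC"
  unfolding CC
  by (rule C_closure_compose[OF assms[unfolded CC]]) (auto intro: comps_C_on LDE_comps_compose)

lemma CC_limit:
  assumes "Cconv r sequentially F f" "\<And>n. F n \<in> LDE_networks (Suc r) \<sigma>"
  shows "f \<in> CC"
  unfolding CC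
proof (rule Cconv_imp_C_closure[OF assms(1) sequentially_bot])
  have "F n \<in> C_closure r (LDE_comps (Suc r) \<sigma>)" for n
    by (rule C_closure_subset[OF LDE_comps.single[OF assms(2)] comps_C_on[OF LDE_comps.single[OF assms(2)]]])
  then show "\<forall>\<^sub>F n in sequentially. F n \<in> C_closure r (LDE_comps (Suc r) \<sigma>)" by simp
qed

text \<open>With \<open>T = U = 0\<close> the position stays and the momentum grows by
  \<open>f\<close>, so \<open>f\<close> has to approximate \<open>G z - snd z\<close>. The limit
  need not be a diffeomorphism.\<close>

lemma momentum_update:
  fixes G :: "'n phase \<Rightarrow> real ^ 'n"
  assumes "C_on r UNIV G"
  shows "(\<lambda>z. (fst z, G z)) \<in> CC"
proof -
  have "C_on r UNIV (\<lambda>z. G z - snd z)" by (rule C_on_diff[OF assms C_on_snd[OF C_on_ident]])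
  then have "(\<lambda>z. G z - snd z) \<in> C_closure r (networks (Suc r) \<sigma>)"
    by (rule networks_dense[OF \<sigma> _ \<sigma>_Suc, rotated]) simp
  moreover have "C_on r UNIV g" if "g \<in> networks (Suc r) \<sigma>" for g :: "'n phase \<Rightarrow> real ^ 'n"
    by (rule C_on_mono[OF networks_C_on[OF that]]) simp
  ultimately obtain F where F: "\<And>n. F n \<in> networks (Suc r) \<sigma>" "Cconv r sequentially F (\<lambda>z. G z - snd z)"
    using C_closure_sequence by blast
  let ?L = "\<lambda>n. LDE (\<lambda>_. 0) (\<lambda>_. 0) (F n)"
  have L: "?L n = (\<lambda>z. (fst z, snd z + F n z))" for n by (simp add: LDE_eq gradient_const)
  have id: "Cconv r sequentially (\<lambda>_ z. z) (\<lambda>z :: 'n phase. z)" by (rule Cconv_ident) simp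
  have "Cconv r sequentially ?L (\<lambda>z. (fst z, snd z + (G z - snd z)))"
    unfolding L
    by (rule Cconv_Pair[OF Cconv_bounded_linear[OF bounded_linear_fst id]
          Cconv_add[OF Cconv_bounded_linear[OF bounded_linear_snd id] F(2)]])
  then have "(\<lambda>z. (fst z, snd z + (G z - snd z))) \<in> CC"
  proof (rule CC_limit)
    show "?L n \<in> LDE_networks (Suc r) \<sigma>" for n
      unfolding LDE_networks_def using zero_network[OF \<sigma>] F(1) by auto
  qed
  then show ?thesis by simp
qed

text \<open>Only \<open>T\<close> can move the position. One quadratic choice suffices, since all
  further position updates are obtained from it by conjugation.\<close>

lemma shear: "(\<lambda>z. (fst z + snd z, snd z)) \<in> CC"
proof -
  let ?T = "\<lambda>p :: real ^ 'n. (p \<bullet> p) * (1/2)"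
  have "C_on (Suc r) UNIV (\<lambda>p :: real ^ 'n. \<Sum>b\<in>Basis. (p \<bullet> b) * (p \<bullet> b))"
    by (rule C_on_sum, rule C_on_mult; rule C_on_bounded_linear[OF bounded_linear_inner_left C_on_ident])
  then have "C_on (Suc r) UNIV (\<lambda>p :: real ^ 'n. p \<bullet> p)" by (subst euclidean_inner)
  then have T: "C_on (Suc r) UNIV ?T" by (rule C_on_mult[OF _ C_on_const])
  have gT: "gradient ?T p = p" for p
  proof -
    have "(?T has_derivative (\<lambda>h. h \<bullet> p)) (at p)"
      by (auto intro!: derivative_eq_intros simp: inner_commute)
    from gradient_eq[OF this] show ?thesis
      by (simp add: euclidean_representation inner_commute[of _ p])
  qed
  have "?T \<in> C_closure (Suc r) (networks (Suc (Suc r)) \<sigma>)"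
    by (rule networks_dense[OF \<sigma> _ \<sigma> T]) simp
  moreover have "C_on (Suc r) UNIV g" if "g \<in> networks (Suc (Suc r)) \<sigma>" for g :: "real ^ 'n \<Rightarrow> real"
    by (rule C_on_mono[OF networks_C_on[OF that]]) simp
  ultimately obtain F where F: "\<And>n. F n \<in> networks (Suc (Suc r)) \<sigma>" "Cconv (Suc r) sequentially F ?T"
    using C_closure_sequence by blast
  let ?L = "\<lambda>n. LDE (F n) (\<lambda>_. 0) (\<lambda>_. 0)"
  have L: "?L n = (\<lambda>z. (fst z + gradient (F n) (snd z), snd z))" for n
    by (simp add: LDE_eq gradient_const)
  have id: "Cconv r sequentially (\<lambda>_ z. z) (\<lambda>z :: 'n phase. z)" by (rule Cconv_ident) simp
  have snd: "Cconv r sequentially (\<lambda>_ z. snd z) (\<lambda>z :: 'n phase. snd z)"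
    by (rule Cconv_bounded_linear[OF bounded_linear_snd id])
  have "Cconv r sequentially ?L (\<lambda>z. (fst z + gradient ?T (snd z), snd z))"
    unfolding L
    by (rule Cconv_Pair[OF Cconv_add[OF Cconv_bounded_linear[OF bounded_linear_fst id]
            Cconv_compose[OF Cconv_gradient[OF F(2)] snd]] snd])
  then have "(\<lambda>z. (fst z + gradient ?T (snd z), snd z)) \<in> CC"
  proof (rule CC_limit)
    show "?L n \<in> LDE_networks (Suc r) \<sigma>" for n
      unfolding LDE_networks_def using zero_network[OF \<sigma>] zero_network[OF \<sigma>_Suc] F(1) by auto
  qed
  then show ?thesis by (simp only: gT)
qed

text \<open>The point \<open>(q, p)\<close> runs through \<open>(q + p, p)\<close>,
  \<open>(q + p, - q)\<close> and \<open>(p, - q)\<close>: shear, momentum update, shear.\<close>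

lemma quarter_turn: "(\<lambda>z. (snd z, - fst z)) \<in> CC"
proof -
  have "C_on r UNIV (\<lambda>z :: 'n phase. snd z - fst z)"
    by (rule C_on_diff[OF C_on_snd[OF C_on_ident] C_on_fst[OF C_on_ident]])
  from CC_compose[OF shear CC_compose[OF momentum_update[OF this] shear]]
  show ?thesis by simp
qed

text \<open>A momentum update between two quarter turns: \<open>(q, p)\<close> becomes
  \<open>(p, - q)\<close>, then \<open>(p, G (q, p))\<close>, then \<open>(G (q, p), - p)\<close>.
  The sign is repaired by negating the momentum, which is a momentum update.\<close>

lemma position_update:
  fixes G :: "'n phase \<Rightarrow> real ^ 'n"
  assumes "C_on r UNIV G"
  shows "(\<lambda>z. (G z, snd z)) \<in> CC"
proof -
  have "linear (\<lambda>w :: 'n phase. (- snd w, fst w))" by (rule linearI) auto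
  from C_on_compose[OF assms C_on_linear[OF this]]
  have 1: "(\<lambda>z. (fst z, G (- snd z, fst z))) \<in> CC" by (rule momentum_update)
  have "linear (\<lambda>w :: 'n phase. - snd w)" by (rule linearI) auto
  from momentum_update[OF C_on_linear[OF this]]
  have 2: "(\<lambda>z. (fst z, - snd z)) \<in> CC" .
  from CC_compose[OF 2 CC_compose[OF quarter_turn CC_compose[OF 1 quarter_turn]]]
  show ?thesis by simp
qed

subsection \<open>Linear maps\<close>

text \<open>The generation of linear maps by elementary ones,
  \<open>induct_linear_elementary\<close>, concerns spaces \<open>real ^ 'm\<close>; phase space is
  identified with \<open>real ^ ('n + 'n)\<close>.\<close>

definition join :: "'n phase \<Rightarrow> real ^ ('n + 'n)" where
  "join z = (\<chi> k. case k of Inl i \<Rightarrow> fst z $ i | Inr i \<Rightarrow> snd z $ i)"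

definition unjoin :: "real ^ ('n + 'n) \<Rightarrow> 'n phase" where
  "unjoin x = (\<chi> i. x $ Inl i, \<chi> i. x $ Inr i)"

lemma unjoin_join: "unjoin (join z) = z"
  by (simp add: unjoin_def join_def prod_eq_iff vec_eq_iff)

lemma join_unjoin: "join (unjoin x) = x"
  by (auto simp: unjoin_def join_def vec_eq_iff split: sum.split)

lemma linear_join: "linear join"
  by (rule linearI) (auto simp: join_def vec_eq_iff split: sum.split)

lemma linear_unjoin: "linear unjoin"
  by (rule linearI) (auto simp: unjoin_def vec_eq_iff)

lemma conj_compose:
  assumes "(\<lambda>z. unjoin (f (join z))) \<in> CC" "(\<lambda>z. unjoin (g (join z))) \<in> CC"
  shows "(\<lambda>z. unjoin ((f \<circ> g) (join z))) \<in> CC"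
  using CC_compose[OF assms] by (simp add: join_unjoin)

text \<open>A single coordinate belongs either to the position or to the momentum, so this is one of
  the two kinds of update. All row operations have this form.\<close>

lemma coordinate_update:
  assumes "linear g"
  shows "(\<lambda>z. unjoin (\<chi> k. if k = m then g (join z) else join z $ k)) \<in> CC"
proof -
  have g: "linear (\<lambda>z. g (join z))" using linear_compose[OF linear_join assms] by (simp add: o_def)
  show ?thesis
  proof (cases m)
    case (Inl i)
    have "linear (\<lambda>z. \<chi> j. if j = i then g (join z) else fst z $ j)"
      using linear_add[OF g] linear_cmul[OF g] by (intro linearI) (auto simp: vec_eq_iff)
    from position_update[OF C_on_linear[OF this]]
    show ?thesis by (simp add: Inl unjoin_def join_def cong: if_cong)
  next
    case (Inr i)
    have "linear (\<lambda>z. \<chi> j. if j = i then g (join z) else snd z $ j)"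
      using linear_add[OF g] linear_cmul[OF g] by (intro linearI) (auto simp: vec_eq_iff)
    from momentum_update[OF C_on_linear[OF this]]
    show ?thesis by (simp add: Inr unjoin_def join_def cong: if_cong)
  qed
qed

lemma linear_in_CC:
  fixes A :: "'n phase \<Rightarrow> 'n phase"
  assumes "linear A" "surj A"
  shows "A \<in> CC"
proof -
  let ?Q = "\<lambda>f. (\<lambda>z. unjoin (f (join z))) \<in> CC"
  have upd: "?Q (\<lambda>x. \<chi> k. if k = m then a * x $ m + b * x $ n else x $ k)" for m n a b
    by (rule coordinate_update) (auto intro!: linearI simp: algebra_simps)
  \<comment> \<open>Elimination also produces maps with a zero row. They are not surjective, which
    is why the induction is over an implication.\<close>
  have "surj f \<longrightarrow> ?Q f" if "linear f" for f :: "real ^ ('n + 'n) \<Rightarrow> real ^ ('n + 'n)"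
    using that
  proof (rule induct_linear_elementary)
    fix f g :: "real ^ ('n + 'n) \<Rightarrow> real ^ ('n + 'n)"
    assume fg: "linear f" "linear g" "surj f \<longrightarrow> ?Q f" "surj g \<longrightarrow> ?Q g"
    show "surj (f \<circ> g) \<longrightarrow> ?Q (f \<circ> g)"
    proof
      assume s: "surj (f \<circ> g)"
      then have sf: "surj f" by (metis comp_surj fun.set_map image_comp surj_def o_apply)
      \<comment> \<open>Finite dimension: surjectivity of the composition gives injectivity, hence
        injectivity and then surjectivity of the inner factor.\<close>
      have "inj (f \<circ> g)" using linear_surj_imp_inj[OF linear_compose[OF fg(2,1)] s] .
      then have "inj g" by (rule inj_on_imageI2)
      then have "surj g" using linear_inj_imp_surj[OF fg(2)] by blast
      then show "?Q (f \<circ> g)" using sf fg(3,4) by (intro conj_compose) auto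
    qed
  next
    fix f :: "real ^ ('n + 'n) \<Rightarrow> real ^ ('n + 'n)" and i
    assume "\<And>x. f x $ i = 0"
    then have "\<not> surj f"
      by (metis axis_nth surjD zero_neq_one)
    then show "surj f \<longrightarrow> ?Q f" by blast
  next
    fix c :: "'n + 'n \<Rightarrow> real"
    have "?Q (\<lambda>x. \<chi> i. if i \<in> F then c i * x $ i else x $ i)" if "finite F" for F
      using that
    proof (induction rule: finite_induct)
      case empty
      \<comment> \<open>The identity as an update with coefficients 1 and 0;
        \<open>undefined\<close> merely names some coordinate.\<close>
      have "?Q (\<lambda>x. \<chi> k. if k = undefined then 1 * x $ undefined + 0 * x $ undefined else x $ k)"
        by (rule upd)
      moreover have "(\<chi> k. if k = undefined then 1 * x $ undefined + 0 * x $ undefined else x $ k)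
          = (\<chi> i. if i \<in> {} then c i * x $ i else x $ i)" for x :: "real ^ ('n + 'n)"
        by (auto simp: vec_eq_iff)
      ultimately show ?case by (simp only:)
    next
      case (insert a F)
      have "(\<lambda>x. \<chi> k. if k = a then c a * x $ a + 0 * x $ a else x $ k) \<circ>
          (\<lambda>x. \<chi> i. if i \<in> F then c i * x $ i else x $ i) =
          (\<lambda>x. \<chi> i. if i \<in> insert a F then c i * x $ i else x $ i)"
        using insert(2) by (auto simp: fun_eq_iff vec_eq_iff)
      then show ?case using conj_compose[OF upd[of a "c a" 0 a] insert(3)] by simp
    qed
    from this[of UNIV] show "surj (\<lambda>x. \<chi> i. c i * x $ i) \<longrightarrow> ?Q (\<lambda>x. \<chi> i. c i * x $ i)" by simp
  next
    fix m n :: "'n + 'n" assume mn: "m \<noteq> n"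
    \<comment> \<open>A transposition from three updates: first add entry \<open>n\<close> to entry
      \<open>m\<close>, then replace entry \<open>n\<close> by its difference from entry
      \<open>m\<close>, then subtract it from entry \<open>m\<close>.\<close>
    have *: "(\<lambda>x. \<chi> k. if k = m then 1 * x $ m + (-1) * x $ n else x $ k) \<circ>
        ((\<lambda>x. \<chi> k. if k = n then (-1) * x $ n + 1 * x $ m else x $ k) \<circ>
         (\<lambda>x. \<chi> k. if k = m then 1 * x $ m + 1 * x $ n else x $ k))
        = (\<lambda>x :: real ^ ('n + 'n). \<chi> i. x $ Transposition.transpose m n i)"
      using mn by (auto simp: fun_eq_iff vec_eq_iff Transposition.transpose_def)
    show "surj (\<lambda>x. \<chi> i. x $ Transposition.transpose m n i) \<longrightarrow> ?Q (\<lambda>x. \<chi> i. x $ Transposition.transpose m n i)"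
      using conj_compose[OF upd[of m 1 "-1" n] conj_compose[OF upd[of n "-1" 1 m] upd[of m 1 1 n]]]
      unfolding * by blast
    show "surj (\<lambda>x. \<chi> i. if i = m then x $ m + x $ n else x $ i) \<longrightarrow>
        ?Q (\<lambda>x. \<chi> i. if i = m then x $ m + x $ n else x $ i)"
      using upd[of m 1 1 n] by (simp cong: if_cong)
  qed
  note gen = this[THEN mp]
  have lin: "linear (\<lambda>x. join (A (unjoin x)))"
    using linear_compose[OF linear_compose[OF linear_unjoin assms(1)] linear_join] by (simp add: o_def)
  have "surj (\<lambda>x. join (A (unjoin x)))"
  proof (rule surjI)
    show "join (A (unjoin (join (inv A (unjoin y))))) = y" for y
      by (simp add: unjoin_join join_unjoin surj_f_inv_f[OF assms(2)])
  qed
  from gen[OF lin this] show ?thesis by (simp add: unjoin_join)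
qed

subsection \<open>Perturbations of the identity\<close>

text \<open>First update the position, then the momentum as a function of the new position.\<close>

lemma near_identity_in_CC:
  fixes u :: "'n phase \<Rightarrow> 'n phase"
  assumes C: "C_on (Suc r) UNIV u"
    and bnd: "\<And>x v. norm (frechet_derivative u (at x) v) \<le> 1/2 * norm v"
  shows "(\<lambda>z. z + u z) \<in> CC"
proof -
  \<comment> \<open>The position part of the perturbation. It inherits the bound 1/2, so the
    position update \<open>z + ?w z\<close> has a global inverse \<open>g\<close>.\<close>
  let ?w = "\<lambda>z. (fst (u z), 0 :: real ^ 'n)"
  have dw: "frechet_derivative ?w (at x) = (\<lambda>v. (fst (frechet_derivative u (at x) v), 0))" for x
  proof (rule frechet_derivative_at[symmetric])
    show "(?w has_derivative (\<lambda>v. (fst (frechet_derivative u (at x) v), 0))) (at x)"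
      by (intro has_derivative_Pair has_derivative_fst has_derivative_const C_on_has_derivative[OF C])
  qed
  have w: "C_on (Suc r) UNIV ?w" by (rule C_on_Pair[OF C_on_fst[OF C] C_on_const])
  have "norm (frechet_derivative ?w (at x) v) \<le> 1/2 * norm v" for x v
  proof -
    have "norm (fst p) \<le> norm p" for p :: "'n phase" by (metis norm_fst_le prod.collapse)
    from order_trans[OF this bnd[of x v]] show ?thesis unfolding dw by (simp add: norm_Pair)
  qed
  then obtain g where g: "\<And>x. g (x + ?w x) = x" "C_on (Suc r) UNIV g"
    using near_identity_inverse[OF w] by metis
  have le: "r \<le> Suc r" by simp
  have \<psi>: "C_on r UNIV (\<lambda>z. z + u z)" by (rule C_on_add[OF C_on_ident C_on_mono[OF C le]])
  have 1: "(\<lambda>z. (fst (z + u z), snd z)) \<in> CC" by (rule position_update[OF C_on_fst[OF \<psi>]])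
  \<comment> \<open>After the position update \<open>g\<close> recovers the original
    \<open>z\<close>, so the desired momentum is a function of the current point.\<close>
  have 2: "(\<lambda>y. (fst y, snd (g y + u (g y)))) \<in> CC"
    by (rule momentum_update[OF C_on_snd[OF C_on_compose[OF \<psi> C_on_mono[OF g(2) le]]]])
  have "(fst (z + u z), snd z) = z + ?w z" for z by (simp add: prod_eq_iff)
  then have "g (fst (z + u z), snd z) = z" for z using g(1) by metis
  moreover have "(fst z + fst (u z), snd z + snd (u z)) = z + u z" for z by (simp add: prod_eq_iff)
  ultimately show ?thesis using CC_compose[OF 2 1] by simp
qed

end

section \<open>Approximation of diffeomorphisms\<close>

lemma norm_linear_le_basis:
  fixes L :: "'a::euclidean_space \<Rightarrow> 'b::real_normed_vector"
  assumes "linear L" "\<And>b. b \<in> Basis \<Longrightarrow> norm (L b) \<le> c"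
  shows "norm (L v) \<le> real DIM('a) * c * norm v"
proof -
  have "norm (L v) \<le> (\<Sum>b\<in>Basis. norm ((v \<bullet> b) *\<^sub>R L b))"
    by (subst linear_basis_expand[OF assms(1)]) (rule norm_sum)
  also have "\<dots> \<le> (\<Sum>b\<in>(Basis :: 'a set). norm v * c)"
  proof (rule sum_mono)
    fix b :: 'a assume b: "b \<in> Basis"
    have "\<bar>v \<bullet> b\<bar> * norm (L b) \<le> norm v * c"
      by (intro mult_mono Basis_le_norm assms(2) b) auto
    then show "norm ((v \<bullet> b) *\<^sub>R L b) \<le> norm v * c" by simp
  qed
  finally show ?thesis by (simp add: algebra_simps)
qed

lemma derivative_bounded_on_compact:
  fixes f :: "'a::euclidean_space \<Rightarrow> 'b::real_normed_vector"
  assumes "C_on (Suc k) UNIV f" "compact K"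
  obtains M where "M > 0" "\<And>x v. x \<in> K \<Longrightarrow> norm (frechet_derivative f (at x) v) \<le> M * norm v"
proof -
  have "\<exists>B>0. \<forall>x\<in>K. norm (frechet_derivative f (at x) b) \<le> B" for b
  proof -
    have "C_on k UNIV (\<lambda>x. frechet_derivative f (at x) b)" using assms(1) by simp
    then have "compact ((\<lambda>x. frechet_derivative f (at x) b) ` K)"
      by (intro compact_continuous_image assms(2) continuous_on_subset[OF C_on_continuous]) auto
    then have "bounded ((\<lambda>x. frechet_derivative f (at x) b) ` K)" by (rule compact_imp_bounded)
    then show ?thesis unfolding bounded_pos by auto
  qed
  then obtain B where B: "\<And>b. B b > 0" "\<And>b x. x \<in> K \<Longrightarrow> norm (frechet_derivative f (at x) b) \<le> B b"
    by metis
  let ?c = "\<Sum>b\<in>(Basis :: 'a set). B b"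
  have c: "?c > 0" by (rule sum_pos) (use B in auto)
  have Bc: "B b \<le> ?c" if "b \<in> Basis" for b
    using that B(1) by (intro member_le_sum) (auto intro: less_imp_le)
  have "norm (frechet_derivative f (at x) v) \<le> real DIM('a) * ?c * norm v" if "x \<in> K" for x v
    by (rule norm_linear_le_basis[OF has_derivative_linear[OF C_on_has_derivative[OF assms(1)]]
          order_trans[OF B(2)[OF that] Bc]])
  moreover have "real DIM('a) * ?c > 0" using c by simp
  ultimately show thesis using that by blast
qed

lemma derivative_uniformly_continuous:
  fixes f :: "'a::euclidean_space \<Rightarrow> 'b::real_normed_vector"
  assumes "C_on (Suc k) UNIV f" "compact K" "e > 0"
  obtains d where "d > 0" "\<And>x y v. x \<in> K \<Longrightarrow> y \<in> K \<Longrightarrow> dist x y < d \<Longrightarrow>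
     norm (frechet_derivative f (at x) v - frechet_derivative f (at y) v) \<le> e * norm v"
proof -
  let ?e = "e / real DIM('a)"
  have e: "?e > 0" using assms(3) by simp
  have "\<exists>d>0. \<forall>x\<in>K. \<forall>y\<in>K. dist x y < d \<longrightarrow>
     norm (frechet_derivative f (at x) b - frechet_derivative f (at y) b) \<le> ?e" for b
  proof -
    have "C_on k UNIV (\<lambda>x. frechet_derivative f (at x) b)" using assms(1) by simp
    then have "uniformly_continuous_on K (\<lambda>x. frechet_derivative f (at x) b)"
      by (intro compact_uniformly_continuous assms(2) continuous_on_subset[OF C_on_continuous]) auto
    then obtain d where "d > 0" "\<And>x y. x \<in> K \<Longrightarrow> y \<in> K \<Longrightarrow> dist y x < d \<Longrightarrow>
        dist (frechet_derivative f (at y) b) (frechet_derivative f (at x) b) < ?e"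
      using e unfolding uniformly_continuous_on_def by meson
    then show ?thesis by (metis dist_norm less_imp_le)
  qed
  then obtain d where d: "\<And>b. d b > 0" "\<And>b x y. x \<in> K \<Longrightarrow> y \<in> K \<Longrightarrow> dist x y < d b \<Longrightarrow>
     norm (frechet_derivative f (at x) b - frechet_derivative f (at y) b) \<le> ?e" by metis
  let ?d = "Min (d ` (Basis :: 'a set))"
  have "norm (frechet_derivative f (at x) v - frechet_derivative f (at y) v) \<le> e * norm v"
    if xy: "x \<in> K" "y \<in> K" "dist x y < ?d" for x y v
  proof -
    let ?L = "\<lambda>v. frechet_derivative f (at x) v - frechet_derivative f (at y) v"
    have lin: "linear ?L"
      by (intro linear_compose_sub has_derivative_linear[OF C_on_has_derivative[OF assms(1)]])
    have b: "norm (?L b) \<le> ?e" if "b \<in> Basis" for b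
      using xy that by (intro d(2)) auto
    from norm_linear_le_basis[OF lin b, of v] show ?thesis by simp
  qed
  moreover have "?d > 0" using d(1) by simp
  ultimately show thesis using that by blast
qed

context LDE_approximation
begin

text \<open>Closeness is assumed on a ball only, so the deviation from the identity is cut off to be
  small everywhere. That \<delta> is fixed before \<psi> matters: the number of steps in the isotopy
  is determined from it.\<close>

lemma near_identity_local:
  assumes R: "R > 0"
  obtains \<delta> where "\<delta> > 0"
    "\<And>\<psi> :: 'n phase \<Rightarrow> 'n phase. C_on (Suc r) UNIV \<psi> \<Longrightarrow> \<psi> 0 = 0 \<Longrightarrow>
       (\<And>y v. norm y \<le> 2 * R \<Longrightarrow> norm (frechet_derivative \<psi> (at y) v - v) \<le> \<delta> * norm v) \<Longrightarrow>
       \<exists>\<Psi>\<in>CC. \<forall>y. norm y \<le> R \<longrightarrow> \<Psi> y = \<psi> y"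
proof -
  obtain \<beta> :: "'n phase \<Rightarrow> real" where \<beta>: "C_on (Suc r) UNIV \<beta>" "\<And>x. norm x \<le> R \<Longrightarrow> \<beta> x = 1"
     "\<And>x. norm x \<ge> 2 * R \<Longrightarrow> \<beta> x = 0" "\<And>x. 0 \<le> \<beta> x" "\<And>x. \<beta> x \<le> 1"
    using bump_function[OF R, where k = "Suc r" and 'a = "'n phase"] by metis
  obtain M where M: "M > 0"
    "\<And>x v. x \<in> cball 0 (2 * R) \<Longrightarrow> norm (frechet_derivative \<beta> (at x) v) \<le> M * norm v"
    using derivative_bounded_on_compact[OF \<beta>(1) compact_cball] by metis
  \<comment> \<open>The cut-off perturbation has derivative at most
    \<open>\<delta> + M * (\<delta> * (2 * R))\<close>: the second term is the derivative of the
    bump times the deviation of \<psi> from the identity, estimated from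
    \<open>\<psi> 0 = 0\<close>. This \<delta> makes the total 1/2.\<close>
  define \<delta> where "\<delta> = 1 / (2 * (1 + M * (2 * R)))"
  have MR: "1 + M * (2 * R) > 0" using M(1) R by (simp add: add_pos_pos)
  have \<delta>: "\<delta> > 0" "\<delta> * (1 + M * (2 * R)) = 1/2" unfolding \<delta>_def using MR by auto
  have "\<exists>\<Psi>\<in>CC. \<forall>y. norm y \<le> R \<longrightarrow> \<Psi> y = \<psi> y"
    if \<psi>: "C_on (Suc r) UNIV \<psi>" "\<psi> 0 = 0"
      and D: "\<And>y v. norm y \<le> 2 * R \<Longrightarrow> norm (frechet_derivative \<psi> (at y) v - v) \<le> \<delta> * norm v"
    for \<psi> :: "'n phase \<Rightarrow> 'n phase"
  proof -
    have d\<psi>: "((\<lambda>z. \<psi> z - z) has_derivative (\<lambda>v. frechet_derivative \<psi> (at y) v - v)) (at y)" for y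
      by (intro has_derivative_diff has_derivative_ident C_on_has_derivative[OF \<psi>(1)])
    have small: "norm (\<psi> y - y) \<le> \<delta> * (2 * R)" if y: "norm y \<le> 2 * R" for y
    proof -
      have "norm ((\<psi> y - y) - (\<psi> 0 - 0)) \<le> \<delta> * norm (y - 0)"
      proof (rule differentiable_bound[of "cball 0 (2 * R)"])
        show "((\<lambda>z. \<psi> z - z) has_derivative (\<lambda>v. frechet_derivative \<psi> (at x) v - v)) (at x within cball 0 (2 * R))" for x
          by (rule has_derivative_at_withinI[OF d\<psi>])
        show "onorm (\<lambda>v. frechet_derivative \<psi> (at x) v - v) \<le> \<delta>" if "x \<in> cball 0 (2 * R)" for x
          using that by (intro onorm_le D) simp
      qed (use y R in auto)
      also have "\<dots> \<le> \<delta> * (2 * R)" using y \<delta> by (intro mult_left_mono) auto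
      finally show ?thesis using \<psi>(2) by simp
    qed
    let ?u = "\<lambda>y. \<beta> y *\<^sub>R (\<psi> y - y)"
    have u: "C_on (Suc r) UNIV ?u"
      by (rule C_on_scaleR[OF \<beta>(1) C_on_diff[OF \<psi>(1) C_on_ident]])
    have "norm (frechet_derivative ?u (at y) v) \<le> 1/2 * norm v" for y v
    proof (cases "norm y \<le> 2 * R")
      case True
      have du: "(?u has_derivative (\<lambda>v. \<beta> y *\<^sub>R (frechet_derivative \<psi> (at y) v - v)
          + frechet_derivative \<beta> (at y) v *\<^sub>R (\<psi> y - y))) (at y)"
        by (rule has_derivative_scaleR[OF C_on_has_derivative[OF \<beta>(1)] d\<psi>])
      have "frechet_derivative ?u (at y) v = \<beta> y *\<^sub>R (frechet_derivative \<psi> (at y) v - v)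
          + frechet_derivative \<beta> (at y) v *\<^sub>R (\<psi> y - y)"
        by (simp only: frechet_derivative_at[OF du, symmetric])
      then have "norm (frechet_derivative ?u (at y) v) \<le> \<bar>\<beta> y\<bar> * norm (frechet_derivative \<psi> (at y) v - v)
          + norm (frechet_derivative \<beta> (at y) v) * norm (\<psi> y - y)"
        using norm_triangle_ineq[of "\<beta> y *\<^sub>R (frechet_derivative \<psi> (at y) v - v)"
            "frechet_derivative \<beta> (at y) v *\<^sub>R (\<psi> y - y)"]
        by (simp only: norm_scaleR real_norm_def)
      also have "\<dots> \<le> 1 * (\<delta> * norm v) + (M * norm v) * (\<delta> * (2 * R))"
        using True \<beta>(4,5) M R by (intro add_mono mult_mono D small) auto
      also have "\<dots> = \<delta> * (1 + M * (2 * R)) * norm v" by (simp add: algebra_simps)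
      finally show ?thesis using \<delta>(2) by simp
    next
      case False
      have "open {y :: 'n phase. 2 * R < norm y}" by (intro open_Collect_less continuous_intros)
      from frechet_derivative_cong_open[OF this, of y ?u "\<lambda>_. 0"]
      have "frechet_derivative ?u (at y) = frechet_derivative (\<lambda>_. 0) (at y)"
        using False \<beta>(3) by simp
      then show ?thesis by simp
    qed
    from near_identity_in_CC[OF u this]
    show ?thesis by (rule bexI[rotated]) (use \<beta>(2) in simp)
  qed
  then show thesis using that \<delta>(1) by blast
qed

lemma translation_in_CC: "(\<lambda>z. z + c) \<in> CC"
proof -
  have "norm (frechet_derivative (\<lambda>_ :: 'n phase. c) (at x) v) \<le> 1/2 * norm v" for x v by simp
  from near_identity_in_CC[OF C_on_const this] show ?thesis .
qed

text \<open>
  The isotopy \<open>s \<mapsto> (x \<mapsto> \<phi> (s x) / s)\<close> joins the derivative of \<open>\<phi>\<close> at the fixed point \<open>0\<close> to \<open>\<phi>\<close>.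
  Consecutive members differ by diffeomorphisms that are \<open>C\<^sup>1\<close>-close to the identity on any
  given ball, and these have been dealt with.
\<close>

lemma diffeomorphism_fixing_0_in_CC:
  fixes \<phi> \<theta> :: "'n phase \<Rightarrow> 'n phase"
  assumes inv: "\<And>x. \<theta> (\<phi> x) = x" "\<And>y. \<phi> (\<theta> y) = y"
    and C: "C_on (Suc r) UNIV \<phi>" "C_on (Suc r) UNIV \<theta>" and \<phi>0: "\<phi> 0 = 0"
  shows "\<phi> \<in> CC"
proof -
  have \<theta>0: "\<theta> 0 = 0" using inv(1)[of 0] \<phi>0 by simp
  let ?D\<phi> = "\<lambda>x. frechet_derivative \<phi> (at x)" and ?D\<theta> = "\<lambda>y. frechet_derivative \<theta> (at y)"
  have d\<phi>: "(\<phi> has_derivative ?D\<phi> x) (at x)" for x by (rule C_on_has_derivative[OF C(1)])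
  have d\<theta>: "(\<theta> has_derivative ?D\<theta> y) (at y)" for y by (rule C_on_has_derivative[OF C(2)])
  have lin: "linear (?D\<phi> x)" "linear (?D\<theta> x)" for x
    using d\<phi> d\<theta> has_derivative_linear by blast+
  have DD: "?D\<phi> (\<theta> y) (?D\<theta> y v) = v" for y v
  proof -
    have "((\<lambda>y. \<phi> (\<theta> y)) has_derivative (\<lambda>v. ?D\<phi> (\<theta> y) (?D\<theta> y v))) (at y)"
      by (rule has_derivative_compose[OF d\<theta> d\<phi>])
    then have "((\<lambda>y. y) has_derivative (\<lambda>v. ?D\<phi> (\<theta> y) (?D\<theta> y v))) (at y)" by (simp add: inv)
    from has_derivative_unique[OF this has_derivative_ident] show ?thesis by metis
  qed
  have DD': "?D\<theta> (\<phi> x) (?D\<phi> x v) = v" for x v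
  proof -
    have "((\<lambda>x. \<theta> (\<phi> x)) has_derivative (\<lambda>v. ?D\<theta> (\<phi> x) (?D\<phi> x v))) (at x)"
      by (rule has_derivative_compose[OF d\<phi> d\<theta>])
    then have "((\<lambda>x. x) has_derivative (\<lambda>v. ?D\<theta> (\<phi> x) (?D\<phi> x v))) (at x)" by (simp add: inv)
    from has_derivative_unique[OF this has_derivative_ident] show ?thesis by metis
  qed
  \<comment> \<open>At \<open>s = 0\<close> the quotient is replaced by its limit, the derivative.
    The same formula serves \<phi> and its inverse \<theta>.\<close>
  define iso where "iso g s x = (if s = 0 then frechet_derivative g (at 0) x else inverse s *\<^sub>R g (s *\<^sub>R x))"
    for g :: "'n phase \<Rightarrow> 'n phase" and s :: real and x
  \<comment> \<open>The formula has no \<open>s\<close> in a denominator and includes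
    \<open>s = 0\<close>, so all estimates hold uniformly from the start of the isotopy.\<close>
  have iso_deriv: "(iso g s has_derivative frechet_derivative g (at (s *\<^sub>R x))) (at x)"
    if "\<And>x. (g has_derivative frechet_derivative g (at x)) (at x)" for g s x
  proof (cases "s = 0")
    case True
    then show ?thesis
      using linear_imp_has_derivative[OF has_derivative_linear[OF that[of 0]]]
      by (simp add: iso_def[abs_def])
  next
    case False
    have "((\<lambda>x. g (s *\<^sub>R x)) has_derivative (\<lambda>v. frechet_derivative g (at (s *\<^sub>R x)) (s *\<^sub>R v))) (at x)"
      by (rule has_derivative_compose[OF _ that]) (auto intro!: derivative_eq_intros)
    then have "((\<lambda>x. inverse s *\<^sub>R g (s *\<^sub>R x)) has_derivative
        (\<lambda>v. inverse s *\<^sub>R frechet_derivative g (at (s *\<^sub>R x)) (s *\<^sub>R v))) (at x)"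
      by (rule has_derivative_scaleR_right)
    then show ?thesis
      using False by (simp add: iso_def[abs_def] linear_cmul[OF has_derivative_linear[OF that]])
  qed
  have iso_C: "C_on (Suc r) UNIV (iso g s)" if "C_on (Suc r) UNIV g" for g s
  proof (cases "s = 0")
    case True
    then show ?thesis
      using C_on_linear[OF has_derivative_linear[OF C_on_has_derivative[OF that]]] by (simp add: iso_def[abs_def])
  next
    case False
    have "C_on (Suc r) UNIV (\<lambda>x :: 'n phase. s *\<^sub>R x)" by (rule C_on_scaleR[OF C_on_const C_on_ident])
    from C_on_scaleR[OF C_on_const C_on_compose[OF that this], of "inverse s"]
    show ?thesis using False by (simp add: iso_def[abs_def])
  qed
  have iso_0: "iso g s 0 = 0" if "g 0 = 0" "linear (frechet_derivative g (at 0))" for g s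
    using that linear_0 by (auto simp: iso_def)
  have iso_inv: "iso \<theta> s (iso \<phi> s x) = x" for s x
    using DD'[of 0] by (auto simp: iso_def \<phi>0 inv)
  have iso_scale: "s *\<^sub>R iso \<theta> s y = \<theta> (s *\<^sub>R y)" for s y by (auto simp: iso_def \<theta>0)
  have iso_bound: "norm (iso g s x) \<le> L * norm x"
    if g: "\<And>x. (g has_derivative frechet_derivative g (at x)) (at x)" "g 0 = 0"
      and L: "\<And>x v. x \<in> cball 0 \<rho> \<Longrightarrow> norm (frechet_derivative g (at x) v) \<le> L * norm v"
      and s: "0 \<le> s" "s \<le> 1" and x: "norm x \<le> \<rho>" for g s x L \<rho>
  proof -
    have "norm (iso g s x - iso g s 0) \<le> L * norm (x - 0)"
    proof (rule differentiable_bound[of "cball 0 \<rho>"])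
      show "(iso g s has_derivative frechet_derivative g (at (s *\<^sub>R z))) (at z within cball 0 \<rho>)" for z
        by (rule has_derivative_at_withinI[OF iso_deriv[OF g(1)]])
      show "onorm (frechet_derivative g (at (s *\<^sub>R z))) \<le> L" if "z \<in> cball 0 \<rho>" for z
      proof (intro onorm_le L)
        have "s * norm z \<le> 1 * norm z" using s by (intro mult_right_mono) auto
        then show "s *\<^sub>R z \<in> cball 0 \<rho>" using that s by simp
      qed
    qed (use x order_trans[OF norm_ge_zero x] in auto)
    then show ?thesis using iso_0[OF g(2) has_derivative_linear[OF g(1)]] by simp
  qed
  have "\<exists>\<Phi>\<in>CC. \<forall>x\<in>ball 0 R. \<Phi> x = \<phi> x" for R
  proof -
    define R0 where "R0 = max R 1"
    have R0: "R0 > 0" "R \<le> R0" by (auto simp: R0_def)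
    obtain L where L: "L > 0" "\<And>x v. x \<in> cball 0 R0 \<Longrightarrow> norm (?D\<phi> x v) \<le> L * norm v"
      using derivative_bounded_on_compact[OF C(1) compact_cball] by metis
    \<comment> \<open>All members of the isotopy map the ball of radius \<open>R0\<close> into the
      ball of radius \<open>R1\<close>, where the corrections have to be exact.\<close>
    define R1 where "R1 = L * R0"
    have R1: "R1 > 0" using L(1) R0(1) by (simp add: R1_def)
    obtain \<delta> where \<delta>: "\<delta> > 0"
      "\<And>\<psi> :: 'n phase \<Rightarrow> 'n phase. C_on (Suc r) UNIV \<psi> \<Longrightarrow> \<psi> 0 = 0 \<Longrightarrow>
       (\<And>y v. norm y \<le> 2 * R1 \<Longrightarrow> norm (frechet_derivative \<psi> (at y) v - v) \<le> \<delta> * norm v) \<Longrightarrow>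
       \<exists>\<Psi>\<in>CC. \<forall>y. norm y \<le> R1 \<longrightarrow> \<Psi> y = \<psi> y"
      using near_identity_local[OF R1] by metis
    obtain L' where L': "L' > 0" "\<And>x v. x \<in> cball 0 (2 * R1) \<Longrightarrow> norm (?D\<theta> x v) \<le> L' * norm v"
      using derivative_bounded_on_compact[OF C(2) compact_cball] by metis
    \<comment> \<open>The inverse members map the ball of radius \<open>2 * R1\<close>, on which
      closeness to the identity is required, into the ball of radius \<open>c\<close>.\<close>
    define c where "c = L' * (2 * R1)"
    have c: "c > 0" using L'(1) R1 by (simp add: c_def)
    \<comment> \<open>The derivative of \<theta> will contribute a factor \<open>L'\<close>, for
      which this tolerance compensates.\<close>
    have "\<delta> / L' > 0" using \<delta>(1) L'(1) by simp
    from derivative_uniformly_continuous[OF C(1) compact_cball this, of 0 c]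
    obtain d where d: "d > 0" "\<And>x y v. x \<in> cball 0 c \<Longrightarrow> y \<in> cball 0 c \<Longrightarrow> dist x y < d \<Longrightarrow>
       norm (?D\<phi> x v - ?D\<phi> y v) \<le> \<delta> / L' * norm v" by metis
    \<comment> \<open>One step of length \<open>1 / N\<close> then moves
      \<open>s *\<^sub>R x\<close> by less than \<open>d\<close> whenever
      \<open>norm x \<le> c\<close>.\<close>
    obtain N :: nat where N: "c / d < real N" using reals_Archimedean2 by blast
    have "0 < c / d" using c d(1) by simp
    then have N0: "N > 0" using N by (metis less_trans of_nat_0_less_iff)
    have "j \<le> N \<Longrightarrow> \<exists>\<Phi>\<in>CC. \<forall>x. norm x \<le> R0 \<longrightarrow> \<Phi> x = iso \<phi> (real j / real N) x" for j
    proof (induction j)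
      case 0
      have "surj (?D\<phi> 0)" 
        by (rule surjI[where f = "?D\<theta> 0"]) (use DD[of 0] \<theta>0 in simp)
      from linear_in_CC[OF lin(1) this] have "?D\<phi> 0 \<in> CC" .
      then show ?case by (rule bexI[rotated]) (simp add: iso_def)
    next
      case (Suc j)
      define s s' where "s = real j / real N" and "s' = real (Suc j) / real N"
      have s: "0 \<le> s" "s \<le> 1" "0 \<le> s'" "s' \<le> 1" "s' - s = 1 / real N"
        using Suc.prems N0 by (auto simp: s_def s'_def field_simps)
      obtain \<Phi> where \<Phi>: "\<Phi> \<in> CC" "\<And>x. norm x \<le> R0 \<Longrightarrow> \<Phi> x = iso \<phi> s x"
        using Suc unfolding s_def by auto
      let ?\<psi> = "\<lambda>y. iso \<phi> s' (iso \<theta> s y)"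
      have \<psi>C: "C_on (Suc r) UNIV ?\<psi>" by (rule C_on_compose[OF iso_C[OF C(1)] iso_C[OF C(2)]])
      have \<psi>0: "?\<psi> 0 = 0" by (simp add: iso_0 \<phi>0 \<theta>0 lin)
      have \<psi>D: "norm (frechet_derivative ?\<psi> (at y) v - v) \<le> \<delta> * norm v" if y: "norm y \<le> 2 * R1" for y v
      proof -
        let ?x = "iso \<theta> s y"
        have d\<psi>: "(?\<psi> has_derivative (\<lambda>v. ?D\<phi> (s' *\<^sub>R ?x) (?D\<theta> (s *\<^sub>R y) v))) (at y)"
          by (rule has_derivative_compose[OF iso_deriv[OF d\<theta>] iso_deriv[OF d\<phi>]])
        have "frechet_derivative ?\<psi> (at y) v = ?D\<phi> (s' *\<^sub>R ?x) (?D\<theta> (s *\<^sub>R y) v)"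
          by (simp only: frechet_derivative_at[OF d\<psi>, symmetric])
        \<comment> \<open>Here \<open>s *\<^sub>R ?x\<close> is \<theta> of
          \<open>s *\<^sub>R y\<close>, so the two derivatives are inverse to each other. The
          deviation of the derivative from the identity becomes a difference of derivatives of
          \<phi> at nearby points.\<close>
        moreover have "v = ?D\<phi> (s *\<^sub>R ?x) (?D\<theta> (s *\<^sub>R y) v)" by (simp add: iso_scale DD)
        ultimately have eq: "norm (frechet_derivative ?\<psi> (at y) v - v) =
            norm (?D\<phi> (s' *\<^sub>R ?x) (?D\<theta> (s *\<^sub>R y) v) - ?D\<phi> (s *\<^sub>R ?x) (?D\<theta> (s *\<^sub>R y) v))"
          by metis
        have "norm ?x \<le> L' * norm y" by (rule iso_bound[OF d\<theta> \<theta>0 L'(2) s(1,2) y])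
        also have "\<dots> \<le> c" unfolding c_def using y L'(1) by (intro mult_left_mono) auto
        finally have xc: "norm ?x \<le> c" .
        have in_ball: "t *\<^sub>R ?x \<in> cball 0 c" if "0 \<le> t" "t \<le> 1" for t
        proof -
          have "t * norm ?x \<le> 1 * norm ?x" using that by (intro mult_right_mono) auto
          then show ?thesis using that xc by simp
        qed
        have "dist (s' *\<^sub>R ?x) (s *\<^sub>R ?x) = norm ((s' - s) *\<^sub>R ?x)"
          by (simp add: dist_norm algebra_simps)
        also have "\<dots> = norm ?x / real N" unfolding s(5) by simp
        also have "\<dots> \<le> c / real N" using xc by (intro divide_right_mono) auto
        also have "\<dots> < d" using N N0 d(1) by (simp add: field_simps)
        finally have "norm (frechet_derivative ?\<psi> (at y) v - v) \<le> \<delta> / L' * norm (?D\<theta> (s *\<^sub>R y) v)"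
          unfolding eq by (intro d(2) in_ball s)
        also have "norm (?D\<theta> (s *\<^sub>R y) v) \<le> L' * norm v"
        proof (rule L'(2))
          have "s * norm y \<le> 1 * norm y" using s by (intro mult_right_mono) auto
          then show "s *\<^sub>R y \<in> cball 0 (2 * R1)" using y s by simp
        qed
        then have "\<delta> / L' * norm (?D\<theta> (s *\<^sub>R y) v) \<le> \<delta> / L' * (L' * norm v)"
          using \<delta>(1) L'(1) by (intro mult_left_mono) auto
        also have "\<dots> = \<delta> * norm v" using L'(1) by simp
        finally show ?thesis .
      qed
      obtain \<Psi> where \<Psi>: "\<Psi> \<in> CC" "\<And>y. norm y \<le> R1 \<Longrightarrow> \<Psi> y = ?\<psi> y"
        using \<delta>(2)[OF \<psi>C \<psi>0 \<psi>D] by blast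
      \<comment> \<open>\<open>\<Phi> x\<close> lies in the ball where \<Psi> equals the transition
        map, so the identity is exact and no error accumulates over the steps.\<close>
      have "\<Psi> (\<Phi> x) = iso \<phi> s' x" if x: "norm x \<le> R0" for x
      proof -
        have "norm (iso \<phi> s x) \<le> L * norm x" by (rule iso_bound[OF d\<phi> \<phi>0 L(2) s(1,2) x])
        also have "\<dots> \<le> R1" unfolding R1_def using x L(1) by (intro mult_left_mono) auto
        finally show ?thesis using \<Psi>(2) \<Phi>(2)[OF x] by (simp add: iso_inv)
      qed
      then show ?case
        unfolding s'_def by (intro bexI[OF _ CC_compose[OF \<Psi>(1) \<Phi>(1)]]) simp
    qed
    from this[of N] have "\<exists>\<Phi>\<in>CC. \<forall>x. norm x \<le> R0 \<longrightarrow> \<Phi> x = iso \<phi> 1 x"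
      using N0 by simp
    then obtain \<Phi> where \<Phi>: "\<Phi> \<in> CC" "\<And>x. norm x \<le> R0 \<Longrightarrow> \<Phi> x = iso \<phi> 1 x" by blast
    have "\<Phi> x = \<phi> x" if "x \<in> ball 0 R" for x
      using \<Phi>(2)[of x] that R0(2) by (simp add: iso_def)
    then show ?thesis using \<Phi>(1) by blast
  qed
  then show ?thesis
    unfolding CC by (intro C_closure_local C_on_mono[OF C(1)]) simp_all
qed

text \<open>The isotopy needs a fixed point at the origin; subtracting \<open>\<phi> 0\<close>
  creates it, and a translation undoes this.\<close>

lemma diffeomorphism_in_CC:
  assumes "diffeomorphism (Suc r) \<phi>"
  shows "\<phi> \<in> CC"
proof -
  have \<phi>: "bij \<phi>" "C_on (Suc r) UNIV \<phi>" "C_on (Suc r) UNIV (inv \<phi>)"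
    using assms by (auto simp: diffeomorphism_def)
  let ?c = "\<phi> 0"
  have "(\<lambda>x. \<phi> x - ?c) \<in> CC"
  proof (rule diffeomorphism_fixing_0_in_CC)
    show "C_on (Suc r) UNIV (\<lambda>x. \<phi> x - ?c)" by (rule C_on_diff[OF \<phi>(2) C_on_const])
    show "C_on (Suc r) UNIV (\<lambda>y. inv \<phi> (y + ?c))"
      by (rule C_on_compose[OF \<phi>(3) C_on_add[OF C_on_ident C_on_const]])
    show "inv \<phi> (\<phi> x - ?c + ?c) = x" for x using \<phi>(1) by (simp add: bij_is_inj)
    show "\<phi> (inv \<phi> (y + ?c)) - ?c = y" for y using \<phi>(1) by (simp add: bij_is_surj surj_f_inv_f)
  qed simp
  from CC_compose[OF translation_in_CC[of ?c] this] show ?thesis by simp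
qed

end

section \<open>The \<open>C\<^sup>r\<close> norm\<close>

lemma iter_deriv_sum:
  assumes "finite B" "\<And>b. b \<in> B \<Longrightarrow> C_on (length vs) UNIV (g b)"
  shows "iter_deriv UNIV (\<lambda>x. \<Sum>b\<in>B. c b *\<^sub>R g b x) vs x = (\<Sum>b\<in>B. c b *\<^sub>R iter_deriv UNIV (g b) vs x)"
  using assms(2)
proof (induction vs arbitrary: g)
  case (Cons v vs)
  have "frechet_derivative (\<lambda>x. \<Sum>b\<in>B. c b *\<^sub>R g b x) (at x) =
      (\<lambda>v. \<Sum>b\<in>B. c b *\<^sub>R frechet_derivative (g b) (at x) v)" for x
  proof (rule frechet_derivative_at[symmetric])
    have "C_on (Suc (length vs)) UNIV (g b)" if "b \<in> B" for b using Cons.prems[OF that] by simp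
    then show "((\<lambda>x. \<Sum>b\<in>B. c b *\<^sub>R g b x) has_derivative
       (\<lambda>v. \<Sum>b\<in>B. c b *\<^sub>R frechet_derivative (g b) (at x) v)) (at x)"
      by (intro has_derivative_sum has_derivative_scaleR_right C_on_has_derivative)
  qed
  then show ?case using Cons by simp
qed simp

lemma iter_deriv_diff:
  assumes "C_on (length vs) UNIV f" "C_on (length vs) UNIV g"
  shows "iter_deriv UNIV (\<lambda>x. f x - g x) vs x = iter_deriv UNIV f vs x - iter_deriv UNIV g vs x"
  using assms
proof (induction vs arbitrary: f g)
  case (Cons v vs)
  have fg: "C_on (Suc (length vs)) UNIV f" "C_on (Suc (length vs)) UNIV g" using Cons.prems by simp_all
  have "frechet_derivative (\<lambda>x. f x - g x) (at x) =
      (\<lambda>v. frechet_derivative f (at x) v - frechet_derivative g (at x) v)" for x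
    by (rule frechet_derivative_at[symmetric])
      (intro has_derivative_diff C_on_has_derivative[OF fg(1)] C_on_has_derivative[OF fg(2)])
  then show ?case using Cons by simp
qed simp

text \<open>Expanding one direction in the basis gives as many terms as the dimension, with
  coefficients of absolute value at most 1; every direction contributes one such factor.\<close>

lemma norm_iter_deriv_le_basis:
  fixes u :: "'a::euclidean_space \<Rightarrow> 'b::real_normed_vector"
  assumes "C_on (length vs) UNIV u" "\<And>v. v \<in> set vs \<Longrightarrow> norm v \<le> 1"
    and "\<And>bs. set bs \<subseteq> Basis \<Longrightarrow> length bs = length vs \<Longrightarrow> norm (iter_deriv UNIV u bs x) \<le> e"
  shows "norm (iter_deriv UNIV u vs x) \<le> real DIM('a) ^ length vs * e"
  using assms
proof (induction vs arbitrary: u)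
  case Nil
  then show ?case by simp
next
  case (Cons v vs)
  have C: "C_on (Suc (length vs)) UNIV u" using Cons.prems(1) by simp
  have Cb: "C_on (length vs) UNIV (\<lambda>x. frechet_derivative u (at x) b)" for b using C by simp
  let ?g = "\<lambda>b. iter_deriv UNIV (\<lambda>x. frechet_derivative u (at x) b) vs x"
  have "(\<lambda>x. frechet_derivative u (at x) v) = (\<lambda>x. \<Sum>b\<in>Basis. (v \<bullet> b) *\<^sub>R frechet_derivative u (at x) b)"
    using linear_basis_expand[OF has_derivative_linear[OF C_on_has_derivative[OF C]]] by blast
  then have "norm (iter_deriv UNIV u (v # vs) x) = norm (\<Sum>b\<in>Basis. (v \<bullet> b) *\<^sub>R ?g b)"
    using iter_deriv_sum[where g = "\<lambda>b x. frechet_derivative u (at x) b", OF finite_Basis Cb] by simp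
  also have "\<dots> \<le> (\<Sum>b\<in>Basis. norm ((v \<bullet> b) *\<^sub>R ?g b))" by (rule norm_sum)
  also have "\<dots> \<le> (\<Sum>b\<in>(Basis :: 'a set). real DIM('a) ^ length vs * e)"
  proof (rule sum_mono)
    fix b :: 'a assume b: "b \<in> Basis"
    have "norm (?g b) \<le> real DIM('a) ^ length vs * e"
    proof (rule Cons.IH[OF Cb])
      show "norm (iter_deriv UNIV (\<lambda>x. frechet_derivative u (at x) b) bs x) \<le> e"
        if "set bs \<subseteq> Basis" "length bs = length vs" for bs
        using Cons.prems(3)[of "b # bs"] that b by simp
    qed (use Cons.prems(2) in auto)
    moreover have "\<bar>v \<bullet> b\<bar> \<le> 1" using Basis_le_norm[OF b, of v] Cons.prems(2)[of v] by simp
    ultimately have "\<bar>v \<bullet> b\<bar> * norm (?g b) \<le> 1 * (real DIM('a) ^ length vs * e)"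
      by (intro mult_mono) auto
    then show "norm ((v \<bullet> b) *\<^sub>R ?g b) \<le> real DIM('a) ^ length vs * e" by simp
  qed
  finally show ?case by (simp add: mult.assoc)
qed

lemma C_norm_le_of_C_close:
  fixes f g :: "'a::euclidean_space \<Rightarrow> 'b::real_normed_vector"
  assumes "C_on r UNIV f" "C_on r UNIV g" "C_close r K e g f" "e \<ge> 0"
  shows "C_norm r K (\<lambda>x. f x - g x) \<le> ennreal (real DIM('a) ^ r * e)"
proof -
  have "deriv_norm l (\<lambda>x. f x - g x) x \<le> ennreal (real DIM('a) ^ r * e)" if l: "l \<le> r" and x: "x \<in> K" for l x
    unfolding deriv_norm_def
  proof (rule SUP_least)
    fix vs assume "vs \<in> {vs :: 'a list. length vs = l \<and> (\<forall>v\<in>set vs. norm v \<le> 1)}"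
    then have vs: "length vs = l" "\<And>v. v \<in> set vs \<Longrightarrow> norm v \<le> 1" by auto
    have C: "C_on l UNIV f" "C_on l UNIV g" using C_on_mono l assms by blast+
    have "norm (iter_deriv UNIV (\<lambda>x. f x - g x) vs x) \<le> real DIM('a) ^ length vs * e"
    proof (rule norm_iter_deriv_le_basis)
      show "C_on (length vs) UNIV (\<lambda>x. f x - g x)" unfolding vs(1) by (rule C_on_diff[OF C])
      fix bs assume bs: "set bs \<subseteq> (Basis :: 'a set)" "length bs = length vs"
      have "norm (iter_deriv UNIV g bs x - iter_deriv UNIV f bs x) \<le> e"
        using assms(3) bs x vs(1) l unfolding C_close_def by simp
      then show "norm (iter_deriv UNIV (\<lambda>x. f x - g x) bs x) \<le> e"
        using iter_deriv_diff[of bs f g x] C bs vs(1) by (simp add: norm_minus_commute)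
    qed (rule vs(2))
    also have "\<dots> \<le> real DIM('a) ^ r * e"
      using l vs(1) assms(4) by (intro mult_right_mono power_increasing) (auto simp: Suc_le_eq)
    finally show "ennreal (norm (iter_deriv UNIV (\<lambda>x. f x - g x) vs x)) \<le> ennreal (real DIM('a) ^ r * e)"
      by (rule ennreal_leI)
  qed
  then show ?thesis
    unfolding C_norm_def by (intro Max.boundedI) (auto intro!: SUP_least)
qed

lemma LDE_comps_fold:
  assumes "\<Phi> \<in> LDE_comps s \<sigma>"
  shows "\<exists>(m::nat) \<Psi>. m \<ge> 1 \<and> (\<forall>i\<in>{1..m}. \<Psi> i \<in> LDE_networks s \<sigma>) \<and> \<Phi> = fold \<Psi> [1..<m + 1]"
  using assms
proof (induction rule: LDE_comps.induct)
  case (single \<Psi>)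
  then show ?case by (intro exI[of _ 1] exI[of _ "\<lambda>_. \<Psi>"]) auto
next
  case (comp \<Psi>0 \<Phi>)
  then obtain m :: nat and \<Psi> where m: "m \<ge> 1" "\<forall>i\<in>{1..m}. \<Psi> i \<in> LDE_networks s \<sigma>" "\<Phi> = fold \<Psi> [1..<m + 1]"
    by blast
  \<comment> \<open>\<open>fold\<close> applies the member with index 1 first, so the outermost map
    takes the new last index.\<close>
  let ?\<Psi> = "\<Psi>(m + 1 := \<Psi>0)"
  have "fold ?\<Psi> [1..<m + 1] = fold \<Psi> [1..<m + 1]" by (intro ext fold_cong) auto
  then have "(\<lambda>z. \<Psi>0 (\<Phi> z)) = fold ?\<Psi> [1..<m + 1 + 1]"
    using m(1,3) by (auto simp: fun_eq_iff)
  moreover have "\<forall>i\<in>{1..m + 1}. ?\<Psi> i \<in> LDE_networks s \<sigma>"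
    using m(2) comp(1) by auto
  ultimately show ?case using le_add2[of 1 m] by blast
qed

theorem theorem3p4:
  fixes r :: nat and \<sigma> :: "real \<Rightarrow> real"
    and \<phi> :: "'n::finite phase \<Rightarrow> 'n phase" and K :: "'n phase set" and \<epsilon> :: real
  assumes "\<sigma> \<in> activations (r + 2)"
    and "\<phi> \<in> LdA (r + 1)"
    and "compact K"
    and "\<epsilon> > 0"
  shows "\<exists>(m::nat) (\<Psi> :: nat \<Rightarrow> 'n phase \<Rightarrow> 'n phase). m \<ge> 1 \<and>
           (\<forall>i\<in>{1..m}. \<Psi> i \<in> LDE_networks (r + 1) \<sigma>) \<and>
           C_norm r K (\<lambda>z. \<phi> z - fold \<Psi> [1..<m + 1] z) < ennreal \<epsilon>"
proof -
  interpret LDE_approximation r \<sigma> "C_closure r (LDE_comps (Suc r) \<sigma>) :: ('n phase \<Rightarrow> 'n phase) set"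
    by unfold_locales (use assms(1) in simp)
  have "diffeomorphism (Suc r) \<phi>" using assms(2) by (simp add: LdA_def)
  then have \<phi>: "\<phi> \<in> C_closure r (LDE_comps (Suc r) \<sigma>)" by (rule diffeomorphism_in_CC)
  obtain R where "\<And>z. z \<in> K \<Longrightarrow> norm z \<le> R"
    using compact_imp_bounded[OF assms(3)] unfolding bounded_iff by blast
  then have R: "K \<subseteq> cball 0 R" by auto
  \<comment> \<open>The power of the dimension cancels the cost of general directions, and the
    factor 2 turns the resulting bound into a strict inequality.\<close>
  define e where "e = \<epsilon> / (2 * real DIM('n phase) ^ r)"
  have e: "e > 0" using assms(4) by (simp add: e_def)
  obtain \<Phi> where \<Phi>: "\<Phi> \<in> LDE_comps (Suc r) \<sigma>" "C_close r (cball 0 R) e \<Phi> \<phi>"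
    using C_closure_D[OF \<phi> e] by blast
  have "C_norm r K (\<lambda>z. \<phi> z - \<Phi> z) \<le> ennreal (real DIM('n phase) ^ r * e)"
    by (rule C_norm_le_of_C_close[OF C_closure_C_on[OF \<phi>] comps_C_on[OF \<Phi>(1)]
          C_close_subset[OF \<Phi>(2) R order_refl] less_imp_le[OF e]])
  also have "real DIM('n phase) ^ r * e = \<epsilon> / 2" by (simp add: e_def)
  also have "ennreal (\<epsilon> / 2) < ennreal \<epsilon>" using assms(4) by (simp add: ennreal_less_iff)
  finally have close: "C_norm r K (\<lambda>z. \<phi> z - \<Phi> z) < ennreal \<epsilon>" .
  obtain m :: nat and \<Psi> where "m \<ge> 1" "\<forall>i\<in>{1..m}. \<Psi> i \<in> LDE_networks (Suc r) \<sigma>" "\<Phi> = fold \<Psi> [1..<m + 1]"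
    using LDE_comps_fold[OF \<Phi>(1)] by blast
  then show ?thesis using close by auto
qed

end
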